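(* The minimal rank of primitively $2$-universal $\mathbb{Z}$-lattices is $6$.
   Context: A $\mathbb{Z}$-lattice is a finitely generated free $\mathbb{Z}$-module $L$ with a positive definite symmetric bilinear form $B:L\times L\to\mathbb{Z}$. A representation $M\to L$ is a $\mathbb{Z}$-linear map preserving $B$; it is primitive if its image is a direct summand of $L$. $L$ is primitively $2$-universal if every $\mathbb{Z}$-lattice of rank $2$ has a primitive representation into $L$. *)

theory Defs
  imports "HOL-Analysis.Analysis"
begin

context module
begin

definition finite_basis :: "'b set \<Rightarrow> bool" where
  "finite_basis S \<longleftrightarrow> finite S \<and> independent S \<and> span S = UNIV"

definition direct_summand :: "'b set \<Rightarrow> bool" where
  "direct_summand N \<longleftrightarrow> subspace N \<and>
     (\<exists>K. subspace K \<and> N \<inter> K = {0} \<and> {x + y | x y. x \<in> N \<and> y \<in> K} = UNIV)"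

end

text \<open>
  The lattice is carried by the whole type \<open>'a\<close>, on which \<open>smul\<close> is the action of the integers.
  The form takes its values in the integers, seen as a module over themselves.
\<close>

locale Z_lattice = module smul
  for smul :: "int \<Rightarrow> 'a::ab_group_add \<Rightarrow> 'a" +
  fixes B :: "'a \<Rightarrow> 'a \<Rightarrow> int"
  assumes finitely_generated_free: "\<exists>S. finite_basis S"
    and symmetric: "B x y = B y x"
    and linear_left: "module_hom smul (*) (\<lambda>x. B x y)"
    and linear_right: "module_hom smul (*) (\<lambda>y. B x y)"
    and positive_definite: "x \<noteq> 0 \<Longrightarrow> B x x > 0"

text \<open>The choice of the basis is irrelevant, see \<open>Z_rank_eq_card\<close> below.\<close>

definition Z_rank :: "(int \<Rightarrow> 'a::ab_group_add \<Rightarrow> 'a) \<Rightarrow> nat" where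
  "Z_rank smul = card (SOME S. module.finite_basis smul S)"

definition Z_representation ::
  "(int \<Rightarrow> 'b::ab_group_add \<Rightarrow> 'b) \<Rightarrow> ('b \<Rightarrow> 'b \<Rightarrow> int) \<Rightarrow>
   (int \<Rightarrow> 'a::ab_group_add \<Rightarrow> 'a) \<Rightarrow> ('a \<Rightarrow> 'a \<Rightarrow> int) \<Rightarrow> ('b \<Rightarrow> 'a) \<Rightarrow> bool" where
  "Z_representation s C smul B f \<longleftrightarrow>
     module_hom s smul f \<and> (\<forall>x y. B (f x) (f y) = C x y)"

definition primitive_representation ::
  "(int \<Rightarrow> 'b::ab_group_add \<Rightarrow> 'b) \<Rightarrow> ('b \<Rightarrow> 'b \<Rightarrow> int) \<Rightarrow>
   (int \<Rightarrow> 'a::ab_group_add \<Rightarrow> 'a) \<Rightarrow> ('a \<Rightarrow> 'a \<Rightarrow> int) \<Rightarrow> ('b \<Rightarrow> 'a) \<Rightarrow> bool" where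
  "primitive_representation s C smul B f \<longleftrightarrow>
     Z_representation s C smul B f \<and> module.direct_summand smul (range f)"

text \<open>
  A definition cannot quantify over types, so the lattices of rank 2 to be represented are taken
  on the type \<open>int^2\<close>.  By \<open>primitively_2_universal_any_type\<close> below, lattices of rank 2 on any
  other type are then primitively represented as well.
\<close>

definition primitively_2_universal ::
  "(int \<Rightarrow> 'a::ab_group_add \<Rightarrow> 'a) \<Rightarrow> ('a \<Rightarrow> 'a \<Rightarrow> int) \<Rightarrow> bool" where
  "primitively_2_universal smul B \<longleftrightarrow> Z_lattice smul B \<and>
     (\<forall>(s :: int \<Rightarrow> int^2 \<Rightarrow> int^2) C. Z_lattice s C \<and> Z_rank s = 2 \<longrightarrow>
        (\<exists>f. primitive_representation s C smul B f))"

text \<open>Two finite bases have the same size \<open>n\<close>, since the quotient modulo 2 has \<open>2 ^ n\<close> elements.\<close>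

lemma card_quotient_mod_2:
  fixes smul :: "int \<Rightarrow> 'a::ab_group_add \<Rightarrow> 'a"
  assumes "module smul" and S: "module.finite_basis smul S"
  shows "card (UNIV // {(x, y). \<exists>z. x - y = smul 2 z}) = 2 ^ card S"
proof -
  interpret module smul by fact
  define r where "r = {(x, y). \<exists>z. x - y = smul 2 z}"
  have fin: "finite S" and ind: "independent S" and sp: "span S = UNIV"
    using S by (auto simp: finite_basis_def)
  have eq: "equiv UNIV r"
  proof (rule equivI)
    show "refl r" by (auto simp: refl_on_def r_def intro: exI[of _ 0])
    show "sym r"
    proof (rule symI)
      fix x y assume "(x, y) \<in> r"
      then obtain z where "x - y = smul 2 z" by (auto simp: r_def)
      then have "y - x = smul 2 (- z)" by (metis minus_diff_eq scale_minus_right)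
      then show "(y, x) \<in> r" unfolding r_def by blast
    qed
    show "trans r"
    proof (rule transI)
      fix x y w assume "(x, y) \<in> r" "(y, w) \<in> r"
      then obtain z z' where "x - y = smul 2 z" "y - w = smul 2 z'" by (auto simp: r_def)
      then have "x - w = smul 2 (z + z')"
        by (metis add_diff_eq diff_add_cancel scale_right_distrib)
      then show "(x, w) \<in> r" unfolding r_def by blast
    qed
  qed simp
  define \<phi> where "\<phi> A = (\<Sum>v\<in>S. smul (if v \<in> A then 1 else 0) v)" for A
  have "bij_betw (\<lambda>A. r `` {\<phi> A}) (Pow S) (UNIV // r)"
    unfolding bij_betw_def
  proof
    show "inj_on (\<lambda>A. r `` {\<phi> A}) (Pow S)"
    proof (rule inj_onI)
      fix A A' assume A: "A \<in> Pow S" "A' \<in> Pow S" and "r `` {\<phi> A} = r `` {\<phi> A'}"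
      then have "(\<phi> A, \<phi> A') \<in> r" using eq by (simp add: eq_equiv_class_iff)
      then obtain z where z: "\<phi> A - \<phi> A' = smul 2 z" by (auto simp: r_def)
      obtain u where u: "z = (\<Sum>v\<in>S. smul (u v) v)"
        using sp span_finite[OF fin] by blast
      define c where
        "c v = (if v \<in> A then 1 else 0) - (if v \<in> A' then 1 else 0) - 2 * u v" for v
      have "(\<Sum>v\<in>S. smul (c v) v) = \<phi> A - \<phi> A' - smul 2 z"
        unfolding c_def \<phi>_def u scale_left_diff_distrib sum_subtractf
        by (simp add: scale_sum_right)
      then have "(\<Sum>v\<in>S. smul (c v) v) = 0" using z by simp
      then have c0: "c v = 0" if "v \<in> S" for v
        using independentD[OF ind fin subset_refl _ that] by blast
      have "v \<in> A \<longleftrightarrow> v \<in> A'" if "v \<in> S" for v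
        using c0[OF that] unfolding c_def by (auto split: if_splits) presburger+
      then show "A = A'" using A by auto
    qed
    show "(\<lambda>A. r `` {\<phi> A}) ` Pow S = UNIV // r"
    proof
      show "(\<lambda>A. r `` {\<phi> A}) ` Pow S \<subseteq> UNIV // r" by (auto intro: quotientI)
      show "UNIV // r \<subseteq> (\<lambda>A. r `` {\<phi> A}) ` Pow S"
      proof
        fix X assume "X \<in> UNIV // r"
        then obtain x where X: "X = r `` {x}" by (auto elim: quotientE)
        obtain u where u: "x = (\<Sum>v\<in>S. smul (u v) v)"
          using sp span_finite[OF fin] by blast
        define A where "A = {v \<in> S. odd (u v)}"
        have "x - \<phi> A = (\<Sum>v\<in>S. smul (u v - (if v \<in> A then 1 else 0)) v)"
          by (simp add: u \<phi>_def scale_left_diff_distrib sum_subtractf)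
        also have "\<dots> = (\<Sum>v\<in>S. smul (2 * (u v div 2)) v)"
          by (rule sum.cong) (auto simp: A_def elim: oddE evenE)
        also have "\<dots> = smul 2 (\<Sum>v\<in>S. smul (u v div 2) v)"
          by (simp add: scale_sum_right)
        finally have "(x, \<phi> A) \<in> r" by (auto simp: r_def)
        then have "X = r `` {\<phi> A}" using eq X by (simp add: eq_equiv_class_iff)
        then show "X \<in> (\<lambda>A. r `` {\<phi> A}) ` Pow S" by (auto simp: A_def)
      qed
    qed
  qed
  then show ?thesis using card_Pow[OF fin] by (simp add: r_def bij_betw_same_card[symmetric])
qed

lemma Z_rank_eq_card:
  assumes "module smul" and S: "module.finite_basis smul S"
  shows "Z_rank smul = card S"
proof -
  have "module.finite_basis smul (SOME S. module.finite_basis smul S)"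
    using S by (rule someI)
  then have "(2::nat) ^ Z_rank smul = 2 ^ card S"
    using card_quotient_mod_2[OF assms(1)] S unfolding Z_rank_def by metis
  then show ?thesis by simp
qed

lemma primitively_2_universal_any_type:
  fixes t :: "int \<Rightarrow> 'b::ab_group_add \<Rightarrow> 'b"
  assumes L: "primitively_2_universal smul B"
    and M: "Z_lattice t D" "Z_rank t = 2"
  shows "\<exists>f. primitive_representation t D smul B f"
proof -
  interpret M: Z_lattice t D by fact
  obtain S where S: "M.finite_basis S" using M.finitely_generated_free by blast
  then have "card S = 2" using Z_rank_eq_card[OF M.module_axioms S] M(2) by simp
  then obtain u v where uv: "S = {u, v}" "u \<noteq> v" by (auto simp: card_2_iff)
  define g :: "int^2 \<Rightarrow> 'b" where "g x = t (x $ 1) u + t (x $ 2) v" for x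
  have inj0: "x = 0" if "g x = 0" for x
  proof -
    define c where "c w = (if w = u then x $ 1 else x $ 2)" for w
    have "(\<Sum>w\<in>S. t (c w) w) = g x" using uv by (simp add: c_def g_def)
    then have "c w = 0" if "w \<in> S" for w
      using M.independentD[of S S c w] S that \<open>g x = 0\<close> by (auto simp: M.finite_basis_def)
    from this[of u] this[of v] show "x = 0" using uv by (auto simp: c_def vec_eq_iff forall_2)
  qed
  have g_add: "g (x + y) = g x + g y" and g_scale: "g (k *s x) = t k (g x)" for x y k
    by (simp_all add: g_def algebra_simps)
  have g_diff: "g (x - y) = g x - g y" for x y
    by (metis add_diff_cancel_right' diff_add_cancel g_add)
  have surj: "surj g"
    unfolding surj_def
  proof
    fix y
    obtain c where "y = (\<Sum>w\<in>S. t (c w) w)"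
      using S M.span_finite[of S] unfolding M.finite_basis_def by blast
    then have "y = g (vector [c u, c v])" using uv by (simp add: g_def)
    then show "\<exists>x. y = g x" ..
  qed
  have inj: "inj g"
    by (rule injI) (metis eq_iff_diff_eq_0 g_diff inj0)
  have modN: "module ((*s) :: int \<Rightarrow> int^2 \<Rightarrow> int^2)"
    by unfold_locales (auto simp: vec_eq_iff algebra_simps)
  interpret N: module "(*s) :: int \<Rightarrow> int^2 \<Rightarrow> int^2" by (rule modN)
  have basis: "N.finite_basis {axis 1 1, axis 2 1}"
  proof -
    have ne: "axis 1 1 \<noteq> (axis 2 1 :: int^2)" by (simp add: axis_eq_axis)
    have "x \<in> N.span {axis 1 1, axis 2 1}" for x :: "int^2"
    proof -
      have "x = (x $ 1) *s axis 1 1 + (x $ 2) *s axis 2 1"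
        by (simp add: vec_eq_iff forall_2 axis_def)
      then show ?thesis
        by (metis N.span_add N.span_base N.span_scale insertCI)
    qed
    moreover have "N.independent {axis 1 1, axis 2 1 :: int^2}"
      using ne by (auto simp: N.dependent_finite vec_eq_iff forall_2 axis_def)
    ultimately show ?thesis by (auto simp: N.finite_basis_def)
  qed
  have rank: "Z_rank ((*s) :: int \<Rightarrow> int^2 \<Rightarrow> int^2) = 2"
    using Z_rank_eq_card[OF modN basis] by (simp add: axis_eq_axis)
  define C where "C x y = D (g x) (g y)" for x y
  have "Z_lattice (*s) C"
  proof (intro Z_lattice.intro Z_lattice_axioms.intro)
    show "module ((*s) :: int \<Rightarrow> int^2 \<Rightarrow> int^2)" by (rule modN)
    show "\<exists>S. N.finite_basis S" using basis by blast
    have sym: "C x y = C y x" for x y unfolding C_def by (rule M.symmetric)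
    show "C x y = C y x" for x y by (rule sym)
    have left: "module_hom (*s) (*) (\<lambda>x. C x y)" for y
    proof -
      interpret h: module_hom t "(*)" "\<lambda>x. D x (g y)" by (rule M.linear_left)
      show ?thesis by unfold_locales (auto simp: C_def g_add g_scale h.add h.scale)
    qed
    show "module_hom (*s) (*) (\<lambda>x. C x y)" for y by (rule left)
    show "module_hom (*s) (*) (\<lambda>y. C x y)" for x
      using left[of x] by (simp only: sym[of x])
    show "C x x > 0" if "x \<noteq> 0" for x
      unfolding C_def using inj0 that by (intro M.positive_definite) blast
  qed
  then obtain f where f: "primitive_representation (*s) C smul B f"
    using L rank unfolding primitively_2_universal_def by blast
  interpret f: module_hom "(*s)" smul f
    using f by (simp add: primitive_representation_def Z_representation_def)
  let ?h = "inv g"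
  have gh: "g (?h y) = y" for y using surj by (rule surj_f_inv_f)
  have hg: "?h (g x) = x" for x using inj by (rule inv_f_f)
  have h_add: "?h (x + y) = ?h x + ?h y" for x y by (metis g_add gh hg)
  have h_scale: "?h (t k x) = k *s ?h x" for k x by (metis g_scale gh hg)
  have "module_hom t smul (f \<circ> ?h)"
    by unfold_locales (auto simp: h_add h_scale f.add f.scale)
  moreover have "B ((f \<circ> ?h) x) ((f \<circ> ?h) y) = D x y" for x y
    using f by (simp add: primitive_representation_def Z_representation_def C_def gh)
  moreover have "range (f \<circ> ?h) = range f"
    using inj_imp_surj_inv[OF inj] by (metis image_comp)
  ultimately have "primitive_representation t D smul B (f \<circ> ?h)"
    using f by (simp add: primitive_representation_def Z_representation_def)
  then show ?thesis by blast
qed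

end

(*
  Existence. Every unimodular positive definite lattice of rank 6 is isometric to Z^6 (Hermite
  reduction). A binary form embeds into Q^6, because by descent every indefinite ternary hermitian
  form over the Gaussian integers is isotropic. The integral vectors in the plane of this embedding
  form a lattice commensurable with the given binary lattice, and the two are connected by steps of
  prime index. In each step Z^6 is replaced by a p-neighbour, in which the new binary lattice is
  primitive. Such a neighbour is defined by a vector that is isotropic mod p and subject to linear
  conditions; for odd p it comes from the Chevalley-Warning theorem.

  Lower bound. In a primitively 2-universal lattice L of rank at most 5, representations of binary
  forms with diagonal entries at most 3 produce four orthogonal vectors that span a quaternary
  lattice whose form is anisotropic over the p-adic numbers for some prime p. The hyperplane that
  they span meets every primitive binary sublattice in a primitive vector, which excludes a
  primitive representation of p^m (x^2 + y^2) for large m.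
*)

theory Submission
  imports Defs "HOL-Number_Theory.Cong"
begin

section \<open>A group of vectors has short dual vectors\<close>

text \<open>Reduction is phrased with short dual vectors instead of determinants: in dimension n,
  the minimum of a group times the norm of a suitable dual vector is at most (4/3)^(n-1), and for a
  self-dual lattice the dual vector lies in the lattice itself. In dimension 6 this bound alone no
  longer produces a vector of norm 1; it gives norm 2, and projecting along a hexagonal sublattice
  makes up the difference. Only the Gram matrix of the binary lattice is carried along, while the
  unimodular lattice around it may change; the uniqueness of Z^6 lets every step start again in
  integral coordinates. The prime 2 is the obstacle among the neighbours: if the product of u, or of
  u + v, with every vector has the parity of that vector's norm, then no w of norm divisible by 4
  has an odd product with u and an even one with v. A preliminary 2-neighbour, which keeps the
  binary lattice, removes this. In the lower bound, two orthogonal vectors of norm 1 are available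
  from the start, and the branching is on the few products that small vectors can have with
  them.\<close>

definition add_subgroup :: "'a::ab_group_add set \<Rightarrow> bool" where
  "add_subgroup G \<longleftrightarrow> 0 \<in> G \<and> (\<forall>x\<in>G. \<forall>y\<in>G. x - y \<in> G)"

lemma add_subgroupD:
  assumes "add_subgroup G"
  shows add_subgroup_0: "0 \<in> G"
    and add_subgroup_diff: "\<And>x y. x \<in> G \<Longrightarrow> y \<in> G \<Longrightarrow> x - y \<in> G"
    and add_subgroup_minus: "\<And>x. x \<in> G \<Longrightarrow> - x \<in> G"
    and add_subgroup_add: "\<And>x y. x \<in> G \<Longrightarrow> y \<in> G \<Longrightarrow> x + y \<in> G"
proof -
  show 0: "0 \<in> G" and d: "\<And>x y. x \<in> G \<Longrightarrow> y \<in> G \<Longrightarrow> x - y \<in> G"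
    using assms by (auto simp: add_subgroup_def)
  show m: "- x \<in> G" if "x \<in> G" for x using d[OF 0 that] by simp
  show "x + y \<in> G" if "x \<in> G" "y \<in> G" for x y using d[OF that(1) m[OF that(2)]] by simp
qed

lemma add_subgroup_scale_int:
  fixes G :: "'a::real_vector set"
  assumes "add_subgroup G" "x \<in> G"
  shows "of_int k *\<^sub>R x \<in> G"
proof -
  have n: "of_nat n *\<^sub>R x \<in> G" for n
    by (induction n) (use assms in \<open>auto simp: add_subgroup_0 add_subgroup_add algebra_simps\<close>)
  show ?thesis
  proof (cases k rule: int_cases2)
    case (nonneg n)
    then show ?thesis using n[of n] by simp
  next
    case (nonpos n)
    then show ?thesis using add_subgroup_minus[OF assms(1) n[of n]] by simp
  qed
qed

lemma Ints_scale:
  fixes G :: "'a::real_vector set"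
  assumes "add_subgroup G" "x \<in> G" "c \<in> \<int>"
  shows "c *\<^sub>R x \<in> G"
  using assms add_subgroup_scale_int by (auto elim!: Ints_cases)

text \<open>An accumulation point would put two distinct members of \<open>G\<close> at distance
  below sqrt \<mu>, and their difference would be too short.\<close>

lemma finite_bounded_subgroup:
  fixes G :: "'a::euclidean_space set"
  assumes G: "add_subgroup G" and "\<mu> > 0" and \<mu>: "\<And>x. x \<in> G \<Longrightarrow> x \<noteq> 0 \<Longrightarrow> \<mu> \<le> x \<bullet> x"
  shows "finite {x \<in> G. x \<bullet> x \<le> R}"
proof (rule ccontr)
  let ?S = "{x \<in> G. x \<bullet> x \<le> R}"
  assume inf: "infinite ?S"
  have "bounded ?S"
    unfolding bounded_iff norm_eq_sqrt_inner by (intro exI[of _ "sqrt R"]) auto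
  then obtain l where "l islimpt ?S"
    using inf bounded_infinite_imp_islimpt subset_refl by metis
  then have "infinite (?S \<inter> ball l (sqrt \<mu> / 2))"
    using islimpt_eq_infinite_ball \<open>\<mu> > 0\<close> by (metis half_gt_zero real_sqrt_gt_0_iff)
  then obtain x where x: "x \<in> ?S \<inter> ball l (sqrt \<mu> / 2)"
    using infinite_imp_nonempty by blast
  have "infinite (?S \<inter> ball l (sqrt \<mu> / 2) - {x})"
    using \<open>infinite (?S \<inter> ball l (sqrt \<mu> / 2))\<close> by simp
  then obtain y where y: "y \<in> ?S \<inter> ball l (sqrt \<mu> / 2)" "y \<noteq> x"
    using infinite_imp_nonempty by blast
  have "dist x y < sqrt \<mu>"
    using x y dist_triangle_half_r[of l x "sqrt \<mu>" y] by auto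
  then have "norm (x - y) < sqrt \<mu>" by (simp add: dist_norm)
  then have "(x - y) \<bullet> (x - y) < \<mu>"
    by (simp add: norm_eq_sqrt_inner)
  moreover have "x - y \<in> G" using x y G add_subgroup_diff by blast
  ultimately show False using \<mu>[of "x - y"] y by auto
qed

lemma subgroup_minimal_vector:
  fixes G :: "'a::euclidean_space set"
  assumes G: "add_subgroup G" and "\<mu> > 0" and \<mu>: "\<And>x. x \<in> G \<Longrightarrow> x \<noteq> 0 \<Longrightarrow> \<mu> \<le> x \<bullet> x"
    and "\<not> G \<subseteq> {0}"
  obtains b where "b \<in> G" "b \<noteq> 0" "\<And>x. x \<in> G \<Longrightarrow> x \<noteq> 0 \<Longrightarrow> b \<bullet> b \<le> x \<bullet> x"
proof -
  obtain c where c: "c \<in> G" "c \<noteq> 0" using assms(4) by blast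
  let ?S = "{x \<in> G. x \<bullet> x \<le> c \<bullet> c} - {0}"
  have "finite ?S" using finite_bounded_subgroup[OF G \<open>\<mu> > 0\<close> \<mu>] by blast
  moreover have "?S \<noteq> {}" using c by auto
  ultimately obtain b where b: "b \<in> ?S" "\<And>x. x \<in> ?S \<Longrightarrow> b \<bullet> b \<le> x \<bullet> x"
    using ex_is_arg_min_if_finite[of ?S "\<lambda>x. x \<bullet> x"] unfolding is_arg_min_linorder by blast
  show ?thesis
  proof (rule that[of b])
    fix x assume "x \<in> G" "x \<noteq> 0"
    then show "b \<bullet> b \<le> x \<bullet> x" using b by (cases "x \<bullet> x \<le> c \<bullet> c") auto
  qed (use b in auto)
qed

lemma dim_orthogonal_complement_1:
  fixes V :: "'a::euclidean_space set"
  assumes V: "subspace V" and "b \<in> V" "b \<noteq> 0" "dim V = Suc n"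
  shows "subspace {x \<in> V. b \<bullet> x = 0}" "dim {x \<in> V. b \<bullet> x = 0} = n"
proof -
  show "subspace {x \<in> V. b \<bullet> x = 0}"
    using V by (auto simp: subspace_def inner_simps)
  have "{y \<in> V. \<forall>x\<in>span {b}. orthogonal x y} = {x \<in> V. b \<bullet> x = 0}"
    by (auto simp: span_singleton orthogonal_def)
  moreover have "span {b} \<subseteq> V" using assms by (simp add: span_minimal)
  moreover have "dim (span {b}) = 1" using \<open>b \<noteq> 0\<close> by simp
  ultimately show "dim {x \<in> V. b \<bullet> x = 0} = n"
    using dim_subspace_orthogonal_to_vectors[of "span {b}" V] V assms(4) by simp
qed

definition orth_proj :: "'a::euclidean_space \<Rightarrow> 'a \<Rightarrow> 'a" where
  "orth_proj b x = x - ((x \<bullet> b) / (b \<bullet> b)) *\<^sub>R b"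

lemma orth_proj_inner:
  assumes "b \<noteq> 0"
  shows "b \<bullet> orth_proj b x = 0"
    and "orth_proj b x \<bullet> orth_proj b x = x \<bullet> x - (x \<bullet> b)\<^sup>2 / (b \<bullet> b)"
  using assms by (auto simp: orth_proj_def inner_simps inner_commute field_simps power2_eq_square)

lemma orth_proj_subgroup:
  assumes V: "subspace V" "G \<subseteq> V" "add_subgroup G" "b \<in> V" "b \<noteq> 0"
  shows "orth_proj b ` G \<subseteq> {x \<in> V. b \<bullet> x = 0}" and "add_subgroup (orth_proj b ` G)"
proof -
  show "orth_proj b ` G \<subseteq> {x \<in> V. b \<bullet> x = 0}"
    using V orth_proj_inner(1)[OF V(5)]
    by (auto simp: orth_proj_def intro!: subspace_diff subspace_scale)
  have diff: "orth_proj b x - orth_proj b y = orth_proj b (x - y)" for x y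
    by (simp add: orth_proj_def inner_simps algebra_simps diff_divide_distrib)
  show "add_subgroup (orth_proj b ` G)"
    unfolding add_subgroup_def
  proof (intro conjI ballI)
    show "0 \<in> orth_proj b ` G"
      using add_subgroup_0[OF V(3)] by (intro image_eqI[of _ _ 0]) (auto simp: orth_proj_def)
  qed (use diff add_subgroup_diff[OF V(3)] in auto)
qed

text \<open>Serves the degenerate case \<open>G \<subseteq> {0}\<close> of the dual bound, where
  every vector is dual.\<close>

lemma vector_of_norm:
  fixes V :: "'a::euclidean_space set"
  assumes "subspace V" "dim V = Suc m" "c > 0"
  obtains w where "w \<in> V" "w \<noteq> 0" "w \<bullet> w = c"
proof -
  obtain v where v: "v \<in> V" "v \<noteq> 0"
    using assms(2) by (metis Suc_neq_Zero dim_eq_0 subsetI singleton_iff)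
  let ?w = "(sqrt c / norm v) *\<^sub>R v"
  have "?w \<bullet> ?w = c"
    using v assms(3) by (simp add: power2_norm_eq_inner[symmetric] power2_eq_square field_simps)
  then show ?thesis using that[of ?w] v assms by (auto simp: subspace_scale)
qed

text \<open>
  Hermite's argument: if \<open>b\<close> is a shortest vector, then the projection of \<open>G\<close> along \<open>b\<close> has
  no vectors shorter than \<open>3/4 * (b \<bullet> b)\<close>, and a vector that is orthogonal to \<open>b\<close> and dual to the
  projection is dual to \<open>G\<close>.
\<close>

lemma short_dual_vector:
  fixes V G :: "'a::euclidean_space set"
  assumes "subspace V" "dim V = Suc m" "G \<subseteq> V" "add_subgroup G" "\<mu> > 0"
    and "\<And>x. x \<in> G \<Longrightarrow> x \<noteq> 0 \<Longrightarrow> \<mu> \<le> x \<bullet> x"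
  shows "\<exists>w\<in>V. w \<noteq> 0 \<and> (\<forall>x\<in>G. w \<bullet> x \<in> \<int>) \<and> w \<bullet> w \<le> (4/3) ^ m / \<mu>"
  using assms
proof (induction m arbitrary: V G \<mu>)
  case (0 V G \<mu>)
  show ?case
  proof (cases "G \<subseteq> {0}")
    case True
    obtain w where "w \<in> V" "w \<noteq> 0" "w \<bullet> w = (4/3) ^ 0 / \<mu>"
      using vector_of_norm[OF "0.prems"(1,2), of "(4/3) ^ 0 / \<mu>"] "0.prems"(5) by auto
    then show ?thesis using True by (intro bexI[of _ w]) auto
  next
    case False
    obtain b where b: "b \<in> G" "b \<noteq> 0" "\<And>x. x \<in> G \<Longrightarrow> x \<noteq> 0 \<Longrightarrow> b \<bullet> b \<le> x \<bullet> x"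
      using subgroup_minimal_vector[OF "0.prems"(4-6) False] by metis
    have bb: "b \<bullet> b > 0" using b by simp
    have "span {b} \<subseteq> V" using b "0.prems" by (intro span_minimal) auto
    then have "span {b} = V"
      using b "0.prems" by (intro subspace_dim_equal) auto
    let ?w = "(1 / (b \<bullet> b)) *\<^sub>R b"
    have "?w \<bullet> x \<in> \<int>" if x: "x \<in> G" for x
    proof -
      obtain t where t: "x = t *\<^sub>R b"
        using x \<open>span {b} = V\<close> "0.prems"(3) by (auto simp: span_singleton)
      \<comment> \<open>The remainder after rounding is at most half of \<open>b\<close>, hence
        shorter than the minimal vector, hence 0. So \<open>G\<close> consists of the integral
        multiples of \<open>b\<close>.\<close>
      define y where "y = x - of_int (round t) *\<^sub>R b"
      have y: "y \<in> G" unfolding y_def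
        using x b "0.prems"(4) add_subgroup_diff add_subgroup_scale_int by blast
      have yt: "y = (t - of_int (round t)) *\<^sub>R b" by (simp add: y_def t algebra_simps)
      have "\<bar>t - of_int (round t)\<bar> \<le> 1/2"
        using of_int_round_abs_le[of t] by (simp add: abs_minus_commute)
      then have "(t - of_int (round t))\<^sup>2 \<le> (1/2)\<^sup>2" 
        by (metis abs_ge_zero power2_abs power_mono)
      then have "y \<bullet> y \<le> (1/4) * (b \<bullet> b)"
        using bb by (simp add: yt power2_eq_square[symmetric] mult.assoc[symmetric] power_divide)
      then have "y = 0" using b(3)[OF y] bb by fastforce
      then have "t = of_int (round t)" using yt b(2) by simp
      then show ?thesis using bb t by (simp, metis Ints_of_int)
    qed
    moreover have "?w \<bullet> ?w \<le> 1 / \<mu>"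
      using bb "0.prems"(5) "0.prems"(6)[OF b(1,2)] by (simp add: field_simps)
    ultimately show ?thesis
      using b bb "0.prems" by (intro bexI[of _ ?w]) (auto simp: subspace_scale)
  qed
next
  case (Suc m V G \<mu>)
  show ?case
  proof (cases "G \<subseteq> {0}")
    case True
    obtain w where "w \<in> V" "w \<noteq> 0" "w \<bullet> w = (4/3) ^ Suc m / \<mu>"
      using vector_of_norm[OF Suc.prems(1,2), of "(4/3) ^ Suc m / \<mu>"] Suc.prems(5) by auto
    then show ?thesis using True by (intro bexI[of _ w]) auto
  next
    case False
    obtain b where b: "b \<in> G" "b \<noteq> 0" "\<And>x. x \<in> G \<Longrightarrow> x \<noteq> 0 \<Longrightarrow> b \<bullet> b \<le> x \<bullet> x"
      using subgroup_minimal_vector[OF Suc.prems(4-6) False] by metis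
    have bb: "b \<bullet> b > 0" using b by simp
    have bV: "b \<in> V" using b Suc.prems by blast
    define \<pi> where "\<pi> = orth_proj b"
    let ?W = "{x \<in> V. b \<bullet> x = 0}"
    note W = dim_orthogonal_complement_1[OF Suc.prems(1) bV b(2) Suc.prems(2)]
    note sub = orth_proj_subgroup(1)[OF Suc.prems(1,3,4) bV b(2), folded \<pi>_def]
      and grp = orth_proj_subgroup(2)[OF Suc.prems(1,3,4) bV b(2), folded \<pi>_def]
    have min: "3/4 * (b \<bullet> b) \<le> y \<bullet> y" if y: "y \<in> \<pi> ` G" "y \<noteq> 0" for y
    proof -
      obtain x where x: "x \<in> G" "y = \<pi> x" using y by blast
      define t where "t = (x \<bullet> b) / (b \<bullet> b)"
      define x' where "x' = x - of_int (round t) *\<^sub>R b"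
      have x': "x' \<in> G" unfolding x'_def
        using x b Suc.prems(4) add_subgroup_diff add_subgroup_scale_int by blast
      have eq: "x' = y + (t - of_int (round t)) *\<^sub>R b"
        by (simp add: x'_def x \<pi>_def orth_proj_def t_def algebra_simps)
      have orth: "b \<bullet> y = 0" using sub y by blast
      then have "x' \<noteq> 0" using y(2) eq 
        by (metis add.commute inner_eq_zero_iff inner_add_right inner_scaleR_right inner_commute
              mult_zero_right add_cancel_left_left)
      then have "b \<bullet> b \<le> x' \<bullet> x'" using b x' by blast
      also have "\<dots> = y \<bullet> y + (t - of_int (round t))\<^sup>2 * (b \<bullet> b)"
        using orth by (simp add: eq inner_simps inner_commute power2_eq_square)
      also have "(t - of_int (round t))\<^sup>2 * (b \<bullet> b) \<le> (1/2)\<^sup>2 * (b \<bullet> b)"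
      proof (intro mult_right_mono)
        have "\<bar>t - of_int (round t)\<bar> \<le> 1/2"
          using of_int_round_abs_le[of t] by (simp add: abs_minus_commute)
        then show "(t - of_int (round t))\<^sup>2 \<le> (1/2)\<^sup>2" 
          by (metis abs_ge_zero power2_abs power_mono)
      qed (use bb in auto)
      finally show ?thesis by (simp add: power2_eq_square)
    qed
    obtain w where w: "w \<in> ?W" "w \<noteq> 0" "\<forall>x\<in>\<pi> ` G. w \<bullet> x \<in> \<int>"
      "w \<bullet> w \<le> (4/3) ^ m / (3/4 * (b \<bullet> b))"
      using Suc.IH[OF W sub grp _ min] bb by auto
    have "w \<bullet> x \<in> \<int>" if x: "x \<in> G" for x
    proof -
      have "w \<bullet> x = w \<bullet> \<pi> x" using w(1) by (simp add: \<pi>_def orth_proj_def inner_simps inner_commute)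
      then show ?thesis using w(3) x by simp
    qed
    moreover have "w \<bullet> w \<le> (4/3) ^ Suc m / \<mu>"
    proof -
      have "(4/3) ^ m / (3/4 * (b \<bullet> b)) = (4/3) ^ Suc m / (b \<bullet> b)" by simp
      also have "\<dots> \<le> (4/3) ^ Suc m / \<mu>"
        using bb Suc.prems(5) Suc.prems(6)[OF b(1,2)] by (intro divide_left_mono mult_pos_pos) auto
      finally show ?thesis using w(4) by linarith
    qed
    ultimately show ?thesis using w by auto
  qed
qed

section \<open>Self-dual lattices of rank at most 6 have an orthonormal basis\<close>

text \<open>Encodes full unimodular lattices of \<open>V\<close> without bases: integral norms make
  \<open>L\<close> discrete, and a vector of \<open>V\<close> orthogonal to \<open>L\<close> lies in
  \<open>L\<close>, is orthogonal to itself and vanishes, so \<open>L\<close> spans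
  \<open>V\<close>.\<close>

definition selfdual_in :: "'a::euclidean_space set \<Rightarrow> 'a set \<Rightarrow> bool" where
  "selfdual_in V L \<longleftrightarrow> L = {y \<in> V. \<forall>x\<in>L. x \<bullet> y \<in> \<int>}"

lemma selfdual_inD:
  assumes "selfdual_in V L" "subspace V"
  shows selfdual_subset: "L \<subseteq> V" and selfdual_subgroup: "add_subgroup L"
    and selfdual_Ints: "\<And>x y. x \<in> L \<Longrightarrow> y \<in> L \<Longrightarrow> x \<bullet> y \<in> \<int>"
    and selfdual_mem: "\<And>y. y \<in> V \<Longrightarrow> (\<And>x. x \<in> L \<Longrightarrow> x \<bullet> y \<in> \<int>) \<Longrightarrow> y \<in> L"
proof -
  have L: "y \<in> L \<longleftrightarrow> y \<in> V \<and> (\<forall>x\<in>L. x \<bullet> y \<in> \<int>)" for y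
    using assms(1) unfolding selfdual_in_def by blast
  show "L \<subseteq> V" "\<And>x y. x \<in> L \<Longrightarrow> y \<in> L \<Longrightarrow> x \<bullet> y \<in> \<int>"
    "\<And>y. y \<in> V \<Longrightarrow> (\<And>x. x \<in> L \<Longrightarrow> x \<bullet> y \<in> \<int>) \<Longrightarrow> y \<in> L"
    using L by blast+
  show "add_subgroup L" unfolding add_subgroup_def
  proof (intro conjI ballI)
    show "0 \<in> L" unfolding L[of 0] using assms(2) by (simp add: subspace_0)
    show "x - y \<in> L" if "x \<in> L" "y \<in> L" for x y
      using that assms(2) by (auto simp: L[of "x - y"] L[of x] L[of y] inner_diff_right subspace_diff)
  qed
qed

text \<open>Without norm 1 all nonzero norms are at least 2, so a dual vector of norm below 2 is a
  contradiction, since it lies in \<open>L\<close>. The Hermite bound is small enough up to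
  dimension 5. In dimension 6 it is about 2.1 and only gives a vector \<open>b\<close> of norm 2; a
  second one, \<open>x'\<close>, is found from the projection along \<open>b\<close>, and in the
  orthogonal complement of both the bound is 16/9.\<close>

lemma selfdual_norm1_vector:
  fixes V L :: "'a::euclidean_space set"
  assumes V: "subspace V" and dimV: "1 \<le> dim V" "dim V \<le> 6" and L: "selfdual_in V L"
  shows "\<exists>e\<in>L. e \<bullet> e = 1"
proof (rule ccontr)
  assume none: "\<not> (\<exists>e\<in>L. e \<bullet> e = 1)"
  note LV = selfdual_subset[OF L V] and grp = selfdual_subgroup[OF L V]
    and int = selfdual_Ints[OF L V] and mem = selfdual_mem[OF L V]
  have two: "2 \<le> x \<bullet> x" if x: "x \<in> L" "x \<noteq> 0" for x
  proof -
    obtain k where k: "x \<bullet> x = of_int k" using int[OF x(1) x(1)] by (auto elim: Ints_cases)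
    have "x \<bullet> x > 0" using x by simp
    moreover have "x \<bullet> x \<noteq> 1" using none x by blast
    ultimately have "k > 0" "k \<noteq> 1" using k by auto
    then have "2 \<le> k" by simp
    then show ?thesis unfolding k by linarith
  qed
  have no_short: False if "w \<in> L" "w \<noteq> 0" "w \<bullet> w < 2" for w
    using two[OF that(1,2)] that(3) by simp
  have dualL: "w \<in> L" if "w \<in> V" "\<forall>x\<in>L. w \<bullet> x \<in> \<int>" for w
    using mem[OF that(1)] that(2) by (simp add: inner_commute)
  show False
  proof (cases "dim V = 6")
    case False
    then obtain m where m: "dim V = Suc m" "m \<le> 4" using dimV by (cases "dim V") auto
    then obtain w where w: "w \<in> V" "w \<noteq> 0" "\<forall>x\<in>L. w \<bullet> x \<in> \<int>" "w \<bullet> w \<le> (4/3) ^ m / 2"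
      using short_dual_vector[OF V m(1) LV grp zero_less_numeral two] by blast
    have "(4/3::real) ^ m \<le> (4/3) ^ 4" using m by (intro power_increasing) auto
    moreover have "(4/3::real) ^ 4 = 256/81" by (simp add: power_divide)
    ultimately have "w \<bullet> w < 2" using w(4) by linarith
    then show False using no_short w dualL by blast
  next
    case True
    then have dim6: "dim V = Suc 5" by simp
    then obtain b where b: "b \<in> V" "b \<noteq> 0" "\<forall>x\<in>L. b \<bullet> x \<in> \<int>" "b \<bullet> b \<le> (4/3) ^ 5 / 2"
      using short_dual_vector[OF V dim6 LV grp zero_less_numeral two] by blast
    have bL: "b \<in> L" using dualL b by blast
    obtain k where k: "b \<bullet> b = of_int k" using int[OF bL bL] by (auto elim: Ints_cases)
    have "real_of_int k < 3" using b(4) k by (simp add: power_divide)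
    moreover have "real_of_int k \<ge> 2" using two[OF bL b(2)] k by simp
    ultimately have bb: "b \<bullet> b = 2" using k by force
    define \<pi> where "\<pi> = orth_proj b"
    let ?W = "{x \<in> V. b \<bullet> x = 0}"
    note W = dim_orthogonal_complement_1[OF V b(1,2) dim6]
    have dim5: "dim ?W = Suc 4" using W(2) by simp
    note sub = orth_proj_subgroup(1)[OF V LV grp b(1,2), folded \<pi>_def]
      and grp1 = orth_proj_subgroup(2)[OF V LV grp b(1,2), folded \<pi>_def]
    have "\<exists>y\<in>\<pi> ` L. y \<noteq> 0 \<and> y \<bullet> y < 2"
    proof (rule ccontr)
      assume "\<not> (\<exists>y\<in>\<pi> ` L. y \<noteq> 0 \<and> y \<bullet> y < 2)"
      then have "2 \<le> y \<bullet> y" if "y \<in> \<pi> ` L" "y \<noteq> 0" for y using that by fastforce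
      then obtain w where w: "w \<in> ?W" "w \<noteq> 0" "\<forall>x\<in>\<pi> ` L. w \<bullet> x \<in> \<int>" "w \<bullet> w \<le> (4/3) ^ 4 / 2"
        using short_dual_vector[OF W(1) dim5 sub grp1 zero_less_numeral] by blast
      have "w \<bullet> x \<in> \<int>" if x: "x \<in> L" for x
      proof -
        have "w \<bullet> x = w \<bullet> \<pi> x" using w(1) by (simp add: \<pi>_def orth_proj_def inner_simps inner_commute)
        then show ?thesis using w(3) x by simp
      qed
      moreover have "w \<bullet> w < 2" using w(4) by (simp add: power_divide)
      ultimately show False using no_short w dualL by blast
    qed
    then obtain x where x: "x \<in> L" "\<pi> x \<noteq> 0" "\<pi> x \<bullet> \<pi> x < 2" by blast
    obtain j where j: "x \<bullet> b = of_int j" using int[OF x(1) bL] by (auto elim: Ints_cases)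
    \<comment> \<open>Reduction modulo \<open>b\<close> makes the product
      \<open>x' \<bullet> b\<close> equal to 0 or 1. The value 0 would make \<open>x'\<close>
      shorter than 2; the value 1 forces norm 2, so that \<open>b\<close> and \<open>x'\<close> span
      a hexagonal lattice.\<close>
    define i where "i = j div 2"
    define x' where "x' = x - of_int i *\<^sub>R b"
    have x'L: "x' \<in> L" unfolding x'_def
      using x bL grp add_subgroup_diff add_subgroup_scale_int by blast
    have x'b: "x' \<bullet> b = of_int (j mod 2)" 
      using bb by (simp add: x'_def inner_simps j i_def minus_mult_div_eq_mod[symmetric])
    have \<pi>x': "\<pi> x' = \<pi> x"
      using b bb by (simp add: x'_def \<pi>_def orth_proj_def inner_simps algebra_simps diff_divide_distrib)
    have nx': "\<pi> x \<bullet> \<pi> x = x' \<bullet> x' - (x' \<bullet> b)\<^sup>2 / 2"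
      using orth_proj_inner(2)[OF b(2), of x'] \<pi>x' bb by (simp add: \<pi>_def)
    have "x' \<noteq> 0" using x(2) \<pi>x' by (auto simp: \<pi>_def orth_proj_def)
    then have x'2: "x' \<bullet> x' \<ge> 2" using two x'L by blast
    obtain l where l: "x' \<bullet> x' = of_int l" using int[OF x'L x'L] by (auto elim: Ints_cases)
    have "j mod 2 = 1"
    proof (rule ccontr)
      assume "j mod 2 \<noteq> 1"
      then have "j mod 2 = 0" by presburger
      then show False using nx' x'b x'2 x(3) by simp
    qed
    then have x'b1: "x' \<bullet> b = 1" using x'b by simp
    have "real_of_int l < 3" using nx' x'b1 x(3) l by simp
    moreover have "real_of_int l \<ge> 2" using x'2 l by simp
    ultimately have x'x': "x' \<bullet> x' = 2" using l by force
    \<comment> \<open>Orthogonal to \<open>b\<close> in the plane of the hexagonal lattice; \<rho>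
      below is the projection along this plane.\<close>
    define c where "c = 2 *\<^sub>R x' - b"
    have bc: "b \<bullet> c = 0" "c \<bullet> c = 6" 
      using bb x'b1 x'x' by (auto simp: c_def inner_simps inner_commute)
    then have c0: "c \<noteq> 0" by auto
    have cW: "c \<in> ?W" 
      using bc V b x'L LV by (auto simp: c_def intro!: subspace_diff subspace_scale)
    let ?U = "{x \<in> ?W. c \<bullet> x = 0}"
    note U = dim_orthogonal_complement_1[OF W(1) cW c0 dim5]
    have dim4: "dim ?U = Suc 3" using U(2) by simp
    define \<rho> where "\<rho> x = x - ((x \<bullet> b) / 2) *\<^sub>R b - ((x \<bullet> c) / 6) *\<^sub>R c" for x
    have \<rho>_diff: "\<rho> x - \<rho> y = \<rho> (x - y)" for x y
      by (simp add: \<rho>_def inner_simps algebra_simps diff_divide_distrib)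
    have subU: "\<rho> ` L \<subseteq> ?U"
    proof
      fix y assume "y \<in> \<rho> ` L"
      then obtain x where x: "x \<in> L" "y = \<rho> x" by blast
      have "y \<in> V" unfolding x \<rho>_def using x LV V b cW by (auto intro!: subspace_diff subspace_scale)
      moreover have "b \<bullet> y = 0" "c \<bullet> y = 0"
        using bb bc by (auto simp: x \<rho>_def inner_simps inner_commute)
      ultimately show "y \<in> ?U" by simp
    qed
    have grp2: "add_subgroup (\<rho> ` L)"
      unfolding add_subgroup_def
    proof (intro conjI ballI)
      show "0 \<in> \<rho> ` L" 
        using add_subgroup_0[OF grp] by (intro image_eqI[of _ _ 0]) (auto simp: \<rho>_def)
    qed (use \<rho>_diff add_subgroup_diff[OF grp] in auto)
    \<comment> \<open>4/3 = 2 - 2/3: modulo the hexagonal lattice, the component of \<open>z\<close>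
      in the plane can be brought to norm at most 2/3.\<close>
    have min: "4/3 \<le> y \<bullet> y" if yR: "y \<in> \<rho> ` L" and y0: "y \<noteq> 0" for y
    proof -
      obtain z where z: "z \<in> L" "y = \<rho> z" using yR by blast
      obtain s where s: "z \<bullet> b = of_int s" using int[OF z(1) bL] by (auto elim: Ints_cases)
      obtain t where t: "z \<bullet> x' = of_int t" using int[OF z(1) x'L] by (auto elim: Ints_cases)
      note st = s t
      \<comment> \<open>The dual of the hexagonal lattice modulo the lattice has order 3. The class
        of \<open>z\<close> is \<open>r\<close>, and \<open>z'\<close> is the representative whose
        products with \<open>b\<close> and \<open>x'\<close> are \<open>r\<close> and 0.\<close>
      define r where "r = (s + t + 1) mod 3 - 1"
      have "3 dvd s + t - r" unfolding r_def by presburger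
      then obtain q where q: "s + t - r = 3 * q" by (elim dvdE)
      have r: "r = -1 \<or> r = 0 \<or> r = 1" unfolding r_def by presburger
      define z' where "z' = z - of_int (2 * q - t) *\<^sub>R b - of_int (t - q) *\<^sub>R x'"
      have z'L: "z' \<in> L" unfolding z'_def
        using z bL x'L grp add_subgroup_diff add_subgroup_scale_int by blast
      have "z' \<bullet> b = of_int (s - 2 * (2 * q - t) - (t - q))"
        using st bb x'b1 by (simp add: z'_def inner_simps)
      also have "s - 2 * (2 * q - t) - (t - q) = r" using q by simp
      finally have z'b: "z' \<bullet> b = of_int r" .
      have z'x': "z' \<bullet> x' = 0" 
        using st x'x' x'b1 by (simp add: z'_def inner_simps inner_commute)
      have \<rho>_scale: "\<rho> (t *\<^sub>R x) = t *\<^sub>R \<rho> x" for t x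
        by (simp add: \<rho>_def algebra_simps)
      have \<rho>0: "\<rho> b = 0" "\<rho> x' = 0"
      proof -
        show "\<rho> b = 0" using bb bc by (simp add: \<rho>_def)
        have "x' \<bullet> c = 3" using x'b1 x'x' by (simp add: c_def inner_simps)
        then have "2 *\<^sub>R \<rho> x' = 0" using x'b1 by (simp add: \<rho>_def c_def algebra_simps)
        then show "\<rho> x' = 0" by simp
      qed
      have \<rho>z': "\<rho> z' = y"
        by (simp add: z(2) z'_def \<rho>_diff[symmetric] \<rho>_scale \<rho>0)
      have "z' \<noteq> 0" using y0 \<rho>z' by (auto simp: \<rho>_def)
      then have "2 \<le> z' \<bullet> z'" using two z'L by blast
      moreover have "y \<bullet> y = z' \<bullet> z' - (z' \<bullet> b)\<^sup>2 / 2 - (z' \<bullet> c)\<^sup>2 / 6"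
        using bb bc unfolding \<rho>z'[symmetric] \<rho>_def
        by (simp add: inner_simps inner_commute power2_eq_square field_simps)
      moreover have "z' \<bullet> c = - of_int r" using z'b z'x' by (simp add: c_def inner_simps)
      moreover have "(real_of_int r)\<^sup>2 \<le> 1" using r by auto
      ultimately show ?thesis using z'b by simp
    qed
    obtain w where w: "w \<in> ?U" "w \<noteq> 0" "\<forall>x\<in>\<rho> ` L. w \<bullet> x \<in> \<int>" "w \<bullet> w \<le> (4/3) ^ 3 / (4/3)"
      using short_dual_vector[OF U(1) dim4 subU grp2 _ min] by fastforce
    have "w \<bullet> x \<in> \<int>" if x: "x \<in> L" for x
    proof -
      have "w \<bullet> x = w \<bullet> \<rho> x" using w(1) by (simp add: \<rho>_def inner_simps inner_commute)
      then show ?thesis using w(3) x by simp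
    qed
    moreover have "w \<bullet> w < 2" using w(4) by (simp add: power_divide)
    ultimately show False using no_short w dualL by blast
  qed
qed

text \<open>A vector \<open>e\<close> of norm 1 splits off: since \<open>x \<bullet> e\<close> is an
  integer, the projection along \<open>e\<close> maps \<open>L\<close> into itself, and the
  complement of \<open>e\<close> in \<open>L\<close> is again self-dual.\<close>

lemma selfdual_orthonormal_basis:
  fixes V L :: "'a::euclidean_space set"
  assumes "subspace V" "dim V = n" "n \<le> 6" "selfdual_in V L"
  shows "\<exists>E\<subseteq>L. finite E \<and> card E = n \<and> pairwise orthogonal E \<and> (\<forall>e\<in>E. norm e = 1)"
  using assms
proof (induction n arbitrary: V L)
  case 0
  then show ?case by (intro exI[of _ "{}"]) auto
next
  case (Suc n V L)
  note LV = selfdual_subset[OF Suc.prems(4,1)] and grp = selfdual_subgroup[OF Suc.prems(4,1)]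
    and int = selfdual_Ints[OF Suc.prems(4,1)] and mem = selfdual_mem[OF Suc.prems(4,1)]
  obtain e where e: "e \<in> L" "e \<bullet> e = 1"
    using selfdual_norm1_vector[of V L] Suc.prems by auto
  have eV: "e \<in> V" "e \<noteq> 0" using e LV by auto
  let ?W = "{x \<in> V. e \<bullet> x = 0}"
  note W = dim_orthogonal_complement_1[OF Suc.prems(1) eV Suc.prems(2)]
  have sd: "selfdual_in ?W (L \<inter> ?W)"
    unfolding selfdual_in_def
  proof (intro equalityI subsetI)
    fix y assume y: "y \<in> {y \<in> ?W. \<forall>x\<in>L \<inter> ?W. x \<bullet> y \<in> \<int>}"
    have "x \<bullet> y \<in> \<int>" if x: "x \<in> L" for x
    proof -
      let ?x = "x - (x \<bullet> e) *\<^sub>R e"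
      have "?x \<in> L" using x e int grp Ints_scale add_subgroup_diff by blast
      moreover have "e \<bullet> ?x = 0" using e by (simp add: inner_simps inner_commute)
      ultimately have "?x \<bullet> y \<in> \<int>" using y LV by auto
      moreover have "?x \<bullet> y = x \<bullet> y" using y by (simp add: inner_simps)
      ultimately show ?thesis by simp
    qed
    then have "y \<in> L" using mem y by blast
    then show "y \<in> L \<inter> ?W" using y by blast
  next
    fix y assume "y \<in> L \<inter> ?W"
    then show "y \<in> {y \<in> ?W. \<forall>x\<in>L \<inter> ?W. x \<bullet> y \<in> \<int>}" using int by blast
  qed
  have "n \<le> 6" using Suc.prems(3) by simp
  then obtain E where E: "E \<subseteq> L \<inter> ?W" "finite E" "card E = n" "pairwise orthogonal E"
    "\<forall>e\<in>E. norm e = 1"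
    using Suc.IH[OF W _ sd] by blast
  have "e \<notin> E" using E(1) e by auto
  moreover have "norm e = 1" using e by (simp add: norm_eq_sqrt_inner)
  moreover have "pairwise orthogonal (insert e E)"
    using E(1,4) by (auto simp: pairwise_insert orthogonal_def inner_commute)
  ultimately show ?case using E e by (intro exI[of _ "insert e E"]) auto
qed

section \<open>Unimodular lattices and their neighbours\<close>

definition unimodular :: "(real^6) set \<Rightarrow> bool" where
  "unimodular L \<longleftrightarrow> selfdual_in UNIV L"

definition int_lattice :: "(real^6) set" where
  "int_lattice = {x. \<forall>i. x $ i \<in> \<int>}"

text \<open>With real coefficients the condition includes the linear independence of
  \<open>u\<close> and \<open>v\<close>: a nontrivial relation could be scaled to non-integral
  coefficients.\<close>

definition primitive_pair :: "(real^6) set \<Rightarrow> real^6 \<Rightarrow> real^6 \<Rightarrow> bool" where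
  "primitive_pair L u v \<longleftrightarrow> u \<in> L \<and> v \<in> L \<and>
     (\<forall>\<alpha> \<beta>. \<alpha> *\<^sub>R u + \<beta> *\<^sub>R v \<in> L \<longrightarrow> \<alpha> \<in> \<int> \<and> \<beta> \<in> \<int>)"

text \<open>The lattice is quantified so that it can be exchanged for a neighbour;
  \<open>prim_represented_int_lattice\<close> leads back to Z^6.\<close>

definition prim_represented :: "real \<Rightarrow> real \<Rightarrow> real \<Rightarrow> bool" where
  "prim_represented a b c \<longleftrightarrow> (\<exists>L u v. unimodular L \<and> primitive_pair L u v \<and>
     u \<bullet> u = a \<and> u \<bullet> v = b \<and> v \<bullet> v = c)"

lemma unimodularD:
  assumes "unimodular L"
  shows unimodular_subgroup: "add_subgroup L"
    and unimodular_Ints: "\<And>x y. x \<in> L \<Longrightarrow> y \<in> L \<Longrightarrow> x \<bullet> y \<in> \<int>"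
    and unimodular_mem: "\<And>y. (\<And>x. x \<in> L \<Longrightarrow> x \<bullet> y \<in> \<int>) \<Longrightarrow> y \<in> L"
  using selfdual_inD[OF assms[unfolded unimodular_def] subspace_UNIV] by blast+

lemma primitive_pairD:
  assumes "primitive_pair L u v"
  shows "u \<in> L" "v \<in> L" "\<And>\<alpha> \<beta>. \<alpha> *\<^sub>R u + \<beta> *\<^sub>R v \<in> L \<Longrightarrow> \<alpha> \<in> \<int>"
    "\<And>\<alpha> \<beta>. \<alpha> *\<^sub>R u + \<beta> *\<^sub>R v \<in> L \<Longrightarrow> \<beta> \<in> \<int>"
  using assms unfolding primitive_pair_def by blast+

lemma inner_vec_Ints: "x \<in> int_lattice \<Longrightarrow> y \<in> int_lattice \<Longrightarrow> x \<bullet> y \<in> \<int>"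
  by (auto simp: int_lattice_def inner_vec_def)

lemma axis_int_lattice: "axis i 1 \<in> int_lattice"
  by (simp add: int_lattice_def axis_def)

lemma unimodular_int_lattice: "unimodular int_lattice"
  unfolding unimodular_def selfdual_in_def
proof (intro equalityI subsetI)
  fix y assume "y \<in> {y \<in> UNIV. \<forall>x\<in>int_lattice. x \<bullet> y \<in> \<int>}"
  then have "axis i 1 \<bullet> y \<in> \<int>" for i using axis_int_lattice by blast
  then show "y \<in> int_lattice" by (simp add: int_lattice_def inner_axis')
qed (use inner_vec_Ints in blast)

lemma unimodular_isometry:
  assumes "unimodular L"
  obtains T :: "real^6 \<Rightarrow> real^6" where "linear T" "\<And>x y. T x \<bullet> T y = x \<bullet> y" "T ` L = int_lattice"
proof -
  obtain E where E: "E \<subseteq> L" "finite E" "card E = 6" "pairwise orthogonal E" "\<forall>e\<in>E. norm e = 1"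
    using selfdual_orthonormal_basis[of UNIV 6 L] assms by (auto simp: unimodular_def)
  have "card (UNIV :: 6 set) = card E" using E by simp
  then obtain e :: "6 \<Rightarrow> real^6" where e: "bij_betw e UNIV E"
    using finite_same_card_bij[OF finite E(2)] by blast
  have eE: "e i \<in> E" for i using e by (auto simp: bij_betw_def)
  have eL: "e i \<in> L" for i using eE E(1) by blast
  have ee: "e i \<bullet> e j = (if i = j then 1 else 0)" for i j
  proof (cases "i = j")
    case True
    then show ?thesis using E(5) eE[of i] by (simp add: norm_eq_sqrt_inner)
  next
    case False
    then have "e i \<noteq> e j" using e by (auto simp: bij_betw_def inj_on_def)
    then show ?thesis using E(4) eE False by (auto simp: pairwise_def orthogonal_def)
  qed
  have "independent E"
    using E(4,5) by (intro pairwise_orthogonal_independent) auto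
  then have "span E = UNIV"
    using card_ge_dim_independent[of E UNIV] E(3) by auto
  then have expand: "(\<Sum>i\<in>UNIV. (x \<bullet> e i) *\<^sub>R e i) = x" for x
    using orthonormal_basis_expand[of E x] E sum.reindex_bij_betw[OF e, of "\<lambda>i. (x \<bullet> i) *\<^sub>R i"]
    by simp
  define T :: "real^6 \<Rightarrow> real^6" where "T x = (\<chi> i. x \<bullet> e i)" for x
  show ?thesis
  proof
    show "linear T" by (rule linearI) (auto simp: T_def vec_eq_iff inner_simps)
    show "T x \<bullet> T y = x \<bullet> y" for x y
    proof -
      have "x \<bullet> y = x \<bullet> (\<Sum>i\<in>UNIV. (y \<bullet> e i) *\<^sub>R e i)" by (simp only: expand)
      also have "\<dots> = T x \<bullet> T y"
        unfolding inner_vec_def[of "T x"] by (simp add: inner_sum_right T_def mult.commute)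
      finally show ?thesis ..
    qed
    show "T ` L = int_lattice"
    proof (intro equalityI subsetI)
      fix y assume "y \<in> T ` L"
      then show "y \<in> int_lattice"
        using unimodular_Ints[OF assms _ eL] by (auto simp: T_def int_lattice_def)
    next
      fix y :: "real^6" assume y: "y \<in> int_lattice"
      define x where "x = (\<Sum>i\<in>UNIV. (y $ i) *\<^sub>R e i)"
      have "x \<in> L"
      proof (rule unimodular_mem[OF assms])
        fix z assume "z \<in> L"
        then show "z \<bullet> x \<in> \<int>" unfolding x_def
          using unimodular_Ints[OF assms _ eL] y by (auto simp: int_lattice_def inner_sum_right)
      qed
      moreover have "T x = y"
        by (simp add: T_def x_def vec_eq_iff inner_sum_left ee if_distrib cong: if_cong)
      ultimately show "y \<in> T ` L" by blast
    qed
  qed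
qed

lemma primitive_pair_isometry:
  assumes T: "linear T" "\<And>x y. T x \<bullet> T y = x \<bullet> y" and "primitive_pair L u v"
  shows "primitive_pair (T ` L) (T u) (T v)"
proof -
  have inj: "inj T"
    using T(1) by (rule linear_injective_0[THEN iffD2]) (metis T(2) inner_eq_zero_iff)
  have "\<alpha> *\<^sub>R u + \<beta> *\<^sub>R v \<in> L" if "\<alpha> *\<^sub>R T u + \<beta> *\<^sub>R T v \<in> T ` L" for \<alpha> \<beta>
  proof -
    have "T (\<alpha> *\<^sub>R u + \<beta> *\<^sub>R v) = \<alpha> *\<^sub>R T u + \<beta> *\<^sub>R T v"
      using T(1) by (simp add: linear_add linear_scale)
    then show ?thesis using that inj by (metis inj_image_mem_iff)
  qed
  then show ?thesis using assms(3) unfolding primitive_pair_def by blast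
qed

lemma primitive_pair_shift:
  assumes "add_subgroup L" "primitive_pair L u v" "k \<in> \<int>"
  shows "primitive_pair L (u + k *\<^sub>R v) v"
proof -
  note uv = primitive_pairD[OF assms(2)]
  have "\<alpha> \<in> \<int> \<and> \<beta> \<in> \<int>" if "\<alpha> *\<^sub>R (u + k *\<^sub>R v) + \<beta> *\<^sub>R v \<in> L" for \<alpha> \<beta>
  proof -
    have *: "\<alpha> *\<^sub>R u + (\<alpha> * k + \<beta>) *\<^sub>R v \<in> L" using that by (simp add: algebra_simps)
    have "\<alpha> \<in> \<int>" "\<alpha> * k + \<beta> \<in> \<int>" using uv(3,4)[OF *] by auto
    then show ?thesis using assms(3) by (metis Ints_diff Ints_mult add_diff_cancel_left')
  qed
  moreover have "u + k *\<^sub>R v \<in> L" using uv assms Ints_scale add_subgroup_add by blast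
  ultimately show ?thesis using uv by (simp add: primitive_pair_def)
qed

lemma primitive_pair_swap:
  assumes "primitive_pair L u v"
  shows "primitive_pair L v u"
proof -
  note uv = primitive_pairD[OF assms]
  have "\<alpha> \<in> \<int> \<and> \<beta> \<in> \<int>" if "\<alpha> *\<^sub>R v + \<beta> *\<^sub>R u \<in> L" for \<alpha> \<beta>
    using uv(3,4)[of \<beta> \<alpha>] that by (simp add: add.commute)
  then show ?thesis using uv(1,2) by (simp add: primitive_pair_def)
qed

lemma prim_representedI:
  "unimodular L \<Longrightarrow> primitive_pair L u v \<Longrightarrow> prim_represented (u \<bullet> u) (u \<bullet> v) (v \<bullet> v)"
  unfolding prim_represented_def by blast

lemma prim_represented_swap:
  assumes "prim_represented a b c"
  shows "prim_represented c b a"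
proof -
  obtain L u v where L: "unimodular L" "primitive_pair L u v"
    and g: "u \<bullet> u = a" "u \<bullet> v = b" "v \<bullet> v = c"
    using assms unfolding prim_represented_def by blast
  show ?thesis
    using prim_representedI[OF L(1) primitive_pair_swap[OF L(2)]] g by (simp add: inner_commute)
qed

lemma prim_represented_shift:
  assumes "prim_represented a b c" "k \<in> \<int>"
  shows "prim_represented (a + 2 * k * b + k\<^sup>2 * c) (b + k * c) c"
proof -
  obtain L u v where L: "unimodular L" and "primitive_pair L u v" 
    and g: "u \<bullet> u = a" "u \<bullet> v = b" "v \<bullet> v = c"
    using assms unfolding prim_represented_def by blast
  then have "primitive_pair L (u + k *\<^sub>R v) v"
    using primitive_pair_shift unimodular_subgroup assms(2) by blast
  from prim_representedI[OF L this] have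
    "prim_represented ((u + k *\<^sub>R v) \<bullet> (u + k *\<^sub>R v)) ((u + k *\<^sub>R v) \<bullet> v) c" using g by simp
  moreover have "(u + k *\<^sub>R v) \<bullet> (u + k *\<^sub>R v) = a + 2 * k * b + k\<^sup>2 * c"
    "(u + k *\<^sub>R v) \<bullet> v = b + k * c"
    using g by (auto simp: inner_simps inner_commute power2_eq_square algebra_simps)
  ultimately show ?thesis by simp
qed

lemma prim_represented_int_lattice:
  assumes "prim_represented a b c"
  obtains u v where "primitive_pair int_lattice u v" "u \<bullet> u = a" "u \<bullet> v = b" "v \<bullet> v = c"
proof -
  obtain L u v where L: "unimodular L" "primitive_pair L u v" "u \<bullet> u = a" "u \<bullet> v = b" "v \<bullet> v = c"
    using assms unfolding prim_represented_def by blast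
  obtain T where T: "linear T" "\<And>x y. T x \<bullet> T y = x \<bullet> y" "T ` L = int_lattice"
    using unimodular_isometry[OF L(1)] by metis
  show ?thesis
    using that[of "T u" "T v"] primitive_pair_isometry[OF T(1,2) L(2)] L T by simp
qed

text \<open>Kneser's p-neighbour of \<open>L\<close> in the direction of \<open>w\<close>. It is
  again unimodular if \<open>w\<close> is not in \<open>p L\<close> and p^2 divides its
  norm.\<close>

definition neighbour :: "(real^6) set \<Rightarrow> nat \<Rightarrow> real^6 \<Rightarrow> (real^6) set" where
  "neighbour L p w = {z + (k / real p) *\<^sub>R w | z k. z \<in> L \<and> z \<bullet> w / real p \<in> \<int> \<and> k \<in> \<int>}"

lemma neighbourI:
  "z \<in> L \<Longrightarrow> z \<bullet> w / real p \<in> \<int> \<Longrightarrow> k \<in> \<int> \<Longrightarrow> z + (k / real p) *\<^sub>R w \<in> neighbour L p w"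
  unfolding neighbour_def by blast

lemma neighbourI_0: "z \<in> L \<Longrightarrow> z \<bullet> w / real p \<in> \<int> \<Longrightarrow> z \<in> neighbour L p w"
  using neighbourI[of z L w p 0] by simp

lemma neighbourI_1: "0 \<in> L \<Longrightarrow> (1 / real p) *\<^sub>R w \<in> neighbour L p w"
  using neighbourI[of 0 L w p 1] by simp

text \<open>Products within the neighbour are integral because p^2 divides the norm of
  \<open>w\<close>. Conversely, if \<open>y\<close> pairs integrally with the neighbour, a suitable
  \<open>y - t w\<close> pairs integrally with all of \<open>L\<close> and hence lies in
  \<open>L\<close>.\<close>

lemma unimodular_neighbour:
  assumes L: "unimodular L" and p: "prime p" and w: "w \<in> L" "w \<bullet> w / (real p)\<^sup>2 \<in> \<int>"
    and x: "x \<in> L" "x \<bullet> w / real p \<notin> \<int>"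
  shows "unimodular (neighbour L p w)"
  unfolding unimodular_def selfdual_in_def
proof (intro equalityI subsetI)
  note grp = unimodular_subgroup[OF L] and int = unimodular_Ints[OF L] and mem = unimodular_mem[OF L]
  have p0: "real p > 0" using p prime_gt_0_nat by simp
  fix y assume "y \<in> neighbour L p w"
    then obtain z k where y: "y = z + (k / real p) *\<^sub>R w" "z \<in> L" "z \<bullet> w / real p \<in> \<int>" "k \<in> \<int>"
      unfolding neighbour_def by blast
    have "y' \<bullet> y \<in> \<int>" if yN: "y' \<in> neighbour L p w" for y'
    proof -
      obtain z' k' where y': "y' = z' + (k' / real p) *\<^sub>R w" "z' \<in> L" "z' \<bullet> w / real p \<in> \<int>" "k' \<in> \<int>"
        using yN unfolding neighbour_def by blast
      have "y' \<bullet> y = z' \<bullet> z + k * (z' \<bullet> w / real p) + k' * (z \<bullet> w / real p) 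
          + k * k' * (w \<bullet> w / (real p)\<^sup>2)"
        by (simp add: y y' inner_simps inner_commute power2_eq_square)
      moreover have "\<dots> \<in> \<int>" 
        using int[OF y'(2) y(2)] y(3,4) y'(3,4) w(2) by (intro Ints_add Ints_mult)
      ultimately show ?thesis by simp
    qed
    then show "y \<in> {y \<in> UNIV. \<forall>x\<in>neighbour L p w. x \<bullet> y \<in> \<int>}" by blast
  next
  note grp = unimodular_subgroup[OF L] and int = unimodular_Ints[OF L] and mem = unimodular_mem[OF L]
  have p0: "real p > 0" using p prime_gt_0_nat by simp
  fix y assume "y \<in> {y \<in> UNIV. \<forall>x\<in>neighbour L p w. x \<bullet> y \<in> \<int>}"
  then have y: "y' \<bullet> y \<in> \<int>" if "y' \<in> neighbour L p w" for y' using that by blast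
  have y1: "z \<bullet> y \<in> \<int>" if "z \<in> L" "z \<bullet> w / real p \<in> \<int>" for z
    by (rule y[OF neighbourI_0[OF that]])
  have "((1 / real p) *\<^sub>R w) \<bullet> y \<in> \<int>" by (rule y[OF neighbourI_1[OF add_subgroup_0[OF grp]]])
  then have y2: "w \<bullet> y / real p \<in> \<int>" by simp
  obtain m where m: "x \<bullet> w = of_int m" using int[OF x(1) w(1)] by (auto elim: Ints_cases)
  have "\<not> int p dvd m"
    using x(2) m p0 by (auto elim!: dvdE)
  moreover have "prime (int p)" using p by simp
  ultimately have "gcd (int p) m = 1"
    using prime_imp_coprime coprime_iff_gcd_eq_1 by blast
  then obtain l k where lk: "l * int p + k * m = 1" using bezout_int[of "int p" m] by auto
  \<comment> \<open>The product of \<open>x0\<close> with \<open>w\<close> is 1 mod p. Subtracting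
    multiples of \<open>x0\<close> therefore moves any vector of \<open>L\<close> into the part of
    \<open>L\<close> that survives in the neighbour, and \<open>x0 \<bullet> y\<close> is the right
    \<open>t\<close>.\<close>
  define x0 where "x0 = of_int k *\<^sub>R x"
  have x0L: "x0 \<in> L" unfolding x0_def using grp x add_subgroup_scale_int by blast
  have x0w: "1 - x0 \<bullet> w = real p * of_int l"
    using arg_cong[OF lk, of real_of_int] m by (simp add: x0_def algebra_simps)
  define t where "t = x0 \<bullet> y"
  have "(real p *\<^sub>R x0) \<bullet> y \<in> \<int>"
  proof (rule y1)
    show "real p *\<^sub>R x0 \<in> L" using add_subgroup_scale_int[OF grp x0L, of "int p"] by simp
    show "(real p *\<^sub>R x0) \<bullet> w / real p \<in> \<int>" using int[OF x0L w(1)] p0 by simp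
  qed
  then have pt: "real p * t \<in> \<int>" by (simp add: t_def)
  define z where "z = y - t *\<^sub>R w"
  have zL: "z \<in> L"
  proof (rule mem)
    fix x' assume x': "x' \<in> L"
    let ?x = "x' - (x' \<bullet> w) *\<^sub>R x0"
    have "?x \<in> L" by (rule add_subgroup_diff[OF grp x' Ints_scale[OF grp x0L int[OF x' w(1)]]])
    moreover have "?x \<bullet> w = (x' \<bullet> w) * (1 - x0 \<bullet> w)" by (simp add: inner_simps algebra_simps)
    then have "?x \<bullet> w / real p = (x' \<bullet> w) * of_int l" using x0w p0 by simp
    then have "?x \<bullet> w / real p \<in> \<int>" using int[OF x' w(1)] by simp
    ultimately have "?x \<bullet> y \<in> \<int>" by (rule y1)
    then show "x' \<bullet> z \<in> \<int>" by (simp add: z_def t_def inner_simps mult.commute)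
  qed
  have "w \<bullet> y / real p = z \<bullet> w / real p + (real p * t) * (w \<bullet> w / (real p)\<^sup>2)"
    using p0 by (simp add: z_def inner_simps inner_commute field_simps power2_eq_square)
  then have "z \<bullet> w / real p = w \<bullet> y / real p - (real p * t) * (w \<bullet> w / (real p)\<^sup>2)" by simp
  then have "z \<bullet> w / real p \<in> \<int>"
    using Ints_diff[OF y2 Ints_mult[OF pt w(2)]] by (simp only:)
  then have "z + ((real p * t) / real p) *\<^sub>R w \<in> neighbour L p w"
    using zL pt by (intro neighbourI)
  then show "y \<in> neighbour L p w" using p0 by (simp add: z_def)
qed

lemma unimodular_nonintegral_inner:
  assumes "unimodular L" "(1 / real p) *\<^sub>R w \<notin> L"
  obtains x where "x \<in> L" "x \<bullet> w / real p \<notin> \<int>"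
proof -
  obtain x where "x \<in> L" "x \<bullet> ((1 / real p) *\<^sub>R w) \<notin> \<int>"
    using unimodular_mem[OF assms(1)] assms(2) by blast
  then show ?thesis using that[of x] by simp
qed

text \<open>The long vector \<open>w\<close> itself defines the neighbour: this adjoins
  \<open>w / p\<close>, keeps \<open>v\<close>, and adds nothing else to the plane of
  \<open>w\<close> and \<open>v\<close>.\<close>

lemma prim_represented_div:
  assumes "prim_represented ((real p)\<^sup>2 * a) (real p * b) c" and p: "prime p"
    and abc: "a \<in> \<int>" "b \<in> \<int>"
  shows "prim_represented a b c"
proof -
  obtain L w v where L: "unimodular L" "primitive_pair L w v"
    and g: "w \<bullet> w = (real p)\<^sup>2 * a" "w \<bullet> v = real p * b" "v \<bullet> v = c"
    using assms unfolding prim_represented_def by blast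
  have p0: "real p > 1" using p prime_gt_1_nat by simp
  note wv = primitive_pairD[OF L(2)] and grp = unimodular_subgroup[OF L(1)]
  have "(1 / real p) *\<^sub>R w \<notin> L"
  proof
    assume "(1 / real p) *\<^sub>R w \<in> L"
    then have "1 / real p \<in> \<int>" using wv(3)[of "1 / real p" 0] by simp
    then show False using p0 Ints_nonzero_abs_ge1[of "1 / real p"] by simp
  qed
  then obtain x where x: "x \<in> L" "x \<bullet> w / real p \<notin> \<int>"
    using unimodular_nonintegral_inner[OF L(1)] by blast
  define N where "N = neighbour L p w"
  define u where "u = (1 / real p) *\<^sub>R w"
  have N: "unimodular N" unfolding N_def
    using unimodular_neighbour[OF L(1) p wv(1) _ x] g p0 abc by simp
  have "u \<in> N" unfolding N_def neighbour_def u_def using add_subgroup_0[OF grp] by force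
  moreover have "v + (0 / real p) *\<^sub>R w \<in> N" unfolding N_def neighbour_def
    using wv(2) g p0 abc by (force simp: inner_commute)
  then have "v \<in> N" by simp
  moreover have "\<alpha> \<in> \<int> \<and> \<beta> \<in> \<int>" if N': "\<alpha> *\<^sub>R u + \<beta> *\<^sub>R v \<in> N" for \<alpha> \<beta>
  proof -
    obtain z k where z: "\<alpha> *\<^sub>R u + \<beta> *\<^sub>R v = z + (k / real p) *\<^sub>R w" "z \<in> L" "k \<in> \<int>"
      using N' unfolding N_def neighbour_def by blast
    have "((\<alpha> - k) / real p) *\<^sub>R w + \<beta> *\<^sub>R v = z"
      using z(1) by (simp add: u_def algebra_simps diff_divide_distrib)
    then have "(\<alpha> - k) / real p \<in> \<int>" "\<beta> \<in> \<int>" using wv(3,4) z(2) by blast+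
    then have "real p * ((\<alpha> - k) / real p) + k \<in> \<int>" using z(3) by (intro Ints_add Ints_mult) auto
    then show ?thesis using p0 \<open>\<beta> \<in> \<int>\<close> by simp
  qed
  ultimately have "primitive_pair N u v" by (simp add: primitive_pair_def)
  moreover have "u \<bullet> u = a" "u \<bullet> v = b" using g p0 by (simp_all add: u_def power2_eq_square)
  ultimately show ?thesis using prim_representedI[OF N] g(3) by metis
qed

section \<open>The Chevalley--Warning theorem\<close>

text \<open>Polynomial functions over the integers; the index is an upper bound for the degree, so
  that summands of different degrees can be added.\<close>

inductive poly_fun :: "nat \<Rightarrow> (('n \<Rightarrow> int) \<Rightarrow> int) \<Rightarrow> bool" where
  const: "poly_fun d (\<lambda>x. c)"
| var: "poly_fun (Suc d) (\<lambda>x. x i)"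
| add: "poly_fun d f \<Longrightarrow> poly_fun d g \<Longrightarrow> poly_fun d (\<lambda>x. f x + g x)"
| mult: "poly_fun d f \<Longrightarrow> poly_fun e g \<Longrightarrow> poly_fun (d + e) (\<lambda>x. f x * g x)"

lemma poly_fun_power: "poly_fun d f \<Longrightarrow> poly_fun (k * d) (\<lambda>x. f x ^ k)"
proof (induction k)
  case (Suc k)
  then show ?case using poly_fun.mult[of d f "k * d" "\<lambda>x. f x ^ k"] by simp
qed (simp add: poly_fun.const)

lemma poly_fun_sum:
  assumes "finite A" "\<And>i. i \<in> A \<Longrightarrow> poly_fun d (f i)"
  shows "poly_fun d (\<lambda>x. \<Sum>i\<in>A. f i x)"
  using assms by (induction A) (auto intro: poly_fun.intros)

text \<open>Telescoping the differences of (m+1)-st powers expresses m + 1 times this sum through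
  p^(m+1) and lower power sums, and m + 1 is invertible mod p.\<close>

lemma sum_powers_dvd:
  assumes "prime p" "Suc m < p"
  shows "int p dvd (\<Sum>t<p. int t ^ m)"
  using assms(2)
proof (induction m rule: less_induct)
  case (less m)
  let ?S = "\<lambda>k. \<Sum>t<p. int t ^ k"
  have "int p ^ Suc m = (\<Sum>t<p. int (Suc t) ^ Suc m - int t ^ Suc m)"
    by (subst sum_lessThan_telescope) simp
  also have "\<dots> = (\<Sum>t<p. \<Sum>k\<le>m. of_nat (Suc m choose k) * int t ^ k)"
  proof (rule sum.cong)
    fix t
    have "int (Suc t) ^ Suc m = (int t + 1) ^ Suc m" by (simp add: add.commute)
    also have "\<dots> = (\<Sum>k\<le>Suc m. of_nat (Suc m choose k) * int t ^ k)"
      by (subst binomial_ring) simp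
    finally show "int (Suc t) ^ Suc m - int t ^ Suc m
        = (\<Sum>k\<le>m. of_nat (Suc m choose k) * int t ^ k)" by simp
  qed simp
  also have "\<dots> = (\<Sum>k\<le>m. of_nat (Suc m choose k) * ?S k)"
    by (subst sum.swap) (simp add: sum_distrib_left)
  also have "\<dots> = (\<Sum>k<m. of_nat (Suc m choose k) * ?S k) + of_nat (Suc m) * ?S m"
    by (simp add: lessThan_Suc_atMost[symmetric])
  finally have eq: "int (Suc m) * ?S m = int p ^ Suc m - (\<Sum>k<m. of_nat (Suc m choose k) * ?S k)"
    by simp
  have "int p dvd int (Suc m) * ?S m"
    unfolding eq using less by (intro dvd_diff dvd_sum) auto
  moreover have "\<not> int p dvd int (Suc m)"
    using less.prems by (metis int_dvd_int_iff nat_dvd_not_less zero_less_Suc)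
  moreover have "prime (int p)" using assms(1) by simp
  ultimately show ?case using prime_dvd_mult_iff by blast
qed

definition nat_box :: "nat \<Rightarrow> ('n \<Rightarrow> nat) set" where
  "nat_box p = {y. \<forall>i. y i < p}"

lemma nat_box_PiE: "nat_box p = PiE UNIV (\<lambda>_. {..<p})"
  by (auto simp: nat_box_def PiE_def)

lemma finite_nat_box: "finite (nat_box p :: ('n::finite \<Rightarrow> nat) set)"
  unfolding nat_box_PiE by (intro finite_PiE) auto

abbreviation weighted_sum :: "nat \<Rightarrow> (('n::finite \<Rightarrow> int) \<Rightarrow> int) \<Rightarrow> ('n \<Rightarrow> nat) \<Rightarrow> int" where
  "weighted_sum p h e \<equiv> (\<Sum>y\<in>nat_box p. h (\<lambda>i. int (y i)) * (\<Prod>i\<in>UNIV. int (y i) ^ e i))"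

text \<open>The hypothesis says that, in sums against monomials, \<open>h\<close> behaves like a
  polynomial of degree \<open>k\<close>. With \<open>h\<close> as an accumulated factor, the
  induction passes through products without expanding \<open>f\<close> into monomials.\<close>

lemma poly_fun_sum_nat_box:
  fixes h :: "('n::finite \<Rightarrow> int) \<Rightarrow> int"
  assumes "poly_fun d f"
    and "\<And>e :: 'n \<Rightarrow> nat. k + sum e UNIV < N \<Longrightarrow>
      int p dvd weighted_sum p h e"
    and "k + d + sum e UNIV < N"
  shows "int p dvd weighted_sum p (\<lambda>x. f x * h x) e"
  using assms
proof (induction arbitrary: k h e)
  case (const d c)
  have "int p dvd c * weighted_sum p h e"
    using const by (intro dvd_mult) auto
  then show ?case by (simp add: sum_distrib_left mult.assoc)
next
  case (var d j)
  define e' where "e' i = e i + (if i = j then 1 else 0)" for i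
  have "sum e' UNIV = sum e UNIV + 1" by (simp add: e'_def sum.distrib)
  then have "int p dvd weighted_sum p h e'"
    using var by auto
  moreover have "(\<Prod>i\<in>UNIV. int (y i) ^ e' i) = int (y j) * (\<Prod>i\<in>UNIV. int (y i) ^ e i)" for y
  proof -
    have "(\<Prod>i\<in>UNIV. int (y i) ^ e' i) = (\<Prod>i\<in>UNIV. int (y i) ^ e i * (if i = j then int (y j) else 1))"
      by (rule prod.cong) (auto simp: e'_def)
    then show ?thesis by (simp add: prod.distrib)
  qed
  ultimately show ?case by (simp add: mult_ac)
next
  case (add d f g)
  have "int p dvd weighted_sum p (\<lambda>x. f x * h x) e
    + weighted_sum p (\<lambda>x. g x * h x) e"
    by (rule dvd_add[OF add.IH(1)[OF add.prems] add.IH(2)[OF add.prems]])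
  then show ?case by (simp add: sum.distrib[symmetric] algebra_simps)
next
  case (mult d f e' g)
  have "int p dvd weighted_sum p (\<lambda>x. f x * (g x * h x)) e"
  proof (rule mult.IH(1)[where k = "k + e'" and h = "\<lambda>x. g x * h x"])
    show "k + e' + d + sum e UNIV < N" using mult.prems by simp
    fix e2 :: "'n \<Rightarrow> nat" assume "k + e' + sum e2 UNIV < N"
    then show "int p dvd weighted_sum p (\<lambda>x. g x * h x) e2"
      using mult.prems(1) by (intro mult.IH(2)[where k = k]) auto
  qed
  then show ?case by (simp add: mult.assoc)
qed

lemma poly_fun_sum_nat_box_dvd:
  fixes f :: "('n::finite \<Rightarrow> int) \<Rightarrow> int"
  assumes "prime p" "poly_fun d f" "d < CARD('n) * (p - 1)"
  shows "int p dvd (\<Sum>y\<in>nat_box p. f (\<lambda>i. int (y i)))"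
proof -
  have "int p dvd (\<Sum>y\<in>nat_box p. (f (\<lambda>i. int (y i)) * 1) * (\<Prod>i\<in>UNIV. int (y i) ^ (\<lambda>i. 0) i))"
  proof (rule poly_fun_sum_nat_box[OF assms(2), where h = "\<lambda>x. 1" and k = 0 and N = "CARD('n) * (p - 1)"])
    fix e :: "'n \<Rightarrow> nat" assume e: "0 + sum e UNIV < CARD('n) * (p - 1)"
    \<comment> \<open>The sum over the box factors into power sums, one for each variable. An
      exponent below p - 1 makes its factor divisible by p.\<close>
    have "\<exists>j. e j < p - 1"
    proof (rule ccontr)
      assume "\<nexists>j. e j < p - 1"
      then have "(\<Sum>j\<in>(UNIV :: 'n set). p - 1) \<le> sum e UNIV" by (intro sum_mono) (auto simp: not_less)
      then show False using e by simp
    qed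
    then obtain j where "e j < p - 1" by blast
    then have j: "int p dvd (\<Sum>t<p. int t ^ e j)" using sum_powers_dvd[OF assms(1)] by simp
    have "(\<Sum>y\<in>nat_box p. (\<Prod>i\<in>UNIV. int (y i) ^ e i)) = (\<Prod>i\<in>UNIV. \<Sum>t<p. int t ^ e i)"
      unfolding nat_box_PiE by (subst prod_sum_PiE) auto
    also have "int p dvd \<dots>"
      using j by (rule dvd_trans) (rule dvd_prodI, auto)
    finally show "int p dvd (\<Sum>y\<in>nat_box p. 1 * (\<Prod>i\<in>UNIV. int (y i) ^ e i))" by simp
  qed (use assms in auto)
  then show ?thesis by simp
qed

lemma fermat_nat:
  assumes "prime p"
  shows "int p dvd int b ^ p - int b"
proof (induction b)
  case 0
  then show ?case using prime_gt_0_nat[OF assms] by (simp add: zero_power)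
next
  case (Suc b)
  obtain q where q: "p = Suc q" using prime_gt_0_nat[OF assms] by (cases p) auto
  have "int (Suc b) ^ p = (int b + 1) ^ p" by (simp add: add.commute)
  also have "\<dots> = (\<Sum>k\<le>p. of_nat (p choose k) * int b ^ k)"
    by (subst binomial_ring) simp
  also have "\<dots> = (\<Sum>k\<le>q. of_nat (p choose k) * int b ^ k) + int b ^ p"
    unfolding q by simp
  also have "(\<Sum>k\<le>q. of_nat (p choose k) * int b ^ k)
      = 1 + (\<Sum>k\<in>{..q} - {0}. of_nat (p choose k) * int b ^ k)"
    by (subst sum.remove[of _ 0]) auto
  finally have "int (Suc b) ^ p - int (Suc b)
      = (\<Sum>k\<in>{..q} - {0}. of_nat (p choose k) * int b ^ k) + (int b ^ p - int b)"
    by simp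
  moreover have "int p dvd (\<Sum>k\<in>{..q} - {0}. of_nat (p choose k) * int b ^ k)"
  proof (rule dvd_sum)
    fix k assume "k \<in> {..q} - {0}"
    then have "p dvd p choose k" using assms q by (intro dvd_choose_prime) auto
    then show "int p dvd of_nat (p choose k) * int b ^ k" by (simp add: dvd_mult2)
  qed
  ultimately show ?case using Suc by (metis dvd_add)
qed

lemma fermat_int:
  assumes "prime p" "\<not> int p dvd a"
  shows "int p dvd a ^ (p - 1) - 1"
proof -
  define b where "b = nat (a mod int p)"
  have p0: "int p > 0" using assms(1) prime_gt_0_nat by simp
  have b: "int b = a mod int p" using p0 by (simp add: b_def)
  have nb: "\<not> int p dvd int b" using assms(2) b by (simp add: dvd_mod_iff)
  have "int b ^ p = int b * int b ^ (p - 1)" using p0 by (cases p) auto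
  then have "int b ^ p - int b = int b * (int b ^ (p - 1) - 1)" by (simp add: algebra_simps)
  then have "int p dvd int b * (int b ^ (p - 1) - 1)" using fermat_nat[OF assms(1), of b] by simp
  then have "int p dvd int b ^ (p - 1) - 1"
    using nb assms(1) prime_dvd_mult_iff[of "int p" "int b" "int b ^ (p - 1) - 1"] by simp
  then have "[int b ^ (p - 1) = 1] (mod int p)" by (simp add: cong_iff_dvd_diff)
  moreover have "[a ^ (p - 1) = int b ^ (p - 1)] (mod int p)"
    by (intro cong_pow) (simp add: b cong_def)
  ultimately show ?thesis by (meson cong_iff_dvd_diff cong_trans)
qed

theorem chevalley_warning:
  fixes fs :: "(nat \<times> (('n::finite \<Rightarrow> int) \<Rightarrow> int)) list"
  assumes p: "prime p" and fs: "\<forall>(d, f)\<in>set fs. poly_fun d f \<and> f (\<lambda>_. 0) = 0"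
    and deg: "sum_list (map fst fs) < CARD('n)"
  shows "\<exists>x. (\<exists>i. \<not> int p dvd x i) \<and> (\<forall>(d, f)\<in>set fs. int p dvd f x)"
proof (rule ccontr)
  assume none: "\<nexists>x. (\<exists>i. \<not> int p dvd x i) \<and> (\<forall>(d, f)\<in>set fs. int p dvd f x)"
  \<comment> \<open>Mod p this is the indicator function of the common zeros. If 0 is the only one,
    its sum over the box is 1 mod p, whereas its degree makes the sum 0.\<close>
  define g where "g x = (\<Prod>(d, f)\<leftarrow>fs. 1 - f x ^ (p - 1))" for x
  have p1: "p > 1" using p prime_gt_1_nat by blast
  have "poly_fun (sum_list (map fst fs) * (p - 1)) (\<lambda>x. \<Prod>(d, f)\<leftarrow>fs. 1 - f x ^ (p - 1))"
    using fs
  proof (induction fs)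
    case (Cons df fs)
    obtain d f where df: "df = (d, f)" by fastforce
    have "poly_fun ((p - 1) * d) (\<lambda>x. 1 + (-1) * f x ^ (p - 1))"
      using Cons.prems poly_fun.mult[OF poly_fun.const[of 0 "-1"] poly_fun_power[of d f "p - 1"]] df
      by (intro poly_fun.add poly_fun.const) auto
    from poly_fun.mult[OF this Cons.IH] Cons.prems
    show ?case by (simp add: df algebra_simps)
  qed (simp add: poly_fun.const)
  moreover have "sum_list (map fst fs) * (p - 1) < CARD('n) * (p - 1)" using deg p1 by simp
  ultimately have "int p dvd (\<Sum>y\<in>nat_box p. g (\<lambda>i::'n. int (y i)))"
    unfolding g_def by (rule poly_fun_sum_nat_box_dvd[OF p])
  also have "(\<Sum>y\<in>nat_box p. g (\<lambda>i::'n. int (y i)))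
      = g (\<lambda>_. 0) + (\<Sum>y\<in>nat_box p - {\<lambda>_. 0}. g (\<lambda>i. int (y i)))"
    using p1 by (subst sum.remove[OF finite_nat_box, of "\<lambda>_. 0"]) (auto simp: nat_box_def)
  also have "g (\<lambda>_. 0) = 1"
    unfolding g_def using fs p1 by (induction fs) auto
  finally have "int p dvd 1 + (\<Sum>y\<in>nat_box p - {\<lambda>_::'n. 0}. g (\<lambda>i. int (y i)))" .
  moreover have "int p dvd (\<Sum>y\<in>nat_box p - {\<lambda>_::'n. 0}. g (\<lambda>i. int (y i)))"
  proof (rule dvd_sum)
    fix y :: "'n \<Rightarrow> nat" assume y: "y \<in> nat_box p - {\<lambda>_. 0}"
    then obtain i where "y i \<noteq> 0" by auto
    then have "\<not> int p dvd int (y i)" using y by (auto simp: nat_box_def dest!: dvd_imp_le leD)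
    then obtain d f where df: "(d, f) \<in> set fs" "\<not> int p dvd f (\<lambda>i. int (y i))"
      using none by fast
    have "int p dvd 1 - f (\<lambda>i. int (y i)) ^ (p - 1)"
      using fermat_int[OF p df(2)] by (metis dvd_diff_commute)
    also have "\<dots> dvd g (\<lambda>i. int (y i))"
      unfolding g_def using df(1) by (intro prod_list_dvd) force
    finally show "int p dvd g (\<lambda>i. int (y i))" .
  qed
  ultimately have "int p dvd 1" using dvd_add_left_iff by blast
  then show False using p1 by simp
qed

section \<open>Passing to sublattices of odd prime index\<close>

definition dot :: "('n::finite \<Rightarrow> int) \<Rightarrow> ('n \<Rightarrow> int) \<Rightarrow> int" where
  "dot X Y = (\<Sum>i\<in>UNIV. X i * Y i)"

lemma dot_simps:
  "dot (\<lambda>i. X i + Y i) Z = dot X Z + dot Y Z" "dot Z (\<lambda>i. X i + Y i) = dot Z X + dot Z Y"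
  "dot (\<lambda>i. X i - Y i) Z = dot X Z - dot Y Z" "dot Z (\<lambda>i. X i - Y i) = dot Z X - dot Z Y"
  "dot (\<lambda>i. c * X i) Z = c * dot X Z" "dot Z (\<lambda>i. c * X i) = c * dot Z X"
  by (simp_all add: dot_def algebra_simps sum.distrib sum_subtractf sum_distrib_left)

lemma dot_commute: "dot X Y = dot Y X"
  by (simp add: dot_def mult.commute)

definition vec_of :: "(6 \<Rightarrow> int) \<Rightarrow> real^6" where
  "vec_of X = (\<chi> i. of_int (X i))"

lemma vec_of_inner: "vec_of X \<bullet> vec_of Y = of_int (dot X Y)"
  by (simp add: vec_of_def inner_vec_def dot_def)

lemma vec_of_int_lattice: "vec_of X \<in> int_lattice"
  by (simp add: vec_of_def int_lattice_def)

lemma int_lattice_vec_of: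
  assumes "x \<in> int_lattice"
  obtains X where "x = vec_of X"
proof
  show "x = vec_of (\<lambda>i. \<lfloor>x $ i\<rfloor>)"
    using assms by (simp add: vec_of_def int_lattice_def vec_eq_iff)
qed

lemma vec_of_arith:
  "vec_of X - vec_of Y = vec_of (\<lambda>i. X i - Y i)" "vec_of X + vec_of Y = vec_of (\<lambda>i. X i + Y i)"
  "of_int c *\<^sub>R vec_of X = vec_of (\<lambda>i. c * X i)"
  by (simp_all add: vec_of_def vec_eq_iff)

lemma of_int_div_Ints: "n \<noteq> 0 \<Longrightarrow> real_of_int a / real n \<in> \<int> \<longleftrightarrow> int n dvd a"
proof
  assume n: "n \<noteq> 0" and "real_of_int a / real n \<in> \<int>"
  then obtain k where "real_of_int a / real n = of_int k" by (auto elim: Ints_cases)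
  then have "real_of_int a = of_int (int n * k)" using n by (simp add: field_simps)
  then have "a = int n * k" by (simp only: of_int_eq_iff)
  then show "int n dvd a" by simp
next
  assume "n \<noteq> 0" "int n dvd a"
  then show "real_of_int a / real n \<in> \<int>" by (auto elim!: dvdE)
qed

lemma div_vec_of_int_lattice:
  "p \<noteq> 0 \<Longrightarrow> (1 / real p) *\<^sub>R vec_of X \<in> int_lattice \<longleftrightarrow> (\<forall>i. int p dvd X i)"
  by (simp add: int_lattice_def vec_of_def of_int_div_Ints)

text \<open>Linear independence mod p: dividing the combination by p would give an integral vector
  of the plane with non-integral coefficients.\<close>

lemma primitive_pair_not_dvd:
  assumes "primitive_pair int_lattice (vec_of U) (vec_of V)" "prime p"
    and "\<And>i. int p dvd a * U i + b * V i"
  shows "int p dvd a" "int p dvd b"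
proof -
  have p0: "p \<noteq> 0" using assms(2) by auto
  have "(1 / real p) *\<^sub>R vec_of (\<lambda>i. a * U i + b * V i) \<in> int_lattice"
    using assms(3) p0 by (simp add: div_vec_of_int_lattice)
  also have "(1 / real p) *\<^sub>R vec_of (\<lambda>i. a * U i + b * V i)
      = (of_int a / real p) *\<^sub>R vec_of U + (of_int b / real p) *\<^sub>R vec_of V"
    by (simp add: vec_of_def vec_eq_iff add_divide_distrib)
  finally have "of_int a / real p \<in> \<int>" "of_int b / real p \<in> \<int>"
    by (rule primitive_pairD(3,4)[OF assms(1)])+
  then show "int p dvd a" "int p dvd b" using p0 by (simp_all add: of_int_div_Ints)
qed

text \<open>The neighbour loses \<open>u\<close>, since p does not divide
  \<open>u \<bullet> w\<close>, but keeps \<open>p u\<close> and \<open>v\<close>. By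
  \<open>ind\<close>, \<open>w\<close> is independent of \<open>u\<close> and \<open>v\<close>
  modulo \<open>p L\<close>, so the adjoined vector \<open>w / p\<close> brings nothing new into
  their plane.\<close>

lemma neighbour_descent:
  assumes L: "unimodular L" and uv: "primitive_pair L u v" and p: "prime p"
    and w: "w \<in> L" "w \<bullet> w / (real p)\<^sup>2 \<in> \<int>" "u \<bullet> w / real p \<notin> \<int>" "v \<bullet> w / real p \<in> \<int>"
    and ind: "\<And>\<gamma> \<delta>. \<gamma> \<in> \<int> \<Longrightarrow> \<delta> \<in> \<int> \<Longrightarrow> (1 / real p) *\<^sub>R (w - \<gamma> *\<^sub>R u - \<delta> *\<^sub>R v) \<notin> L"
  shows "prim_represented ((real p)\<^sup>2 * (u \<bullet> u)) (real p * (u \<bullet> v)) (v \<bullet> v)"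
proof -
  note uvD = primitive_pairD[OF uv] and grp = unimodular_subgroup[OF L] and int = unimodular_Ints[OF L]
  have p0: "real p > 0" using p prime_gt_0_nat by simp
  have pp: "prime (int p)" using p by simp
  define N where "N = neighbour L p w"
  have N: "unimodular N" unfolding N_def by (rule unimodular_neighbour[OF L p w(1,2) uvD(1) w(3)])
  have "real p *\<^sub>R u \<in> L" using add_subgroup_scale_int[OF grp uvD(1), of "int p"] by simp
  moreover have "(real p *\<^sub>R u) \<bullet> w / real p \<in> \<int>" using int[OF uvD(1) w(1)] p0 by simp
  ultimately have pu: "real p *\<^sub>R u \<in> N" unfolding N_def by (rule neighbourI_0)
  have vN: "v \<in> N" unfolding N_def by (rule neighbourI_0[OF uvD(2) w(4)])
  have "\<alpha> \<in> \<int> \<and> \<beta> \<in> \<int>" if mem: "\<alpha> *\<^sub>R (real p *\<^sub>R u) + \<beta> *\<^sub>R v \<in> N" for \<alpha> \<beta>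
  proof -
    obtain z k where z: "\<alpha> *\<^sub>R (real p *\<^sub>R u) + \<beta> *\<^sub>R v = z + (k / real p) *\<^sub>R w"
      "z \<in> L" "z \<bullet> w / real p \<in> \<int>" "k \<in> \<int>"
      using mem unfolding N_def neighbour_def by blast
    obtain k' where k': "k = of_int k'" using z(4) by (auto elim: Ints_cases)
    have eq2: "(\<alpha> * (real p)\<^sup>2) *\<^sub>R u + (\<beta> * real p) *\<^sub>R v = real p *\<^sub>R z + k *\<^sub>R w"
      using arg_cong[OF z(1), of "\<lambda>x. real p *\<^sub>R x"] p0
      by (simp add: algebra_simps power2_eq_square)
    have "real p *\<^sub>R z + k *\<^sub>R w \<in> L"
      using add_subgroup_scale_int[OF grp z(2), of "int p"] add_subgroup_scale_int[OF grp w(1), of k']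
        add_subgroup_add[OF grp] by (simp add: k')
    then have i1: "\<alpha> * (real p)\<^sup>2 \<in> \<int>" "\<beta> * real p \<in> \<int>"
      using uvD(3,4)[of "\<alpha> * (real p)\<^sup>2" "\<beta> * real p"] eq2 by simp_all
    \<comment> \<open>Otherwise a multiple of the relation would express \<open>w\<close> through
      \<open>u\<close> and \<open>v\<close> modulo \<open>p L\<close>.\<close>
    have "int p dvd k'"
    proof (rule ccontr)
      assume "\<not> int p dvd k'"
      then have "gcd (int p) k' = 1" using prime_imp_coprime[OF pp] coprime_iff_gcd_eq_1 by blast
      then obtain l m where lm: "l * int p + m * k' = 1" using bezout_int[of "int p" k'] by auto
      have lm': "of_int m * k = 1 - of_int l * real p"
        using arg_cong[OF lm, of real_of_int] by (simp add: k')
      let ?g = "of_int m * (\<alpha> * (real p)\<^sup>2)" and ?d = "of_int m * (\<beta> * real p)"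
      have "?g *\<^sub>R u + ?d *\<^sub>R v = of_int m *\<^sub>R (real p *\<^sub>R z + k *\<^sub>R w)"
        unfolding eq2[symmetric] by (simp add: algebra_simps)
      also have "\<dots> = (of_int m * real p) *\<^sub>R z + (of_int m * k) *\<^sub>R w" by (simp add: algebra_simps)
      finally have "w - ?g *\<^sub>R u - ?d *\<^sub>R v = real p *\<^sub>R (of_int l *\<^sub>R w - of_int m *\<^sub>R z)"
        unfolding lm' by (simp add: algebra_simps)
      then have "(1 / real p) *\<^sub>R (w - ?g *\<^sub>R u - ?d *\<^sub>R v) = of_int l *\<^sub>R w - of_int m *\<^sub>R z"
        using p0 by simp
      moreover have "of_int l *\<^sub>R w - of_int m *\<^sub>R z \<in> L"
        using grp w(1) z(2) by (intro add_subgroup_diff add_subgroup_scale_int)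
      moreover have "?g \<in> \<int>" "?d \<in> \<int>" using i1 by auto
      ultimately show False using ind by metis
    qed
    then obtain l where l: "k' = int p * l" by (elim dvdE)
    have eq3: "(\<alpha> * real p) *\<^sub>R u + \<beta> *\<^sub>R v = z + of_int l *\<^sub>R w"
      using z(1) p0 by (simp add: k' l)
    moreover have "z + of_int l *\<^sub>R w \<in> L"
      using grp w(1) z(2) by (intro add_subgroup_add add_subgroup_scale_int)
    ultimately have i2: "\<alpha> * real p \<in> \<int>" "\<beta> \<in> \<int>" using uvD(3,4)[of "\<alpha> * real p" \<beta>] by simp_all
    obtain i where i: "\<alpha> * real p = of_int i" using i2(1) by (auto elim: Ints_cases)
    obtain m where m: "u \<bullet> w = of_int m" using int[OF uvD(1) w(1)] by (auto elim: Ints_cases)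
    \<comment> \<open>Pairing with \<open>w\<close>: p divides the product of \<open>i\<close> =
      \<alpha> p and \<open>m\<close>, but not \<open>m\<close>.\<close>
    have "\<alpha> * real p * (u \<bullet> w / real p) = (z + of_int l *\<^sub>R w) \<bullet> w / real p - \<beta> * (v \<bullet> w / real p)"
      unfolding eq3[symmetric] using p0 by (simp add: inner_simps field_simps)
    also have "\<dots> = z \<bullet> w / real p + of_int l * real p * (w \<bullet> w / (real p)\<^sup>2) - \<beta> * (v \<bullet> w / real p)"
      using p0 by (simp add: inner_simps field_simps power2_eq_square)
    also have "\<dots> \<in> \<int>"
      using w z(3) i2(2) by (intro Ints_add Ints_diff Ints_mult) auto
    finally have "of_int (i * m) / real p \<in> \<int>" by (simp add: i m)
    then have "int p dvd i * m" using p0 of_int_div_Ints[of p "i * m"] by simp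
    moreover have "\<not> int p dvd m" using w(3) p0 of_int_div_Ints[of p m] by (simp add: m)
    ultimately have "int p dvd i" using pp prime_dvd_mult_iff by blast
    then obtain j where "i = int p * j" by (elim dvdE)
    then have "\<alpha> = of_int j" using i p0 by simp
    then show ?thesis using i2(2) by simp
  qed
  then have "primitive_pair N (real p *\<^sub>R u) v" using pu vN by (simp add: primitive_pair_def)
  from prim_representedI[OF N this] show ?thesis by (simp add: power2_eq_square mult.assoc)
qed

lemma linear_congruence:
  assumes "prime p" "\<not> int p dvd a"
  obtains t where "int p dvd b + t * a"
proof -
  have "gcd (int p) a = 1" using assms prime_imp_coprime[of "int p" a] coprime_iff_gcd_eq_1 by auto
  then obtain l m where "l * int p + m * a = 1" using bezout_int[of "int p" a] by auto
  then have "b + (- b * m) * a = b * (l * int p + m * a) - b * (m * a)" by simp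
  also have "\<dots> = int p * (b * l)" by (simp add: algebra_simps)
  finally have "b + (- b * m) * a = int p * (b * l)" .
  then have "int p dvd b + (- b * m) * a" by simp
  then show ?thesis using that by blast
qed

text \<open>
  The condition on \<open>H k\<close> makes \<open>H\<close> linearly independent of \<open>V\<close> mod \<open>p\<close> if \<open>p\<close> does not divide \<open>V k\<close>.
\<close>

lemma isotropic_mod_prime:
  fixes U V :: "6 \<Rightarrow> int"
  assumes "prime p"
  obtains H where "int p dvd dot H U" "int p dvd dot H V" "int p dvd dot H H" "int p dvd H k"
    "\<exists>i. \<not> int p dvd H i"
proof -
  \<comment> \<open>The degrees add up to 1 + 1 + 2 + 1 = 5, just below the number 6 of
    variables.\<close>
  let ?fs = "[(1, \<lambda>x. \<Sum>i\<in>UNIV. x i * U i), (1, \<lambda>x. \<Sum>i\<in>UNIV. x i * V i),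
    (2, \<lambda>x. \<Sum>i\<in>UNIV. x i * x i), (1, \<lambda>x. x k)] :: (nat \<times> ((6 \<Rightarrow> int) \<Rightarrow> int)) list"
  have v: "poly_fun 1 (\<lambda>x. x i)" for i :: 6 using poly_fun.var[of 0 i] by simp
  have "poly_fun 1 (\<lambda>x. x i * c)" for i :: 6 and c
    using poly_fun.mult[OF v poly_fun.const[of 0 c]] by simp
  moreover have "poly_fun 2 (\<lambda>x. x i * x i)" for i :: 6
    using poly_fun.mult[OF v v, of i i] by (simp add: numeral_2_eq_2)
  ultimately have "\<forall>(d, f)\<in>set ?fs. poly_fun d f \<and> f (\<lambda>_. 0) = 0"
    using v by (auto intro!: poly_fun_sum)
  from chevalley_warning[OF assms this] show ?thesis using that by (auto simp: dot_def)
qed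

text \<open>The neighbour is defined by a vector \<open>W\<close> that is congruent to
  \<open>Y\<close> plus a multiple of \<open>H\<close> mod p. As \<open>H\<close> is isotropic and
  orthogonal to \<open>U\<close> and \<open>V\<close> mod p, adding multiples of it adjusts the norm
  of \<open>W\<close> but not its products with \<open>U\<close>, \<open>V\<close> and
  \<open>H\<close>. A nonzero product of \<open>W\<close> with \<open>H\<close> mod p then proves
  that \<open>W\<close> is independent of \<open>U\<close> and \<open>V\<close>.\<close>

lemma prim_represented_mult_odd:
  assumes abc: "prim_represented a b c" and p: "prime p" "odd p"
  shows "prim_represented ((real p)\<^sup>2 * a) (real p * b) c"
proof -
  obtain u v where uv: "primitive_pair int_lattice u v" and g: "u \<bullet> u = a" "u \<bullet> v = b" "v \<bullet> v = c"
    using prim_represented_int_lattice[OF abc] by blast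
  obtain U where U: "u = vec_of U" using primitive_pairD(1)[OF uv] int_lattice_vec_of by blast
  obtain V where V: "v = vec_of V" using primitive_pairD(2)[OF uv] int_lattice_vec_of by blast
  note nd = primitive_pair_not_dvd[OF uv[unfolded U V] p(1)]
  have pp: "prime (int p)" and p0: "p \<noteq> 0" using p by auto
  have p2: "\<not> int p dvd 2" using p 
    by (metis dvd_antisym even_of_nat int_dvd_int_iff of_nat_numeral primes_dvd_imp_eq two_is_prime_nat dvd_refl)
  have "\<exists>k. \<not> int p dvd V k"
  proof (rule ccontr)
    assume "\<nexists>k. \<not> int p dvd V k"
    then have "int p dvd 1" using nd(2)[of 0 1] by simp
    then show False using pp by auto
  qed
  then obtain k where k: "\<not> int p dvd V k" by blast
  obtain H where H: "int p dvd dot H U" "int p dvd dot H V" "int p dvd dot H H" "int p dvd H k"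
    "\<exists>i. \<not> int p dvd H i"
    using isotropic_mod_prime[OF p(1)] by blast
  \<comment> \<open>These vectors are orthogonal to \<open>V\<close> exactly. Mod p,
    \<open>Z j1\<close> is not orthogonal to \<open>U\<close> and \<open>Z j2\<close> is not
    orthogonal to \<open>H\<close>; one of them or their sum has both properties.\<close>
  define Z where "Z j i = V k * (if i = j then 1 else 0) - V j * (if i = k then 1 else 0)" for j i :: 6
  have ZX: "dot (Z j) X = V k * X j - V j * X k" for j X
  proof -
    have "dot (Z j) X = (\<Sum>i\<in>UNIV. V k * (if i = j then X i else 0) - V j * (if i = k then X i else 0))"
      unfolding dot_def by (rule sum.cong) (auto simp: Z_def)
    then show ?thesis by (simp add: sum_subtractf sum_distrib_left[symmetric])
  qed
  have "\<exists>j. \<not> int p dvd dot (Z j) U"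
  proof (rule ccontr)
    assume "\<nexists>j. \<not> int p dvd dot (Z j) U"
    then have "int p dvd V k * U j + (- U k) * V j" for j by (simp add: ZX mult.commute)
    then show False using nd(1) k by blast
  qed
  then obtain j1 where j1: "\<not> int p dvd dot (Z j1) U" by blast
  obtain j2 where "\<not> int p dvd H j2" using H(5) by blast
  then have "\<not> int p dvd V k * H j2" using k pp prime_dvd_mult_iff by blast
  then have j2: "\<not> int p dvd dot (Z j2) H" using H(4) unfolding ZX 
    by (metis diff_add_cancel dvd_add dvd_mult)
  obtain Y where Y: "dot Y V = 0" "\<not> int p dvd dot Y U" "\<not> int p dvd dot Y H"
  proof (cases "int p dvd dot (Z j1) H")
    case False
    then show ?thesis using that[of "Z j1"] j1 by (simp add: ZX mult.commute)
  next
    case T1: True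
    show ?thesis
    proof (cases "int p dvd dot (Z j2) U")
      case False
      then show ?thesis using that[of "Z j2"] j2 by (simp add: ZX mult.commute)
    next
      case True
      have "dot (\<lambda>i. Z j1 i + Z j2 i) V = 0" by (simp add: dot_simps ZX mult.commute)
      moreover have "\<not> int p dvd dot (\<lambda>i. Z j1 i + Z j2 i) U"
        using True j1 by (simp add: dot_simps dvd_add_left_iff)
      moreover have "\<not> int p dvd dot (\<lambda>i. Z j1 i + Z j2 i) H"
        using T1 j2 by (simp add: dot_simps dvd_add_right_iff)
      ultimately show ?thesis using that by blast
    qed
  qed
  have nd2: "\<not> int p dvd 2 * x" if "\<not> int p dvd x" for x
    using that p2 pp prime_dvd_mult_iff by blast
  \<comment> \<open>Hensel lifting along \<open>H\<close>: \<open>t\<close> makes the norm divisible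
    by p, and \<open>s\<close> below makes it divisible by p^2. Both times the coefficient of the
    unknown is twice a product with \<open>H\<close>, invertible because p is odd.\<close>
  obtain t where t: "int p dvd dot Y Y + t * (2 * dot Y H)"
    using linear_congruence[OF p(1) nd2[OF Y(3)]] by blast
  define W1 where "W1 i = Y i + t * H i" for i
  have W1: "dot W1 X = dot Y X + t * dot H X" for X by (simp add: W1_def[abs_def] dot_simps)
  have "dot W1 W1 = (dot Y Y + t * (2 * dot Y H)) + t\<^sup>2 * dot H H"
    unfolding W1_def[abs_def] dot_simps dot_commute[of H Y]
    by (simp add: power2_eq_square algebra_simps)
  then have "int p dvd dot W1 W1" using t H(3) by simp
  then obtain q where q: "dot W1 W1 = int p * q" by (elim dvdE)
  have W1H: "\<not> int p dvd dot W1 H" using Y(3) H(3) by (simp add: W1 dvd_add_left_iff)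
  obtain s where s: "int p dvd q + s * (2 * dot W1 H)"
    using linear_congruence[OF p(1) nd2[OF W1H]] by blast
  define W where "W i = W1 i + int p * s * H i" for i
  have W: "dot W X = dot Y X + (t + int p * s) * dot H X" for X
    unfolding W_def[abs_def] dot_simps W1 by (simp add: algebra_simps)
  have "dot W W = int p * (q + s * (2 * dot W1 H)) + (int p)\<^sup>2 * (s\<^sup>2 * dot H H)"
    using q unfolding W_def[abs_def] dot_simps dot_commute[of H W1]
    by (simp add: power2_eq_square algebra_simps)
  moreover have "int p * int p dvd int p * (q + s * (2 * dot W1 H))" using s by (intro mult_dvd_mono) auto
  ultimately have "(int p)\<^sup>2 dvd dot W W" by (simp add: power2_eq_square)
  then obtain m where m: "dot W W = (int p)\<^sup>2 * m" by (elim dvdE)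
  define w where "w = vec_of W"
  have "prim_represented ((real p)\<^sup>2 * (u \<bullet> u)) (real p * (u \<bullet> v)) (v \<bullet> v)"
  proof (rule neighbour_descent[OF unimodular_int_lattice uv p(1), of w])
    show "w \<in> int_lattice" by (simp add: w_def vec_of_int_lattice)
    show "w \<bullet> w / (real p)\<^sup>2 \<in> \<int>" using p0 by (simp add: w_def vec_of_inner m)
    have "\<not> int p dvd dot W U" using Y(2) H(1) by (simp add: W dvd_add_left_iff)
    then show "u \<bullet> w / real p \<notin> \<int>"
      using p0 by (simp add: U w_def vec_of_inner of_int_div_Ints dot_commute[of U])
    have "int p dvd dot W V" using Y(1) H(2) by (simp add: W)
    then show "v \<bullet> w / real p \<in> \<int>"
      using p0 by (simp add: V w_def vec_of_inner of_int_div_Ints dot_commute[of V])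
    fix \<gamma> \<delta> :: real assume "\<gamma> \<in> \<int>" "\<delta> \<in> \<int>"
    then obtain g d where gd: "\<gamma> = of_int g" "\<delta> = of_int d" by (meson Ints_cases)
    show "(1 / real p) *\<^sub>R (w - \<gamma> *\<^sub>R u - \<delta> *\<^sub>R v) \<notin> int_lattice"
    proof
      assume "(1 / real p) *\<^sub>R (w - \<gamma> *\<^sub>R u - \<delta> *\<^sub>R v) \<in> int_lattice"
      then have dv: "\<forall>i. int p dvd W i - g * U i - d * V i"
        unfolding U V w_def gd vec_of_arith div_vec_of_int_lattice[OF p0] .
      have "int p dvd dot (\<lambda>i. W i - g * U i - d * V i) H"
        unfolding dot_def using dv by (intro dvd_sum dvd_mult2) blast
      also have "dot (\<lambda>i. W i - g * U i - d * V i) H = dot W H - g * dot U H - d * dot V H"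
        by (simp add: dot_simps)
      finally have "int p dvd dot W H"
        using H(1,2) by (metis diff_add_cancel dot_commute dvd_add dvd_mult)
      then show False using Y(3) H(3) by (simp add: W dvd_add_left_iff)
    qed
  qed
  then show ?thesis by (simp add: g)
qed

section \<open>Passing to sublattices of index 2\<close>

lemma obtain_pair_of_types:
  fixes t :: "'n::finite \<Rightarrow> 'b"
  assumes "if s = s' then 2 \<le> card {k. t k = s} else 1 \<le> card {k. t k = s} \<and> 1 \<le> card {k. t k = s'}"
  obtains i j where "i \<noteq> j" "t i = s" "t j = s'"
proof (cases "s = s'")
  case True
  then have "\<not> card {k. t k = s} \<le> Suc 0" using assms by simp
  then obtain i j where "i \<in> {k. t k = s}" "j \<in> {k. t k = s}" "i \<noteq> j"
    by (auto simp: card_le_Suc0_iff_eq)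
  then show ?thesis using that[of i j] True by simp
next
  case False
  then have "{k. t k = s} \<noteq> {}" "{k. t k = s'} \<noteq> {}"
    using assms by (metis card.empty not_one_le_zero)+
  then obtain i j where "t i = s" "t j = s'" by blast
  then show ?thesis using that[of i j] False by auto
qed

text \<open>Here and in the next two lemmas, \<open>a\<close>, \<open>b\<close>, \<open>c\<close>,
  \<open>d\<close> count the coordinates at which the entries of \<open>U\<close> and
  \<open>V\<close> are odd-odd, odd-even, even-odd and even-even. Each alternative of the conclusion
  names two types from which the positions \<open>i\<close> and \<open>j\<close> can be
  taken.\<close>

lemma type_counts_1:
  fixes a b c d :: nat
  assumes "even (a + b)" "odd (a + c)" "a + b + c + d = 6" "c \<ge> 1 \<or> d \<ge> 1" "a \<ge> 1 \<or> d \<ge> 1" "a \<ge> 1 \<or> b \<ge> 1"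
    "a \<ge> 1 \<or> c \<ge> 1"  "b \<ge> 1 \<or> c \<ge> 1"
  shows "(1 \<le> d \<and> 1 \<le> a) \<or> (1 \<le> c \<and> 1 \<le> b)"
proof (cases "a = 0 \<or> b \<noteq> 0 \<or> d \<noteq> 0")
  case True
  then show ?thesis using assms by auto
next
  case False
  then have "a + c = 6" using assms(3) by simp
  then show ?thesis using assms(2) by simp
qed

lemma type_counts_2:
  fixes a b c d :: nat
  assumes "even (a + b)" "\<not> odd (a + c)" "a + b + c + d = 6" "c \<ge> 1 \<or> d \<ge> 1" "a \<ge> 1 \<or> d \<ge> 1" "a \<ge> 1 \<or> b \<ge> 1"
    "a \<ge> 1 \<or> c \<ge> 1"  "b \<ge> 1 \<or> c \<ge> 1"
  shows "(1 \<le> d \<and> 1 \<le> b \<and> b + d \<noteq> 2) \<or> (1 \<le> c \<and> 1 \<le> a)"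
proof (rule ccontr)
  assume neg: "\<not> ?thesis"
  then have "b + d = 2" "1 \<le> b" "1 \<le> d" "a = 0 \<or> c = 0" using assms by auto
  then have "b = 1" "a + c = 4" using assms(3) by linarith+
  then have "a = 0 \<or> a = 4" using \<open>a = 0 \<or> c = 0\<close> by linarith
  then show False using assms(1) \<open>b = 1\<close> by auto
qed

lemma type_counts_3:
  fixes a b c d :: nat
  assumes "\<not> even (a + b)" "odd (a + c)" "a + b + c + d = 6" "c \<ge> 1 \<or> d \<ge> 1" "a \<ge> 1 \<or> d \<ge> 1" "a \<ge> 1 \<or> b \<ge> 1"
    "a \<ge> 1 \<or> c \<ge> 1"  "b \<ge> 1 \<or> c \<ge> 1"
  shows "(1 \<le> d \<and> 1 \<le> c) \<or> (1 \<le> b \<and> 1 \<le> a)"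
proof (cases "a = 0 \<or> b \<noteq> 0 \<or> d \<noteq> 0")
  case True
  then show ?thesis using assms by auto
next
  case False
  then have "a + c = 6" using assms(3) by simp
  then show ?thesis using assms(2) by simp
qed

lemma card_split:
  fixes P Q :: "'n::finite \<Rightarrow> bool"
  shows "card {k. P k} = card {k. P k \<and> Q k} + card {k. P k \<and> \<not> Q k}"
proof -
  have "{k. P k} = {k. P k \<and> Q k} \<union> {k. P k \<and> \<not> Q k}" by blast
  also have "card \<dots> = card {k. P k \<and> Q k} + card {k. P k \<and> \<not> Q k}"
    by (rule card_Un_disjoint) auto
  finally show ?thesis .
qed

text \<open>\<open>X\<close> and \<open>Y\<close> mark the odd entries of \<open>U\<close> and
  \<open>V\<close>. For the 0/1 vector \<open>W\<close> that vanishes exactly at \<open>i\<close>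
  and \<open>j\<close>, the conditions mean: odd product with \<open>U\<close>, even product with
  \<open>V\<close>, and \<open>W\<close> not congruent to \<open>V\<close> mod 2. The last one fails
  only if \<open>i\<close> and \<open>j\<close> are the two sole even entries of
  \<open>V\<close>.\<close>

lemma obtain_complement_pair:
  fixes X Y :: "6 \<Rightarrow> bool"
  assumes "\<exists>k. \<not> X k" "\<exists>k. X k = Y k" "\<exists>k. X k" "\<exists>k. Y k" "\<exists>k. X k \<noteq> Y k"
  obtains i j where "i \<noteq> j" "(X i \<noteq> X j) = even (card {k. X k})" "(Y i \<noteq> Y j) = odd (card {k. Y k})"
    "\<exists>k. (k \<noteq> i \<and> k \<noteq> j) \<noteq> Y k"
proof -
  note goal = that
  define t where "t k = (X k, Y k)" for k
  define n where "n s = card {k. t k = s}" for s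
  have n: "n (True, True) = card {k. X k \<and> Y k}" "n (True, False) = card {k. X k \<and> \<not> Y k}"
    "n (False, True) = card {k. \<not> X k \<and> Y k}" "n (False, False) = card {k. \<not> X k \<and> \<not> Y k}"
    by (simp_all add: n_def t_def)
  have cX: "card {k. X k} = n (True, True) + n (True, False)"
    unfolding n by (rule card_split)
  have cY: "card {k. Y k} = n (True, True) + n (False, True)"
    unfolding n using card_split[of Y X] by (simp add: conj_commute)
  have cnY: "card {k. \<not> Y k} = n (True, False) + n (False, False)"
    unfolding n using card_split[of "\<lambda>k. \<not> Y k" X] by (simp add: conj_commute)
  have "card {k. Y k} + card {k. \<not> Y k} = 6"
    using card_split[of "\<lambda>k::6. True" Y] by simp
  then have tot: "n (True, True) + n (True, False) + n (False, True) + n (False, False) = 6"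
    unfolding cY cnY by simp
  have pos: "n (a, b) \<ge> 1" if "X k = a" "Y k = b" for a b k
  proof -
    have "{k. t k = (a, b)} \<noteq> {}" using that by (auto simp: t_def)
    then show ?thesis unfolding n_def by (simp add: Suc_le_eq card_gt_0_iff)
  qed
  have h1: "n (False, True) \<ge> 1 \<or> n (False, False) \<ge> 1" using assms(1) pos by metis
  have h2: "n (True, True) \<ge> 1 \<or> n (False, False) \<ge> 1" using assms(2) pos by metis
  have h3: "n (True, True) \<ge> 1 \<or> n (True, False) \<ge> 1" using assms(3) pos by metis
  have h4: "n (True, True) \<ge> 1 \<or> n (False, True) \<ge> 1" using assms(4) pos by metis
  have h5: "n (True, False) \<ge> 1 \<or> n (False, True) \<ge> 1" using assms(5) pos by metis
  \<comment> \<open>The parities depend only on the types of \<open>i\<close> and \<open>j\<close>;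
    \<open>bb\<close> prevents these two from being all the even entries of
    \<open>V\<close>.\<close>
  have pick: ?thesis
    if ab: "if (a, b) = (a', b') then 2 \<le> n (a, b) else 1 \<le> n (a, b) \<and> 1 \<le> n (a', b')"
    and par: "(a \<noteq> a') = even (card {k. X k})" "(b \<noteq> b') = odd (card {k. Y k})"
    and bb: "b \<or> b' \<or> n (True, False) + n (False, False) \<noteq> 2" for a b a' b'
  proof -
    obtain i j where ij: "i \<noteq> j" "t i = (a, b)" "t j = (a', b')"
      by (rule obtain_pair_of_types[OF ab[unfolded n_def]])
    have "\<exists>k. (k \<noteq> i \<and> k \<noteq> j) \<noteq> Y k"
    proof (rule ccontr)
      assume "\<nexists>k. (k \<noteq> i \<and> k \<noteq> j) \<noteq> Y k"
      then have Y: "Y k \<longleftrightarrow> k \<noteq> i \<and> k \<noteq> j" for k by blast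
      then have nb: "\<not> b" "\<not> b'" using ij by (auto simp: t_def)
      have "{k. \<not> Y k} = {i, j}" using Y by auto
      then have "card {k. \<not> Y k} = 2" using ij(1) by simp
      then show False using bb nb unfolding cnY by simp
    qed
    moreover have "(X i \<noteq> X j) = even (card {k. X k})" "(Y i \<noteq> Y j) = odd (card {k. Y k})"
      using ij par by (simp_all add: t_def)
    ultimately show ?thesis using goal[OF ij(1)] by blast
  qed
  show ?thesis
  proof (cases "even (card {k. X k})"; cases "odd (card {k. Y k})")
    assume X: "even (card {k. X k})" and Y: "odd (card {k. Y k})"
    show ?thesis
      using type_counts_1[OF X[unfolded cX] Y[unfolded cY] tot h1 h2 h3 h4 h5]
        pick[of False False True True] pick[of False True True False] X Y
      by auto
  next
    assume X: "even (card {k. X k})" and Y: "\<not> odd (card {k. Y k})"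
    show ?thesis
      using type_counts_2[OF X[unfolded cX] Y[unfolded cY] tot h1 h2 h3 h4 h5]
        pick[of False False True False] pick[of False True True True] X Y
      by auto
  next
    assume X: "\<not> even (card {k. X k})" and Y: "odd (card {k. Y k})"
    show ?thesis
      using type_counts_3[OF X[unfolded cX] Y[unfolded cY] tot h1 h2 h3 h4 h5]
        pick[of False False False True] pick[of True False True True] X Y
      by auto
  next
    assume X: "\<not> even (card {k. X k})" and Y: "\<not> odd (card {k. Y k})"
    \<comment> \<open>Now \<open>i\<close> and \<open>j\<close> must have the same type. If no type
      would do, there could be at most 4 coordinates.\<close>
    have "(2 \<le> n (False, True) \<or> 2 \<le> n (True, True)) \<or>
        (2 \<le> n (False, False) \<and> n (True, False) + n (False, False) \<noteq> 2) \<or>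
        (2 \<le> n (True, False) \<and> n (True, False) + n (False, False) \<noteq> 2)"
      using tot by linarith
    then show ?thesis
      using pick[of False True False True] pick[of True True True True] pick[of False False False False]
        pick[of True False True False] X Y
      by auto
  qed
qed

lemma odd_sum_iff_card: "odd (sum U (UNIV :: 'n::finite set)) \<longleftrightarrow> odd (card {k. odd (U k :: int)})"
  using even_sum_iff[of "UNIV :: 'n set" U] by simp

definition complement_pair :: "6 \<Rightarrow> 6 \<Rightarrow> 6 \<Rightarrow> int" where
  "complement_pair i j k = (if k = i \<or> k = j then 0 else 1)"

lemma dot_complement_pair:
  assumes "i \<noteq> j"
  shows "dot (complement_pair i j) U = sum U UNIV - U i - U j"
proof -
  have "dot (complement_pair i j) U = (\<Sum>k\<in>UNIV. U k - (if k = i then U k else 0) - (if k = j then U k else 0))"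
    unfolding dot_def by (rule sum.cong) (use assms in \<open>auto simp: complement_pair_def\<close>)
  then show ?thesis by (simp add: sum_subtractf)
qed

lemma odd_dot_complement_pair:
  assumes "i \<noteq> j"
  shows "odd (dot (complement_pair i j) U) \<longleftrightarrow> odd (card {k. odd (U k)}) \<noteq> (odd (U i) \<noteq> odd (U j))"
  unfolding dot_complement_pair[OF assms] odd_sum_iff_card[symmetric] by auto

lemma dot_complement_pair_self: "i \<noteq> j \<Longrightarrow> dot (complement_pair i j) (complement_pair i j) = 4"
proof -
  assume ij: "i \<noteq> j"
  have "{k. k \<noteq> i \<and> k \<noteq> j} = UNIV - {i, j}" by auto
  then have "card {k. k \<noteq> i \<and> k \<noteq> j} = 4" using ij by (simp add: card_Diff_subset)
  moreover have "dot (complement_pair i j) (complement_pair i j) = (\<Sum>k\<in>UNIV. if k \<noteq> i \<and> k \<noteq> j then 1 else 0)"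
    unfolding dot_def by (rule sum.cong) (auto simp: complement_pair_def)
  ultimately show ?thesis by (simp add: sum.If_cases)
qed

lemma even_dot: "(\<And>k. even (U k * V k)) \<Longrightarrow> even (dot U V)"
  unfolding dot_def by (rule dvd_sum) auto

lemma even_dot_odd_vector:
  assumes "\<And>k. odd (U k)"
  shows "even (dot E U) \<longleftrightarrow> even (dot E E)"
proof -
  have "even (dot E (\<lambda>k. U k - E k))" using assms by (intro even_dot) auto
  then show ?thesis by (simp add: dot_simps)
qed

lemma primitive_pair_odd_entries:
  assumes "primitive_pair int_lattice (vec_of U) (vec_of V)"
  shows "\<exists>k. odd (U k)" "\<exists>k. odd (V k)" "\<exists>k. odd (U k) \<noteq> odd (V k)"
proof -
  note nd = primitive_pair_not_dvd[OF assms two_is_prime_nat]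
  have False if "\<And>k. even (U k)"
    using nd(1)[of 1 0] that by simp
  then show "\<exists>k. odd (U k)" by blast
  have False if "\<And>k. even (V k)"
    using nd(2)[of 0 1] that by simp
  then show "\<exists>k. odd (V k)" by blast
  have False if "\<And>k. odd (U k) \<longleftrightarrow> odd (V k)"
    using nd(1)[of 1 1] that by simp
  then show "\<exists>k. odd (U k) \<noteq> odd (V k)" by blast
qed

text \<open>The vector \<open>W\<close> has norm 4, an odd product with \<open>U\<close> and an even
  one with \<open>V\<close>. If all entries of \<open>U\<close>, or of \<open>U + V\<close>, were
  odd, the product with \<open>W\<close> would have the parity of its norm, and no such
  \<open>W\<close> could exist; the two parity hypotheses exclude this.\<close>

lemma prim_represented_mult_2_aux:
  assumes uv: "primitive_pair int_lattice (vec_of U) (vec_of V)"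
    and "\<exists>k. even (U k)" "\<exists>k. even (U k + V k)"
  shows "prim_represented (4 * of_int (dot U U)) (2 * of_int (dot U V)) (of_int (dot V V))"
proof -
  have nonchar: "\<exists>k. \<not> odd (U k)" "\<exists>k. odd (U k) = odd (V k)" using assms(2,3) by auto
  obtain i j where ij: "i \<noteq> j" "(odd (U i) \<noteq> odd (U j)) = even (card {k. odd (U k)})"
    "(odd (V i) \<noteq> odd (V j)) = odd (card {k. odd (V k)})" "\<exists>k. (k \<noteq> i \<and> k \<noteq> j) \<noteq> odd (V k)"
    by (rule obtain_complement_pair[OF nonchar primitive_pair_odd_entries[OF uv]])
  define W where "W = complement_pair i j"
  have WU: "odd (dot W U)" and WV: "even (dot W V)" 
    using odd_dot_complement_pair[OF ij(1)] ij(2,3) unfolding W_def by blast+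
  have WW: "dot W W = 4" unfolding W_def by (rule dot_complement_pair_self[OF ij(1)])
  have Wodd: "odd (W k) \<longleftrightarrow> k \<noteq> i \<and> k \<noteq> j" for k by (simp add: W_def complement_pair_def)
  have "prim_represented ((real 2)\<^sup>2 * (vec_of U \<bullet> vec_of U)) (real 2 * (vec_of U \<bullet> vec_of V)) 
      (vec_of V \<bullet> vec_of V)"
  proof (rule neighbour_descent[OF unimodular_int_lattice uv two_is_prime_nat vec_of_int_lattice, of W])
    show "vec_of W \<bullet> vec_of W / (real 2)\<^sup>2 \<in> \<int>" by (simp add: vec_of_inner WW)
    show "vec_of U \<bullet> vec_of W / real 2 \<notin> \<int>"
      using WU of_int_div_Ints[of 2 "dot U W"] by (simp add: vec_of_inner dot_commute[of U W])
    show "vec_of V \<bullet> vec_of W / real 2 \<in> \<int>"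
      using WV of_int_div_Ints[of 2 "dot V W"] by (simp add: vec_of_inner dot_commute[of V W])
    fix \<gamma> \<delta> :: real assume "\<gamma> \<in> \<int>" "\<delta> \<in> \<int>"
    then obtain g d where gd: "\<gamma> = of_int g" "\<delta> = of_int d" by (meson Ints_cases)
    show "(1 / real 2) *\<^sub>R (vec_of W - \<gamma> *\<^sub>R vec_of U - \<delta> *\<^sub>R vec_of V) \<notin> int_lattice"
    proof
      assume "(1 / real 2) *\<^sub>R (vec_of W - \<gamma> *\<^sub>R vec_of U - \<delta> *\<^sub>R vec_of V) \<in> int_lattice"
      then have "\<forall>k. int 2 dvd W k - g * U k - d * V k"
        unfolding gd vec_of_arith div_vec_of_int_lattice[OF zero_neq_numeral[symmetric]] .
      then have par: "even (W k - g * U k - d * V k)" for k by simp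
      show False
      proof (cases "even g")
        case g: True
        show False
        proof (cases "even d")
          case True
          then have "even (W k)" for k using par[of k] g by simp
          then show False using WU even_dot[of W U] by simp
        next
          case False
          then have "odd (W k) \<longleftrightarrow> odd (V k)" for k using par[of k] g by auto
          then show False using ij(4) Wodd by metis
        qed
      next
        case False
        \<comment> \<open>In the product with \<open>W\<close>, only the term
          \<open>g * dot W U\<close> would be odd.\<close>
        have "even (dot (\<lambda>k. W k - g * U k - d * V k) W)"
          using par by (intro even_dot) simp
        then have "even (4 - g * dot W U - d * dot W V)"
          by (simp add: dot_simps WW dot_commute[of U W] dot_commute[of V W])
        then show False using False WU WV by simp
      qed
    qed
  qed
  then show ?thesis by (simp add: vec_of_inner)
qed

text \<open>The 0/1 vector that vanishes at \<open>i\<close> and \<open>j\<close> has an even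
  product with \<open>V\<close>, and mod 2 it is neither \<open>V\<close> nor the complement of
  \<open>V\<close>. The latter is \<open>U + V\<close> when all entries of \<open>U\<close> are
  odd.\<close>

lemma obtain_balanced_pair:
  fixes Y :: "6 \<Rightarrow> bool"
  assumes "\<exists>k. Y k" "\<exists>k. \<not> Y k"
  obtains i j where "i \<noteq> j" "(Y i \<noteq> Y j) = odd (card {k. Y k})"
    "\<exists>k. (k \<noteq> i \<and> k \<noteq> j) \<noteq> Y k" "\<exists>k. (k \<noteq> i \<and> k \<noteq> j) = Y k"
proof (cases "odd (card {k. Y k})")
  case True
  obtain i j where "Y i" "\<not> Y j" using assms by blast
  then have "i \<noteq> j" "(Y i \<noteq> Y j) = odd (card {k. Y k})" using True by auto
  moreover have "\<exists>k. (k \<noteq> i \<and> k \<noteq> j) \<noteq> Y k" using \<open>Y i\<close> by (intro exI[of _ i]) simp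
  moreover have "\<exists>k. (k \<noteq> i \<and> k \<noteq> j) = Y k" using \<open>\<not> Y j\<close> by (intro exI[of _ j]) simp
  ultimately show ?thesis by (intro that[of i j])
next
  case False
  have tot: "card {k. Y k} + card {k. \<not> Y k} = 6"
    using card_split[of "\<lambda>k::6. True" Y] by simp
  have pos: "card {k. Y k} > 0" "card {k. \<not> Y k} > 0" using assms by (auto simp: card_gt_0_iff)
  have small: "card {k. P k} \<le> 2" if "\<And>k. P k \<Longrightarrow> k = i \<or> k = j" for P and i j :: 6
  proof -
    have "{k. P k} \<subseteq> {i, j}" using that by blast
    then have "card {k. P k} \<le> card {i, j}" by (intro card_mono) auto
    also have "\<dots> \<le> 2" by (simp add: card_insert_if)
    finally show ?thesis .
  qed
  show ?thesis
  proof (cases "card {k. Y k} \<ge> 3")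
    case True
    then have "2 \<le> card {k. Y k = True}" by simp
    then obtain i j where ij: "i \<noteq> j" "Y i = True" "Y j = True" 
      using obtain_pair_of_types[of True True Y] by auto
    have "\<exists>k. (k \<noteq> i \<and> k \<noteq> j) = Y k"
    proof (rule ccontr)
      assume "\<nexists>k. (k \<noteq> i \<and> k \<noteq> j) = Y k"
      then have "card {k. Y k} \<le> 2" by (intro small[of Y i j]) blast
      then show False using True by simp
    qed
    moreover have "\<exists>k. (k \<noteq> i \<and> k \<noteq> j) \<noteq> Y k" using ij(2) by (intro exI[of _ i]) simp
    moreover have "(Y i \<noteq> Y j) = odd (card {k. Y k})" using ij(2,3) False by simp
    ultimately show ?thesis using ij(1) by (intro that[of i j])
  next
    case small_Y: False
    have "card {k. Y k} \<noteq> 1" "card {k. Y k} \<noteq> 3" using False by auto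
    then have big: "card {k. \<not> Y k} \<ge> 3" using tot small_Y pos by linarith
    then have "2 \<le> card {k. Y k = False}" by simp
    then obtain i j where ij: "i \<noteq> j" "Y i = False" "Y j = False" 
      using obtain_pair_of_types[of False False Y] by auto
    have "\<exists>k. (k \<noteq> i \<and> k \<noteq> j) \<noteq> Y k"
    proof (rule ccontr)
      assume "\<nexists>k. (k \<noteq> i \<and> k \<noteq> j) \<noteq> Y k"
      then have "card {k. \<not> Y k} \<le> 2" by (intro small[of "\<lambda>k. \<not> Y k" i j]) blast
      then show False using big by simp
    qed
    moreover have "\<exists>k. (k \<noteq> i \<and> k \<noteq> j) = Y k" using ij(2) by (intro exI[of _ i]) simp
    moreover have "(Y i \<noteq> Y j) = odd (card {k. Y k})" using ij(2,3) False by simp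
    ultimately show ?thesis using ij(1) by (intro that[of i j])
  qed
qed

lemma vec_of_inj: "vec_of X = vec_of Y \<Longrightarrow> X k = Y k"
  by (simp add: vec_of_def vec_eq_iff)

lemma dot_single: "dot (\<lambda>i. if i = k then 1 else 0) X = X k"
  by (simp add: dot_def if_distrib[of "\<lambda>x. x * _"] cong: if_cong)

text \<open>
  A vector \<open>u\<close> all of whose coordinates are odd is characteristic, i.e. \<open>x \<bullet> u\<close> and
  \<open>x \<bullet> x\<close> always have the same parity. Passing to a 2-neighbour destroys this property.
\<close>

lemma neighbour_not_characteristic:
  assumes uv: "primitive_pair int_lattice (vec_of U) (vec_of V)" and Uodd: "\<And>k. odd (U k)"
  obtains U' V' where "primitive_pair int_lattice (vec_of U') (vec_of V')"
    "dot U' U' = dot U U" "dot U' V' = dot U V" "dot V' V' = dot V V"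
    "\<exists>k. even (U' k)" "\<exists>k. even (U' k + V' k)"
proof -
  have Veven: "\<exists>k. \<not> odd (V k)" using primitive_pair_odd_entries(3)[OF uv] Uodd by blast
  obtain i j where ij: "i \<noteq> j" "(odd (V i) \<noteq> odd (V j)) = odd (card {k. odd (V k)})"
    "\<exists>k. (k \<noteq> i \<and> k \<noteq> j) \<noteq> odd (V k)" "\<exists>k. (k \<noteq> i \<and> k \<noteq> j) = odd (V k)"
    by (rule obtain_balanced_pair[OF primitive_pair_odd_entries(2)[OF uv] Veven])
  define W0 where "W0 = complement_pair i j"
  have W0V: "even (dot W0 V)" 
    using odd_dot_complement_pair[OF ij(1), of V] ij(2) unfolding W0_def by blast
  have W0U: "even (dot W0 U)" 
    using odd_dot_complement_pair[OF ij(1), of U] Uodd unfolding W0_def by simp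
  have W0W0: "dot W0 W0 = 4" unfolding W0_def by (rule dot_complement_pair_self[OF ij(1)])
  have "UNIV \<noteq> {i, j}" using ij(1) card_2_iff[of "UNIV :: 6 set"] by auto
  then obtain m where m: "m \<noteq> i" "m \<noteq> j" by blast
  obtain W where Wodd: "\<And>k. odd (W k) \<longleftrightarrow> k \<noteq> i \<and> k \<noteq> j" and WW: "dot W W = 4"
    and WU: "4 dvd dot W U" and WV: "even (dot W V)"
  proof (cases "4 dvd dot W0 U")
    case True
    show ?thesis
    proof (rule that[of W0])
      show "odd (W0 k) \<longleftrightarrow> k \<noteq> i \<and> k \<noteq> j" for k by (simp add: W0_def complement_pair_def)
    qed (fact W0W0 True W0V)+
  next
    case False
    \<comment> \<open>Flipping one sign keeps the norm and all parities mod 2 and changes the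
      product with \<open>U\<close> by twice an odd number, which repairs divisibility by 4.\<close>
    define W where "W k = (if k = m then - W0 k else W0 k)" for k
    have W: "W = (\<lambda>k. W0 k - 2 * (if k = m then 1 else 0))"
      using m by (auto simp: W_def W0_def complement_pair_def)
    have dW: "dot W X = dot W0 X - 2 * X m" for X
      unfolding W by (simp only: dot_simps dot_single)
    show ?thesis
    proof (rule that[of W])
      show "odd (W k) \<longleftrightarrow> k \<noteq> i \<and> k \<noteq> j" for k by (auto simp: W_def W0_def complement_pair_def)
      have "dot W W = dot W0 W0" unfolding dot_def by (rule sum.cong) (auto simp: W_def)
      then show "dot W W = 4" using W0W0 by simp
      show "4 dvd dot W U" using False W0U Uodd[of m] unfolding dW by presburger
      show "even (dot W V)" using W0V unfolding dW by simp
    qed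
  qed
  define u v w N where "u = vec_of U" "v = vec_of V" "w = vec_of W" "N = neighbour int_lattice 2 w"
  note defs = this
  have uv': "primitive_pair int_lattice u v" using uv by (simp add: defs)
  note uvD = primitive_pairD[OF uv'] and grp = unimodular_subgroup[OF unimodular_int_lattice]
  have memN: "vec_of X \<in> N" if "even (dot X W)" for X
    using neighbourI_0[of "vec_of X" int_lattice w 2] that of_int_div_Ints[of 2 "dot X W"]
    by (simp add: defs vec_of_inner vec_of_int_lattice)
  have "odd (W m)" using Wodd m by blast
  then have "vec_of (\<lambda>i. if i = m then 1 else 0) \<bullet> w / real 2 \<notin> \<int>"
    using of_int_div_Ints[of 2 "W m"] by (simp add: defs vec_of_inner dot_single)
  then have N: "unimodular N" unfolding defs(4)
    by (intro unimodular_neighbour[OF unimodular_int_lattice two_is_prime_nat _ _ vec_of_int_lattice])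
      (simp_all add: defs vec_of_inner vec_of_int_lattice WW)
  have "even (dot U W)" using WU dot_commute[of U W] by (metis dvd_trans even_numeral)
  then have uN: "u \<in> N" using memN by (simp add: defs)
  have vN: "v \<in> N" using memN WV by (simp add: defs dot_commute[of V])
  have "\<alpha> \<in> \<int> \<and> \<beta> \<in> \<int>" if mem: "\<alpha> *\<^sub>R u + \<beta> *\<^sub>R v \<in> N" for \<alpha> \<beta>
  proof -
    obtain z k where z: "\<alpha> *\<^sub>R u + \<beta> *\<^sub>R v = z + (k / real 2) *\<^sub>R w" "z \<in> int_lattice" "k \<in> \<int>"
      using mem unfolding defs(4) neighbour_def by blast
    obtain k' where k': "k = of_int k'" using z(3) by (auto elim: Ints_cases)
    have "even k'"
    proof (rule ccontr)
      assume k'odd: "odd k'"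
      obtain Z where Z: "z = vec_of Z" using z(2) int_lattice_vec_of by blast
      have eq: "(2 * \<alpha>) *\<^sub>R u + (2 * \<beta>) *\<^sub>R v = of_int 2 *\<^sub>R z + of_int k' *\<^sub>R w"
        using arg_cong[OF z(1), of "\<lambda>x. 2 *\<^sub>R x"] k' by (simp add: algebra_simps)
      also have "\<dots> = vec_of (\<lambda>i. 2 * Z i + k' * W i)"
        unfolding Z defs(3) vec_of_arith ..
      finally have eq': "(2 * \<alpha>) *\<^sub>R u + (2 * \<beta>) *\<^sub>R v = vec_of (\<lambda>i. 2 * Z i + k' * W i)" .
      then have "2 * \<alpha> \<in> \<int>" "2 * \<beta> \<in> \<int>"
        using uvD(3,4)[of "2 * \<alpha>" "2 * \<beta>"] vec_of_int_lattice by simp_all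
      then obtain g d where gd: "2 * \<alpha> = of_int g" "2 * \<beta> = of_int d" by (meson Ints_cases)
      have "vec_of (\<lambda>i. g * U i + d * V i) = vec_of (\<lambda>i. 2 * Z i + k' * W i)"
        using eq' unfolding gd defs(1,2) vec_of_arith .
      then have "g * U l + d * V l = 2 * Z l + k' * W l" for l by (rule vec_of_inj)
      then have par: "odd (W l) \<longleftrightarrow> odd g \<noteq> (odd d \<and> odd (V l))" for l
        using k'odd Uodd[of l] by (metis even_add even_mult_iff even_numeral)
      show False
      proof (cases "odd g"; cases "odd d")
        assume "odd g" "odd d"
        then show False using par Wodd ij(4) by metis
      next
        assume "odd g" "\<not> odd d"
        then show False using par[of i] Wodd by simp
      next
        assume "\<not> odd g" "odd d"
        then show False using par Wodd ij(3) by metis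
      next
        assume "\<not> odd g" "\<not> odd d"
        then show False using par[of m] Wodd m by simp
      qed
    qed
    then obtain l where "k' = 2 * l" by (elim evenE)
    then have "\<alpha> *\<^sub>R u + \<beta> *\<^sub>R v = z + of_int l *\<^sub>R w" using z(1) k' by simp
    moreover have "z + of_int l *\<^sub>R w \<in> int_lattice"
      using grp z(2) vec_of_int_lattice[of W] unfolding defs(3)
      by (intro add_subgroup_add add_subgroup_scale_int)
    ultimately show ?thesis using uvD(3,4)[of \<alpha> \<beta>] by simp
  qed
  then have prim: "primitive_pair N u v" using uN vN by (simp add: primitive_pair_def)
  obtain T where T: "linear T" "\<And>x y. T x \<bullet> T y = x \<bullet> y" "T ` N = int_lattice"
    using unimodular_isometry[OF N] by metis
  have prim': "primitive_pair int_lattice (T u) (T v)"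
    using primitive_pair_isometry[OF T(1,2) prim] T(3) by simp
  have TN: "\<exists>X. T x = vec_of X" if "x \<in> N" for x
    using that T(3) int_lattice_vec_of[of "T x"] by blast
  obtain U' where U': "T u = vec_of U'" using TN uN by blast
  obtain V' where V': "T v = vec_of V'" using TN vN by blast
  have tr: "dot X' Y' = dot X Y" if "T (vec_of X) = vec_of X'" "T (vec_of Y) = vec_of Y'" for X X' Y Y'
    using T(2)[of "vec_of X" "vec_of Y"] unfolding that vec_of_inner by simp
  note U'' = U'[unfolded defs(1)] and V'' = V'[unfolded defs(2)]
  show ?thesis
  proof (rule that[of U' V'])
    show "primitive_pair int_lattice (vec_of U') (vec_of V')" using prim' U' V' by simp
    show "dot U' U' = dot U U" "dot U' V' = dot U V" "dot V' V' = dot V V"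
      by (rule tr[OF U'' U'']) (rule tr[OF U'' V''], rule tr[OF V'' V''])
    show "\<exists>k. even (U' k)"
    proof (rule ccontr)
      assume "\<nexists>k. even (U' k)"
      then have odd: "odd (U' k)" for k by blast
      \<comment> \<open>The new vector \<open>w / 2\<close> has norm 1 but an even product with
        \<open>u\<close>, so \<open>u\<close> is not characteristic in \<open>N\<close>.\<close>
      have "(1 / real 2) *\<^sub>R w \<in> N" unfolding defs(4) by (rule neighbourI_1[OF add_subgroup_0[OF grp]])
      then obtain E where E: "T ((1 / real 2) *\<^sub>R w) = vec_of E" using TN by blast
      have "real_of_int (dot E E) = ((1 / real 2) *\<^sub>R w) \<bullet> ((1 / real 2) *\<^sub>R w)"
        unfolding vec_of_inner[symmetric] E[symmetric] T(2) ..
      also have "\<dots> = 1" by (simp add: defs(3) vec_of_inner WW)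
      finally have EE: "dot E E = 1" by simp
      have "real_of_int (dot E U') = ((1 / real 2) *\<^sub>R w) \<bullet> u"
        unfolding vec_of_inner[symmetric] E[symmetric] U'[symmetric] T(2) ..
      also have "\<dots> = of_int (dot W U) / 2" by (simp add: defs(1,3) vec_of_inner)
      finally have "real_of_int (2 * dot E U') = of_int (dot W U)" by simp
      then have "2 * dot E U' = dot W U" by (simp only: of_int_eq_iff)
      then have "even (dot E U')" using WU by presburger
      then show False using even_dot_odd_vector[of U' E] odd EE by simp
    qed
    show "\<exists>k. even (U' k + V' k)"
    proof (rule ccontr)
      assume "\<nexists>k. even (U' k + V' k)"
      then have odd: "odd (U' k + V' k)" for k by blast
      \<comment> \<open>In Z^6 the vector \<open>U\<close> is characteristic, so
        \<open>dot Z U\<close> and \<open>dot Z Z\<close> have the same parity. A vector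
        \<open>Z\<close> that survives in \<open>N\<close> and has an odd product with
        \<open>V\<close> thus refutes that \<open>U + V\<close> is characteristic there.\<close>
      have "\<exists>Z. even (dot Z W) \<and> odd (dot Z V)"
      proof (cases "odd (V i) \<or> odd (V j)")
        case True
        then obtain l where "odd (V l)" "even (W l)" using Wodd by blast
        then show ?thesis by (intro exI[of _ "\<lambda>i. if i = l then 1 else 0"]) (simp add: dot_single)
      next
        case False
        obtain l where l: "odd (V l)" using primitive_pair_odd_entries(2)[OF uv] by blast
        then have "odd (W l)" using False Wodd by blast
        moreover obtain n where "odd (W n)" "even (V n)" using ij(3) False Wodd by blast
        ultimately show ?thesis using l
          by (intro exI[of _ "\<lambda>i. (if i = l then 1 else 0) + (if i = n then 1 else 0)"])
            (simp add: dot_simps dot_single)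
      qed
      then obtain Z where Z: "even (dot Z W)" "odd (dot Z V)" by blast
      obtain Z' where Z': "T (vec_of Z) = vec_of Z'" using TN[OF memN[OF Z(1)]] by blast
      have "even (dot Z' (\<lambda>k. U' k + V' k)) \<longleftrightarrow> even (dot Z' Z')"
        by (rule even_dot_odd_vector[OF odd])
      then have "even (dot Z U + dot Z V) \<longleftrightarrow> even (dot Z Z)"
        unfolding dot_simps tr[OF Z' U''] tr[OF Z' V''] tr[OF Z' Z'] .
      then show False using even_dot_odd_vector[of U Z] Uodd Z(2) by simp
    qed
  qed
qed

lemma prim_represented_mult_2:
  assumes abc: "prim_represented a b c"
  shows "prim_represented (4 * a) (2 * b) c"
proof -
  obtain u v where uv: "primitive_pair int_lattice u v" and g: "u \<bullet> u = a" "u \<bullet> v = b" "v \<bullet> v = c"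
    using prim_represented_int_lattice[OF abc] by blast
  obtain U where U: "u = vec_of U" using primitive_pairD(1)[OF uv] int_lattice_vec_of by blast
  obtain V where V: "v = vec_of V" using primitive_pairD(2)[OF uv] int_lattice_vec_of by blast
  have UV: "primitive_pair int_lattice (vec_of U) (vec_of V)" using uv U V by simp
  have g': "a = of_int (dot U U)" "b = of_int (dot U V)" "c = of_int (dot V V)"
    using g unfolding U V vec_of_inner by simp_all
  note shift = primitive_pair_shift[OF unimodular_subgroup[OF unimodular_int_lattice]]
  consider "\<exists>k. even (U k)" "\<exists>k. even (U k + V k)" | "\<forall>k. odd (U k)" | "\<forall>k. odd (U k + V k)" by blast
  then show ?thesis
  proof cases
    case 1
    then show ?thesis unfolding g' by (rule prim_represented_mult_2_aux[OF UV])
  next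
    case 2
    obtain U' V' where *: "primitive_pair int_lattice (vec_of U') (vec_of V')"
      "dot U' U' = dot U U" "dot U' V' = dot U V" "dot V' V' = dot V V"
      "\<exists>k. even (U' k)" "\<exists>k. even (U' k + V' k)"
      by (rule neighbour_not_characteristic[OF UV]) (use 2 in blast)
    show ?thesis using prim_represented_mult_2_aux[OF *(1,5,6)] unfolding *(2-4) g' .
  next
    case 3
    have UV': "primitive_pair int_lattice (vec_of (\<lambda>i. U i + V i)) (vec_of V)"
      using shift[OF UV, of 1] by (simp add: vec_of_arith)
    obtain S V' where *: "primitive_pair int_lattice (vec_of S) (vec_of V')"
      "dot S S = dot (\<lambda>i. U i + V i) (\<lambda>i. U i + V i)" "dot S V' = dot (\<lambda>i. U i + V i) V" 
      "dot V' V' = dot V V" "\<exists>k. even (S k)" "\<exists>k. even (S k + V' k)"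
      by (rule neighbour_not_characteristic[OF UV']) (use 3 in blast)
    \<comment> \<open>Returning from \<open>U + V\<close> to \<open>U\<close>: as
      \<open>S - V'\<close> and \<open>S + V'\<close> agree mod 2, the two parity conditions just
      interchange.\<close>
    have prim: "primitive_pair int_lattice (vec_of (\<lambda>i. S i - V' i)) (vec_of V')"
      using shift[OF *(1), of "-1"] by (simp add: vec_of_arith)
    have "dot (\<lambda>i. S i - V' i) V' = dot U V" 
      unfolding dot_simps *(3,4) by simp
    moreover have "dot (\<lambda>i. S i - V' i) (\<lambda>i. S i - V' i) = dot U U"
      using *(2-4) by (simp add: dot_simps dot_commute[of V' S] dot_commute[of V U])
    moreover have "prim_represented (4 * of_int (dot (\<lambda>i. S i - V' i) (\<lambda>i. S i - V' i)))
      (2 * of_int (dot (\<lambda>i. S i - V' i) V')) (of_int (dot V' V'))"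
      using *(5,6) by (intro prim_represented_mult_2_aux[OF prim]) auto
    ultimately show ?thesis by (simp add: g' *(4))
  qed
qed

lemma prim_represented_mult:
  assumes "prim_represented a b c" "prime p"
  shows "prim_represented ((real p)\<^sup>2 * a) (real p * b) c"
proof (cases "odd p")
  case True
  then show ?thesis using prim_represented_mult_odd assms by blast
next
  case False
  then have "p = 2" using assms(2) by (metis primes_dvd_imp_eq two_is_prime_nat)
  then show ?thesis using prim_represented_mult_2[OF assms(1)] by simp
qed

section \<open>Binary sublattices of the integer vectors\<close>

abbreviation gram_det :: "(6 \<Rightarrow> int) \<Rightarrow> (6 \<Rightarrow> int) \<Rightarrow> int" where
  "gram_det U V \<equiv> dot U U * dot V V - (dot U V)\<^sup>2"

abbreviation gram_represented :: "(6 \<Rightarrow> int) \<Rightarrow> (6 \<Rightarrow> int) \<Rightarrow> bool" where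
  "gram_represented U V \<equiv>
     prim_represented (of_int (dot U U)) (of_int (dot U V)) (of_int (dot V V))"

text \<open>The relation makes \<open>Z = (U + j' V) / p\<close> integral for some
  \<open>j'\<close>. The pair \<open>Z\<close>, \<open>V\<close> has a determinant smaller by the
  factor p^2; its primitive representation is carried back by \<open>prim_represented_mult\<close>
  and the shift by \<open>- j'\<close>.\<close>

lemma prim_represented_enlarge:
  fixes U V Y :: "6 \<Rightarrow> int"
  assumes p: "prime p" and Y: "\<And>k. i * U k + j * V k = int p * Y k" and i: "\<not> int p dvd i"
    and D: "gram_det U V > 0"
    and IH: "\<And>U' V'. gram_det U' V' > 0 \<Longrightarrow> gram_det U' V' < gram_det U V \<Longrightarrow>
      gram_represented U' V'"
  shows "gram_represented U V"
proof -
  have p1: "int p > 1" using p prime_gt_1_nat by simp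
  obtain t where "int p dvd - 1 + t * i" using linear_congruence[OF p i] by blast
  then obtain l where l: "- 1 + t * i = int p * l" by (elim dvdE)
  define j' where "j' = t * j"
  define Z where "Z k = t * Y k - l * U k" for k
  have Z: "int p * Z k = U k + j' * V k" for k
  proof -
    have "int p * Z k = t * (i * U k + j * V k) - (int p * l) * U k"
      unfolding Y by (simp add: Z_def algebra_simps)
    also have "\<dots> = U k + j' * V k" unfolding l[symmetric] by (simp add: j'_def algebra_simps)
    finally show ?thesis .
  qed
  have pZ: "(\<lambda>k. int p * Z k) = (\<lambda>k. U k + j' * V k)" using Z by auto
  have ZZ: "(int p)\<^sup>2 * dot Z Z = dot U U + 2 * j' * dot U V + j'\<^sup>2 * dot V V"
    using arg_cong2[OF pZ pZ, of dot] 
    by (simp add: dot_simps dot_commute[of V U] power2_eq_square algebra_simps)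
  have ZV: "int p * dot Z V = dot U V + j' * dot V V"
    using arg_cong[OF pZ, of "\<lambda>X. dot X V"] by (simp add: dot_simps)
  have "(int p)\<^sup>2 * gram_det Z V = ((int p)\<^sup>2 * dot Z Z) * dot V V - (int p * dot Z V)\<^sup>2"
    by (simp add: power2_eq_square algebra_simps)
  also have "\<dots> = gram_det U V" unfolding ZZ ZV by (simp add: power2_eq_square algebra_simps)
  finally have gd: "(int p)\<^sup>2 * gram_det Z V = gram_det U V" .
  have p2: "(int p)\<^sup>2 > 1" using p1 by (simp add: one_less_power)
  have pos: "gram_det Z V > 0" using gd D p2 by (metis less_trans zero_less_mult_pos zero_less_one)
  then have "1 * gram_det Z V < (int p)\<^sup>2 * gram_det Z V" using p2 by (intro mult_strict_right_mono)
  then have "gram_represented Z V"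
    using IH[OF pos] gd by simp
  from prim_represented_mult[OF this p]
  have "prim_represented (of_int ((int p)\<^sup>2 * dot Z Z)) (of_int (int p * dot Z V)) (of_int (dot V V))"
    by simp
  from prim_represented_shift[OF this, of "of_int (- j')"]
  show ?thesis unfolding ZZ ZV by (simp add: power2_eq_square algebra_simps)
qed

lemma prim_represented_int_vectors:
  assumes "gram_det U V > 0"
  shows "gram_represented U V"
  using assms
proof (induction "nat (gram_det U V)" arbitrary: U V rule: less_induct)
  case less
  have IH: "gram_represented U' V'"
    if "gram_det U' V' > 0" "gram_det U' V' < gram_det U V" for U' V'
    using less.hyps[of U' V'] that by simp
  define u v where "u = vec_of U" "v = vec_of V"
  note uv_def = this
  show ?case
  proof (cases "primitive_pair int_lattice u v")
    case True
    from prim_representedI[OF unimodular_int_lattice True] show ?thesis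
      by (simp add: uv_def vec_of_inner)
  next
    case False
    then obtain \<alpha> \<beta> where ab: "\<alpha> *\<^sub>R u + \<beta> *\<^sub>R v \<in> int_lattice" "\<not> (\<alpha> \<in> \<int> \<and> \<beta> \<in> \<int>)"
      unfolding primitive_pair_def by (auto simp: uv_def vec_of_int_lattice)
    obtain X where X: "\<alpha> *\<^sub>R u + \<beta> *\<^sub>R v = vec_of X" using ab(1) int_lattice_vec_of by blast
    have XU: "of_int (dot X U) = \<alpha> * of_int (dot U U) + \<beta> * of_int (dot U V)"
      and XV: "of_int (dot X V) = \<alpha> * of_int (dot U V) + \<beta> * of_int (dot V V)"
      unfolding vec_of_inner[symmetric] X[symmetric]
      by (simp_all add: uv_def inner_simps vec_of_inner dot_commute[of V U])
    \<comment> \<open>By Cramer's rule the Gram determinant is a common denominator of \<alpha> and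
      \<beta>.\<close>
    define D where "D = nat (gram_det U V)"
    have D: "real D = of_int (gram_det U V)" "D \<ge> 1" using less.prems by (simp_all add: D_def)
    have "real D * \<alpha> = of_int (dot X U * dot V V - dot X V * dot U V)"
      unfolding D(1) of_int_diff of_int_mult XU XV by (simp add: power2_eq_square algebra_simps)
    moreover have "real D * \<beta> = of_int (dot X V * dot U U - dot X U * dot U V)"
      unfolding D(1) of_int_diff of_int_mult XU XV by (simp add: power2_eq_square algebra_simps)
    ultimately have Dint: "D \<ge> 1 \<and> real D * \<alpha> \<in> \<int> \<and> real D * \<beta> \<in> \<int>"
      using D(2) Ints_of_int by metis
    \<comment> \<open>Minimality ensures that, for a prime p dividing \<open>n\<close>, the
      numerators \<open>i\<close> and \<open>j\<close> are not both divisible by p.\<close>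
    define n where "n = (LEAST n. n \<ge> 1 \<and> real n * \<alpha> \<in> \<int> \<and> real n * \<beta> \<in> \<int>)"
    have n: "n \<ge> 1" "real n * \<alpha> \<in> \<int>" "real n * \<beta> \<in> \<int>"
      using LeastI[of "\<lambda>n. n \<ge> 1 \<and> real n * \<alpha> \<in> \<int> \<and> real n * \<beta> \<in> \<int>", OF Dint]
      by (simp_all add: n_def)
    have "n \<noteq> 1" using n(2,3) ab(2) by auto
    then obtain p where p: "prime p" "p dvd n" using prime_factor_nat by blast
    then obtain m where m: "n = p * m" by (elim dvdE)
    have "m \<noteq> 0" using n(1) m by (intro notI) simp
    then have m1: "m \<ge> 1" "m < n" using m prime_gt_1_nat[OF p(1)] by simp_all
    have nm: "\<not> (real m * \<alpha> \<in> \<int> \<and> real m * \<beta> \<in> \<int>)"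
      using not_less_Least[OF m1(2)[unfolded n_def]] m1(1) by simp
    obtain i where i: "real n * \<alpha> = of_int i" using n(2) by (auto elim: Ints_cases)
    obtain j where j: "real n * \<beta> = of_int j" using n(3) by (auto elim: Ints_cases)
    have p0: "p \<noteq> 0" using p(1) by auto
    have "real m * \<alpha> = of_int i / real p" "real m * \<beta> = of_int j / real p"
      using i j p0 by (simp_all add: m field_simps)
    then have ndvd: "\<not> int p dvd i \<or> \<not> int p dvd j" using nm of_int_div_Ints[OF p0] by auto
    have "vec_of (\<lambda>k. i * U k + j * V k) = of_int i *\<^sub>R u + of_int j *\<^sub>R v"
      unfolding uv_def vec_of_arith ..
    also have "\<dots> = of_int (int n) *\<^sub>R (\<alpha> *\<^sub>R u + \<beta> *\<^sub>R v)"
      unfolding i[symmetric] j[symmetric] by (simp add: algebra_simps)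
    also have "\<dots> = vec_of (\<lambda>k. int n * X k)" unfolding X vec_of_arith ..
    finally have Y: "i * U k + j * V k = int p * (int m * X k)" for k
      using vec_of_inj[of "\<lambda>k. i * U k + j * V k" "\<lambda>k. int n * X k" k] by (simp add: m)
    from ndvd show ?thesis
    proof
      assume "\<not> int p dvd i"
      then show ?thesis by (rule prim_represented_enlarge[OF p(1) Y _ less.prems IH])
    next
      assume nj: "\<not> int p dvd j"
      have Y': "j * V k + i * U k = int p * (int m * X k)" for k using Y[of k] by simp
      have sym: "gram_det V U = gram_det U V" by (simp add: dot_commute[of V U] mult.commute)
      have "gram_represented V U"
        by (rule prim_represented_enlarge[OF p(1) Y' nj less.prems[folded sym] IH[folded sym]])
      then show ?thesis using prim_represented_swap by (simp add: dot_commute[of V U])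
    qed
  qed
qed

lemma prim_represented_div_square:
  assumes "prim_represented ((real n)\<^sup>2 * a) (real n * b) c" "n > 0" "a \<in> \<int>" "b \<in> \<int>"
  shows "prim_represented a b c"
  using assms(1,2)
proof (induction n rule: less_induct)
  case (less n)
  show ?case
  proof (cases "n = 1")
    case True
    then show ?thesis using less.prems by simp
  next
    case False
    then obtain p where p: "prime p" "p dvd n" using prime_factor_nat by blast
    then obtain m where m: "n = p * m" by (elim dvdE)
    have "m \<noteq> 0" using less.prems(2) m by (intro notI) simp
    then have m1: "m > 0" "m < n" using m prime_gt_1_nat[OF p(1)] by simp_all
    have rep: "prim_represented ((real p)\<^sup>2 * ((real m)\<^sup>2 * a)) (real p * (real m * b)) c"
      using less.prems(1) by (simp add: m power_mult_distrib mult.assoc)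
    have "prim_represented ((real m)\<^sup>2 * a) (real m * b) c"
      by (rule prim_represented_div[OF rep p(1)]) (use assms(3,4) in auto)
    then show ?thesis by (rule less.IH[OF m1(2) _ m1(1)])
  qed
qed

section \<open>Isotropic ternary hermitian forms over the Gaussian integers\<close>

text \<open>For odd p, Chevalley-Warning applies to x1^2 + x2^2 - A x3^2. If the zero found has x3 =
  0 mod p, then -1 is a square s^2 mod p, and A is the sum of the squares of (A+1)/2 and s
  (A-1)/2.\<close>

lemma two_squares_mod_prime:
  assumes p: "prime p"
  shows "\<exists>x y. int p dvd x\<^sup>2 + y\<^sup>2 - A"
proof (cases "p = 2")
  case True
  have "even (A\<^sup>2 + 0\<^sup>2 - A)" by simp
  then show ?thesis using True by (intro exI[of _ A] exI[of _ 0]) simp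
next
  case False
  have pp: "prime (int p)" using p by simp
  have p2: "\<not> int p dvd 2"
    using False p by (metis int_dvd_int_iff of_nat_numeral primes_dvd_imp_eq two_is_prime_nat)
  let ?f = "\<lambda>x :: 3 \<Rightarrow> int. x 1 * x 1 + (x 2 * x 2 + (- A) * (x 3 * x 3))"
  have v: "poly_fun 1 (\<lambda>x. x i)" for i :: 3 using poly_fun.var[of 0 i] by simp
  have vv: "poly_fun 2 (\<lambda>x. x i * x i)" for i :: 3
    using poly_fun.mult[OF v v, of i i] by (simp add: numeral_2_eq_2)
  have "poly_fun 2 ?f"
    using poly_fun.mult[OF poly_fun.const[of 0 "- A"] vv[of 3]]
    by (intro poly_fun.add vv) (simp add: numeral_2_eq_2)
  then have "\<forall>(d, f)\<in>set [(2 :: nat, ?f)]. poly_fun d f \<and> f (\<lambda>_. 0) = 0" by simp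
  from chevalley_warning[OF p this] obtain x where
    x: "\<exists>i. \<not> int p dvd x i" "int p dvd ?f x" by auto
  have dx: "int p dvd (x 1)\<^sup>2 + (x 2)\<^sup>2 - A * (x 3)\<^sup>2" using x(2) by (simp add: power2_eq_square add_diff_eq)
  show ?thesis
  proof (cases "int p dvd x 3")
    case False
    obtain t where t: "int p dvd - 1 + t * x 3" using linear_congruence[OF p False] by blast
    have "(t * x 1)\<^sup>2 + (t * x 2)\<^sup>2 - A = t\<^sup>2 * ((x 1)\<^sup>2 + (x 2)\<^sup>2 - A * (x 3)\<^sup>2)
        + A * ((- 1 + t * x 3) * (1 + t * x 3))"
      by (simp add: power2_eq_square algebra_simps)
    moreover have "int p dvd \<dots>" by (rule dvd_add[OF dvd_mult[OF dx] dvd_mult[OF dvd_mult2[OF t]]])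
    ultimately show ?thesis by metis
  next
    case True
    then have "int p dvd A * (x 3)\<^sup>2" by (simp add: power2_eq_square)
    then have d2: "int p dvd (x 1)\<^sup>2 + (x 2)\<^sup>2" using dx by (metis diff_add_cancel dvd_add)
    have "\<not> int p dvd x 1"
    proof
      assume x1: "int p dvd x 1"
      then have "int p dvd (x 1)\<^sup>2" by (simp add: power2_eq_square)
      then have "int p dvd (x 2)\<^sup>2" using d2 dvd_add_right_iff by blast
      then have "int p dvd x 2" using pp prime_dvd_power by blast
      then show False using x(1) x1 True by (metis exhaust_3)
    qed
    then obtain t where t: "int p dvd - 1 + t * x 1" using linear_congruence[OF p] by blast
    define s where "s = t * x 2"
    have "s\<^sup>2 + 1 = t\<^sup>2 * ((x 1)\<^sup>2 + (x 2)\<^sup>2) - (- 1 + t * x 1) * (1 + t * x 1)"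
      by (simp add: s_def power2_eq_square algebra_simps)
    moreover have "int p dvd \<dots>" by (rule dvd_diff[OF dvd_mult[OF d2] dvd_mult2[OF t]])
    ultimately have s: "int p dvd s\<^sup>2 + 1" by simp
    obtain h where h: "int p dvd - 1 + h * 2" using linear_congruence[OF p p2] by blast
    have "((A + 1) * h)\<^sup>2 + (s * ((A - 1) * h))\<^sup>2 - A
        = (s\<^sup>2 + 1) * ((A - 1) * h)\<^sup>2 + A * ((- 1 + h * 2) * (1 + h * 2))"
      by (simp add: power2_eq_square algebra_simps)
    moreover have "int p dvd \<dots>" by (rule dvd_add[OF dvd_mult2[OF s] dvd_mult[OF dvd_mult2[OF h]]])
    ultimately show ?thesis by metis
  qed
qed

lemma two_squares_mod_squarefree:
  assumes "n > 0" "\<And>q. q > 1 \<Longrightarrow> \<not> q\<^sup>2 dvd n"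
  shows "\<exists>x y. int n dvd x\<^sup>2 + y\<^sup>2 - A"
  using assms
proof (induction n rule: less_induct)
  case (less n)
  show ?case
  proof (cases "n = 1")
    case False
    then obtain p where p: "prime p" "p dvd n" using prime_factor_nat by blast
    then obtain m where m: "n = p * m" by (elim dvdE)
    have "m \<noteq> 0" using less.prems(1) m by (intro notI) simp
    then have m1: "m > 0" "m < n" using m prime_gt_1_nat[OF p(1)] by simp_all
    have "\<not> p\<^sup>2 dvd n" using less.prems(2) prime_gt_1_nat[OF p(1)] by blast
    then have "\<not> p dvd m" unfolding m power2_eq_square by (auto intro: mult_dvd_mono)
    then have "coprime p m" using p(1) by (intro prime_imp_coprime)
    then have cop: "coprime (int p) (int m)" by simp
    have "\<not> q\<^sup>2 dvd m" if "q > 1" for q using less.prems(2)[OF that] m by (metis dvd_mult)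
    then obtain x1 y1 where 1: "int m dvd x1\<^sup>2 + y1\<^sup>2 - A" using less.IH[OF m1(2,1)] by blast
    obtain x2 y2 where 2: "int p dvd x2\<^sup>2 + y2\<^sup>2 - A" using two_squares_mod_prime[OF p(1)] by blast
    obtain x where x: "[x = x2] (mod int p)" "[x = x1] (mod int m)"
      using binary_chinese_remainder_int[OF cop] by blast
    obtain y where y: "[y = y2] (mod int p)" "[y = y1] (mod int m)"
      using binary_chinese_remainder_int[OF cop] by blast
    have "[x\<^sup>2 + y\<^sup>2 - A = x2\<^sup>2 + y2\<^sup>2 - A] (mod int p)"
      using x y by (intro cong_diff cong_add cong_pow) simp_all
    then have "int p dvd x\<^sup>2 + y\<^sup>2 - A" using 2 cong_dvd_iff by blast
    moreover have "[x\<^sup>2 + y\<^sup>2 - A = x1\<^sup>2 + y1\<^sup>2 - A] (mod int m)"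
      using x y by (intro cong_diff cong_add cong_pow) simp_all
    then have "int m dvd x\<^sup>2 + y\<^sup>2 - A" using 1 cong_dvd_iff by blast
    ultimately have "int n dvd x\<^sup>2 + y\<^sup>2 - A" unfolding m using cop by (simp add: divides_mult)
    then show ?thesis by blast
  qed simp
qed

lemma small_residue:
  assumes "(n::int) > 0"
  obtains x' where "n dvd x - x'" "2 * \<bar>x'\<bar> \<le> n"
proof -
  define x' where "x' = (x + n div 2) mod n - n div 2"
  have "x - x' = (x + n div 2) - (x + n div 2) mod n" by (simp add: x'_def)
  then have "n dvd x - x'" by (metis dvd_minus_mod)
  moreover have "0 \<le> x' + n div 2" "x' + n div 2 < n" using assms by (simp_all add: x'_def)
  then have "2 * \<bar>x'\<bar> \<le> n" by presburger
  ultimately show ?thesis using that by blast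
qed

lemma abs_add_diff_bound:
  fixes X Y Q A m :: int
  assumes "4 * X \<le> Q" "4 * Y \<le> Q" "0 \<le> X" "0 \<le> Y" "\<bar>A\<bar> \<le> m"
  shows "2 * \<bar>X + Y - A\<bar> \<le> Q + 2 * m"
proof -
  have A: "A \<le> m" "- A \<le> m" "0 \<le> Q" using assms by linarith+
  have "2 * X + 2 * Y \<le> Q" using assms(1,2) by linarith
  then have "2 * (X + Y - A) \<le> Q + 2 * m" using A(2) by (simp add: algebra_simps)
  moreover have "2 * A \<le> Q + 2 * m + 2 * X + 2 * Y" using A assms(3,4) by linarith
  then have "- 2 * (X + Y - A) \<le> Q + 2 * m" by (simp add: algebra_simps)
  ultimately show ?thesis by (cases "X + Y - A \<ge> 0") simp_all
qed

text \<open>Isotropy of the ternary form \<open>z * cnj z - A * y * cnj y - B * w * cnj w\<close>,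
  written in real and imaginary parts.\<close>

definition hermitian_isotropic :: "int \<Rightarrow> int \<Rightarrow> bool" where
  "hermitian_isotropic A B \<longleftrightarrow> (\<exists>x1 x2 y1 y2 w1 w2.
     (x1 \<noteq> 0 \<or> x2 \<noteq> 0 \<or> y1 \<noteq> 0 \<or> y2 \<noteq> 0 \<or> w1 \<noteq> 0 \<or> w2 \<noteq> 0) \<and>
     x1\<^sup>2 + x2\<^sup>2 = A * (y1\<^sup>2 + y2\<^sup>2) + B * (w1\<^sup>2 + w2\<^sup>2))"

lemma hermitian_isotropicI:
  "x1\<^sup>2 + x2\<^sup>2 = A * (y1\<^sup>2 + y2\<^sup>2) + B * (w1\<^sup>2 + w2\<^sup>2) \<Longrightarrow>
   x1 \<noteq> 0 \<or> x2 \<noteq> 0 \<or> y1 \<noteq> 0 \<or> y2 \<noteq> 0 \<or> w1 \<noteq> 0 \<or> w2 \<noteq> 0 \<Longrightarrow> hermitian_isotropic A B"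
  unfolding hermitian_isotropic_def by blast

lemma hermitian_isotropic_swap:
  assumes "hermitian_isotropic A B"
  shows "hermitian_isotropic B A"
proof -
  obtain x1 x2 y1 y2 w1 w2 where
    "x1 \<noteq> 0 \<or> x2 \<noteq> 0 \<or> y1 \<noteq> 0 \<or> y2 \<noteq> 0 \<or> w1 \<noteq> 0 \<or> w2 \<noteq> 0"
    "x1\<^sup>2 + x2\<^sup>2 = A * (y1\<^sup>2 + y2\<^sup>2) + B * (w1\<^sup>2 + w2\<^sup>2)"
    using assms unfolding hermitian_isotropic_def by blast
  then show ?thesis by (intro hermitian_isotropicI[of x1 x2 B w1 w2 A y1 y2]) auto
qed

text \<open>
  The norms \<open>z * cnj z - A * w * cnj w\<close> of a quaternion algebra over the rationals, with \<open>z\<close>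
  and \<open>w\<close> Gaussian integers, are multiplicative.
\<close>

lemma quaternion_norm_mult:
  fixes x y x1 x2 y1 y2 A :: int
  shows "(x * x1 - y * x2 + A * y1)\<^sup>2 + (x * x2 + y * x1 - A * y2)\<^sup>2
      - A * ((x * y1 - y * y2 + x1)\<^sup>2 + (x * y2 + y * y1 - x2)\<^sup>2)
    = (x\<^sup>2 + y\<^sup>2 - A) * (x1\<^sup>2 + x2\<^sup>2 - A * (y1\<^sup>2 + y2\<^sup>2))"
  by (simp add: power2_eq_square algebra_simps)

text \<open>Both \<open>B * B'\<close> and \<open>B' * (w1\<^sup>2 + w2\<^sup>2)\<close> are
  quaternion norms. Their product is again one, and it is \<open>B\<close> times the Gaussian norm
  of \<open>B' w\<close>.\<close>

lemma hermitian_isotropic_descent: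
  assumes eq: "x\<^sup>2 + y\<^sup>2 - A = B * B'" and "B' \<noteq> 0" and B': "hermitian_isotropic A B'"
  shows "hermitian_isotropic A B"
proof -
  obtain x1 x2 y1 y2 w1 w2 where nz: "x1 \<noteq> 0 \<or> x2 \<noteq> 0 \<or> y1 \<noteq> 0 \<or> y2 \<noteq> 0 \<or> w1 \<noteq> 0 \<or> w2 \<noteq> 0"
    and *: "x1\<^sup>2 + x2\<^sup>2 = A * (y1\<^sup>2 + y2\<^sup>2) + B' * (w1\<^sup>2 + w2\<^sup>2)"
    using B' unfolding hermitian_isotropic_def by blast
  show ?thesis
  proof (cases "w1 = 0 \<and> w2 = 0")
    case True
    then show ?thesis using nz * by (intro hermitian_isotropicI[of x1 x2 A y1 y2 B 0 0]) auto
  next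
    case False
    have **: "x1\<^sup>2 + x2\<^sup>2 - A * (y1\<^sup>2 + y2\<^sup>2) = B' * (w1\<^sup>2 + w2\<^sup>2)" using * by simp
    show ?thesis
    proof (rule hermitian_isotropicI)
      show "(x * x1 - y * x2 + A * y1)\<^sup>2 + (x * x2 + y * x1 - A * y2)\<^sup>2
        = A * ((x * y1 - y * y2 + x1)\<^sup>2 + (x * y2 + y * y1 - x2)\<^sup>2) + B * ((B' * w1)\<^sup>2 + (B' * w2)\<^sup>2)"
        using quaternion_norm_mult[of x x1 y x2 A y1 y2] unfolding eq **
        by (simp add: power2_eq_square algebra_simps)
    qed (use False \<open>B' \<noteq> 0\<close> in auto)
  qed
qed

text \<open>Legendre's descent on the coefficient of larger absolute value. \<open>A\<close> is a
  sum of two squares modulo every squarefree number, so no congruence condition arises; only the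
  sign condition remains, and \<open>B'\<close> inherits it.\<close>

theorem hermitian_isotropic:
  assumes "A \<noteq> 0" "B \<noteq> 0" "A > 0 \<or> B > 0"
  shows "hermitian_isotropic A B"
  using assms
proof (induction "nat (\<bar>A\<bar> + \<bar>B\<bar>)" arbitrary: A B rule: less_induct)
  case less
  have main: "hermitian_isotropic A B"
    if A: "A \<noteq> 0" and B: "B \<noteq> 0" and pos: "A > 0 \<or> B > 0" and le: "\<bar>A\<bar> \<le> \<bar>B\<bar>"
      and IH: "\<And>B'. B' \<noteq> 0 \<Longrightarrow> A > 0 \<or> B' > 0 \<Longrightarrow> \<bar>B'\<bar> < \<bar>B\<bar> \<Longrightarrow> hermitian_isotropic A B'"
    for A B
  proof (cases "\<exists>q::nat. q > 1 \<and> q\<^sup>2 dvd nat \<bar>B\<bar>")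
    case True
    then obtain q :: nat where q: "q > 1" "q\<^sup>2 dvd nat \<bar>B\<bar>" by blast
    then have "int (q\<^sup>2) dvd B" by (simp add: int_dvd_int_iff[symmetric] del: of_nat_power)
    then obtain B1 where B1: "B = (int q)\<^sup>2 * B1" by (auto elim: dvdE)
    have q2: "(int q)\<^sup>2 > 1" using q(1) by (simp add: one_less_power)
    have B10: "B1 \<noteq> 0" using B B1 by auto
    have "\<bar>B\<bar> = (int q)\<^sup>2 * \<bar>B1\<bar>" by (simp add: B1 abs_mult)
    then have lt: "\<bar>B1\<bar> < \<bar>B\<bar>" using q2 B10 by simp
    have "A > 0 \<or> B1 > 0" using pos q2 by (auto simp: B1 zero_less_mult_iff)
    then obtain x1 x2 y1 y2 w1 w2 where 
      nz: "x1 \<noteq> 0 \<or> x2 \<noteq> 0 \<or> y1 \<noteq> 0 \<or> y2 \<noteq> 0 \<or> w1 \<noteq> 0 \<or> w2 \<noteq> 0"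
      and *: "x1\<^sup>2 + x2\<^sup>2 = A * (y1\<^sup>2 + y2\<^sup>2) + B1 * (w1\<^sup>2 + w2\<^sup>2)"
      using IH[OF B10 _ lt] unfolding hermitian_isotropic_def by blast
    show ?thesis
    proof (rule hermitian_isotropicI)
      have "(int q * x1)\<^sup>2 + (int q * x2)\<^sup>2 = (int q)\<^sup>2 * (x1\<^sup>2 + x2\<^sup>2)"
        by (simp add: power2_eq_square algebra_simps)
      also have "\<dots> = A * ((int q * y1)\<^sup>2 + (int q * y2)\<^sup>2) + B * (w1\<^sup>2 + w2\<^sup>2)"
        unfolding * B1 by (simp add: power2_eq_square algebra_simps)
      finally show "(int q * x1)\<^sup>2 + (int q * x2)\<^sup>2
        = A * ((int q * y1)\<^sup>2 + (int q * y2)\<^sup>2) + B * (w1\<^sup>2 + w2\<^sup>2)" .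
    qed (use nz q in auto)
  next
    case False
    define n where "n = nat \<bar>B\<bar>"
    have n: "n > 0" "int n = \<bar>B\<bar>" using B by (simp_all add: n_def)
    consider "A = - B" | "A = 1" | "B = 1" | "A \<noteq> - B" "n \<ge> 2"
      using n A B pos le by linarith
    then show ?thesis
    proof cases
      case 1
      then show ?thesis by (intro hermitian_isotropicI[of 0 0 A 1 0 B 1 0]) auto
    next
      case 2
      then show ?thesis by (intro hermitian_isotropicI[of 1 0 A 1 0 B 0 0]) auto
    next
      case 3
      then show ?thesis by (intro hermitian_isotropicI[of 1 0 A 0 0 B 1 0]) auto
    next
      case 4
      obtain x0 y0 where xy0: "int n dvd x0\<^sup>2 + y0\<^sup>2 - A"
        using two_squares_mod_squarefree[OF n(1), of A] False unfolding n_def by blast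
      obtain x where x: "int n dvd x0 - x" "2 * \<bar>x\<bar> \<le> int n" using small_residue[of "int n" x0] n(1) by auto
      obtain y where y: "int n dvd y0 - y" "2 * \<bar>y\<bar> \<le> int n" using small_residue[of "int n" y0] n(1) by auto
      have "x\<^sup>2 + y\<^sup>2 - A = (x0\<^sup>2 + y0\<^sup>2 - A) - (x0 - x) * (x0 + x) - (y0 - y) * (y0 + y)"
        by (simp add: power2_eq_square algebra_simps)
      moreover have "int n dvd \<dots>" by (rule dvd_diff[OF dvd_diff[OF xy0 dvd_mult2[OF x(1)]] dvd_mult2[OF y(1)]])
      ultimately have "int n dvd x\<^sup>2 + y\<^sup>2 - A" by (simp only:)
      then have "B dvd x\<^sup>2 + y\<^sup>2 - A" unfolding n(2) by simp
      then obtain B' where B': "x\<^sup>2 + y\<^sup>2 - A = B * B'" by (elim dvdE)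
      show ?thesis
      proof (cases "B' = 0")
        case True
        then show ?thesis using B' by (intro hermitian_isotropicI[of x y A 1 0 B 0 0]) auto
      next
        case B'0: False
        have sq: "4 * x\<^sup>2 \<le> (int n)\<^sup>2" "4 * y\<^sup>2 \<le> (int n)\<^sup>2"
          using power_mono[OF x(2), of 2] power_mono[OF y(2), of 2] by (simp_all add: power_mult_distrib)
        \<comment> \<open>The general estimate yields 2 |B'| \<le> n + 2, a descent for n \<ge> 3
          only. For n = 2, the excluded case A = - B gives A \<ge> -1.\<close>
        have "\<bar>B'\<bar> < \<bar>B\<bar>"
        proof (cases "n = 2")
          case True
          have "\<bar>x\<bar> \<le> 1" "\<bar>y\<bar> \<le> 1" using x(2) y(2) True by simp_all
          then have "x\<^sup>2 + y\<^sup>2 \<le> 2" using abs_le_square_iff[of x 1] abs_le_square_iff[of y 1] by simp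
          moreover have "x\<^sup>2 + y\<^sup>2 \<ge> 0" by simp
          moreover have AB: "\<bar>A\<bar> \<le> 2" "\<bar>B\<bar> = 2" using le n(2) True by simp_all
          moreover have "A \<ge> - 1" using AB 4(1) pos by arith
          ultimately have "\<bar>x\<^sup>2 + y\<^sup>2 - A\<bar> < 4" by linarith
          then have "\<bar>B\<bar> * \<bar>B'\<bar> < 4" unfolding B' abs_mult .
          then show ?thesis using AB(2) by simp
        next
          case False
          then have n3: "int n \<ge> 3" using 4(2) by simp
          have "2 * \<bar>x\<^sup>2 + y\<^sup>2 - A\<bar> \<le> (int n)\<^sup>2 + 2 * int n"
            using abs_add_diff_bound[OF sq _ _ le[folded n(2)]] by simp
          then have "2 * (int n * \<bar>B'\<bar>) \<le> (int n)\<^sup>2 + 2 * int n" unfolding B' abs_mult n(2) .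
          then have "int n * (2 * \<bar>B'\<bar>) \<le> int n * (int n + 2)"
            by (simp add: power2_eq_square algebra_simps)
          then have "2 * \<bar>B'\<bar> \<le> int n + 2" using n(1) by simp
          then show ?thesis using n3 n(2) by linarith
        qed
        moreover have "A > 0 \<or> B' > 0"
        proof (rule ccontr)
          assume "\<not> (A > 0 \<or> B' > 0)"
          then have "A < 0" "B > 0" "B' < 0" using A pos B'0 by auto
          then have "B * B' < 0" by (simp add: mult_pos_neg)
          moreover have "x\<^sup>2 + y\<^sup>2 - A > 0" using \<open>A < 0\<close> zero_le_power2[of x] zero_le_power2[of y] by linarith
          ultimately show False using B' by simp
        qed
        ultimately show ?thesis using hermitian_isotropic_descent[OF B' B'0] IH[OF B'0] by blast
      qed
    qed
  qed
  show ?case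
  proof (cases "\<bar>A\<bar> \<le> \<bar>B\<bar>")
    case True
    show ?thesis
      by (rule main) (use less True in auto)
  next
    case False
    have "hermitian_isotropic B A"
    proof (rule main)
      fix B' assume B': "B' \<noteq> 0" "B > 0 \<or> B' > 0" "\<bar>B'\<bar> < \<bar>A\<bar>"
      then have "hermitian_isotropic B' B" using less.prems by (intro less.hyps) auto
      then show "hermitian_isotropic B B'" by (rule hermitian_isotropic_swap)
    qed (use less.prems False in auto)
    then show ?thesis by (rule hermitian_isotropic_swap)
  qed
qed

section \<open>Every binary form is primitively represented\<close>

lemma UNIV_6: "UNIV = {1, 2, 3, 4, 5, 6 :: 6}"
proof -
  have "x \<in> {1, 2, 3, 4, 5, 6}" for x :: 6
  proof (induct x)
    case (of_int z)
    then have "z = 0 \<or> z = 1 \<or> z = 2 \<or> z = 3 \<or> z = 4 \<or> z = 5" by fastforce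
    then show ?case by auto
  qed
  then show ?thesis by blast
qed

lemma sum_6: "sum f (UNIV :: 6 set) = f 1 + f 2 + f 3 + f 4 + f 5 + f 6"
  unfolding UNIV_6 by (simp add: ac_simps)

definition vec6 :: "int \<Rightarrow> int \<Rightarrow> int \<Rightarrow> int \<Rightarrow> int \<Rightarrow> int \<Rightarrow> 6 \<Rightarrow> int" where
  "vec6 x1 x2 x3 x4 x5 x6 i = (if i = 1 then x1 else if i = 2 then x2 else if i = 3 then x3
     else if i = 4 then x4 else if i = 5 then x5 else x6)"

lemma dot_vec6:
  "dot (vec6 x1 x2 x3 x4 x5 x6) (vec6 y1 y2 y3 y4 y5 y6)
    = x1 * y1 + x2 * y2 + x3 * y3 + x4 * y4 + x5 * y5 + x6 * y6"
  by (simp add: dot_def sum_6 vec6_def)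

text \<open>\<open>V\<close> has to be \<open>(b / a) U\<close> plus a vector orthogonal to
  \<open>U\<close> of norm N^2 d / a, where d is the determinant. One isotropic hermitian form
  provides \<open>U\<close> in four coordinates, the other provides the orthogonal part.\<close>

lemma rational_embedding:
  fixes a b c :: int
  assumes "a > 0" "a * c - b\<^sup>2 > 0"
  obtains N :: nat and U V :: "6 \<Rightarrow> int" where "N > 0" "dot U U = (int N)\<^sup>2 * a"
    "dot U V = (int N)\<^sup>2 * b" "dot V V = (int N)\<^sup>2 * c"
proof -
  define d where "d = a * c - b\<^sup>2"
  have d: "d > 0" using assms by (simp add: d_def)
  have "hermitian_isotropic (- 1) a" using assms by (intro hermitian_isotropic) auto
  then obtain x1 x2 y1 y2 w1 w2 where 1: "x1\<^sup>2 + x2\<^sup>2 = - 1 * (y1\<^sup>2 + y2\<^sup>2) + a * (w1\<^sup>2 + w2\<^sup>2)"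
    and nz1: "x1 \<noteq> 0 \<or> x2 \<noteq> 0 \<or> y1 \<noteq> 0 \<or> y2 \<noteq> 0 \<or> w1 \<noteq> 0 \<or> w2 \<noteq> 0"
    unfolding hermitian_isotropic_def by blast
  define m where "m = w1\<^sup>2 + w2\<^sup>2"
  have eq1: "x1\<^sup>2 + x2\<^sup>2 + y1\<^sup>2 + y2\<^sup>2 = a * m" using 1 by (simp add: m_def)
  have "m \<noteq> 0"
  proof
    assume m0: "m = 0"
    then have "w1 = 0" "w2 = 0" by (auto simp: m_def sum_power2_eq_zero_iff)
    moreover have "x1\<^sup>2 + x2\<^sup>2 + y1\<^sup>2 + y2\<^sup>2 = 0" using eq1 m0 by simp
    then have "x1\<^sup>2 + x2\<^sup>2 = 0" "y1\<^sup>2 + y2\<^sup>2 = 0"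
      using zero_le_power2[of x1] zero_le_power2[of x2] zero_le_power2[of y1] zero_le_power2[of y2]
      by linarith+
    ultimately show False using nz1 by (simp add: sum_power2_eq_zero_iff)
  qed
  moreover have "m \<ge> 0" by (simp add: m_def)
  ultimately have m: "m > 0" by simp
  have "hermitian_isotropic (- a) (a * d)" using assms(1) d by (intro hermitian_isotropic) auto
  then obtain p1 p2 q1 q2 r1 r2 where 2: "p1\<^sup>2 + p2\<^sup>2 = - a * (q1\<^sup>2 + q2\<^sup>2) + a * d * (r1\<^sup>2 + r2\<^sup>2)"
    and nz2: "p1 \<noteq> 0 \<or> p2 \<noteq> 0 \<or> q1 \<noteq> 0 \<or> q2 \<noteq> 0 \<or> r1 \<noteq> 0 \<or> r2 \<noteq> 0"
    unfolding hermitian_isotropic_def by blast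
  define r where "r = r1\<^sup>2 + r2\<^sup>2"
  have eq2: "p1\<^sup>2 + p2\<^sup>2 + a * (q1\<^sup>2 + q2\<^sup>2) = a * d * r" using 2 by (simp add: r_def)
  have "r \<noteq> 0"
  proof
    assume r0: "r = 0"
    then have "r1 = 0" "r2 = 0" by (auto simp: r_def sum_power2_eq_zero_iff)
    moreover have "p1\<^sup>2 + p2\<^sup>2 = 0" "a * (q1\<^sup>2 + q2\<^sup>2) = 0"
    proof -
      have "p1\<^sup>2 + p2\<^sup>2 + a * (q1\<^sup>2 + q2\<^sup>2) = 0" using eq2 r0 by simp
      moreover have "a * (q1\<^sup>2 + q2\<^sup>2) \<ge> 0" "p1\<^sup>2 + p2\<^sup>2 \<ge> 0" using assms(1) by simp_all
      ultimately show "p1\<^sup>2 + p2\<^sup>2 = 0" "a * (q1\<^sup>2 + q2\<^sup>2) = 0"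
        by (simp_all add: add_nonneg_eq_0_iff)
    qed
    ultimately show False using nz2 assms(1) by (simp add: sum_power2_eq_zero_iff)
  qed
  moreover have "r \<ge> 0" by (simp add: r_def)
  ultimately have r: "r > 0" by simp
  \<comment> \<open>Products of the Gaussian integers x and y with the conjugate of w, which turn
    the factor \<open>m\<close> into a square. The same is done below for p, q and r.\<close>
  define \<alpha>1 \<alpha>2 \<beta>1 \<beta>2 where "\<alpha>1 = x1 * w1 + x2 * w2" "\<alpha>2 = x2 * w1 - x1 * w2"
    "\<beta>1 = y1 * w1 + y2 * w2" "\<beta>2 = y2 * w1 - y1 * w2"
  note ab = this
  have n1: "\<alpha>1\<^sup>2 + \<alpha>2\<^sup>2 + \<beta>1\<^sup>2 + \<beta>2\<^sup>2 = a * m\<^sup>2"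
  proof -
    have "\<alpha>1\<^sup>2 + \<alpha>2\<^sup>2 + \<beta>1\<^sup>2 + \<beta>2\<^sup>2 = (x1\<^sup>2 + x2\<^sup>2 + y1\<^sup>2 + y2\<^sup>2) * m"
      unfolding ab m_def by (simp add: power2_eq_square algebra_simps)
    then show ?thesis unfolding eq1 by (simp add: power2_eq_square)
  qed
  define P1 P2 Q1 Q2 where "P1 = p1 * r1 + p2 * r2" "P2 = p2 * r1 - p1 * r2"
    "Q1 = q1 * r1 + q2 * r2" "Q2 = q2 * r1 - q1 * r2"
  note pq = this
  have n2: "P1\<^sup>2 + P2\<^sup>2 + a * (Q1\<^sup>2 + Q2\<^sup>2) = a * d * r\<^sup>2"
  proof -
    have "P1\<^sup>2 + P2\<^sup>2 + a * (Q1\<^sup>2 + Q2\<^sup>2) = (p1\<^sup>2 + p2\<^sup>2 + a * (q1\<^sup>2 + q2\<^sup>2)) * r"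
      unfolding pq r_def by (simp add: power2_eq_square algebra_simps)
    then show ?thesis unfolding eq2 by (simp add: power2_eq_square)
  qed
  define U where "U = vec6 (a * r * \<alpha>1) (a * r * \<alpha>2) (a * r * \<beta>1) (a * r * \<beta>2) 0 0"
  \<comment> \<open>The terms with \<open>Q1\<close> and \<open>Q2\<close> are a skew similitude of
    factor Q1^2 + Q2^2 applied to the four coordinates of \<open>U\<close> (up to scaling), hence
    orthogonal to \<open>U\<close>. The last two coordinates contribute P1^2 + P2^2, so that
    \<open>n2\<close> gives the norm.\<close>
  define V where "V = vec6 (b * r * \<alpha>1 - (Q1 * \<beta>1 + Q2 * \<beta>2)) (b * r * \<alpha>2 - (Q2 * \<beta>1 - Q1 * \<beta>2))
    (b * r * \<beta>1 + (Q1 * \<alpha>1 + Q2 * \<alpha>2)) (b * r * \<beta>2 + (Q2 * \<alpha>1 - Q1 * \<alpha>2)) (m * P1) (m * P2)"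
  define N where "N = nat (a * r * m)"
  have N: "int N = a * r * m" using assms(1) r m by (simp add: N_def)
  have "dot U U = (a * r)\<^sup>2 * (\<alpha>1\<^sup>2 + \<alpha>2\<^sup>2 + \<beta>1\<^sup>2 + \<beta>2\<^sup>2)"
    unfolding U_def dot_vec6 by (simp add: power2_eq_square algebra_simps)
  then have UU: "dot U U = (int N)\<^sup>2 * a" unfolding n1 N by (simp add: power2_eq_square)
  have "dot U V = a * r * (b * r) * (\<alpha>1\<^sup>2 + \<alpha>2\<^sup>2 + \<beta>1\<^sup>2 + \<beta>2\<^sup>2)"
    unfolding U_def V_def dot_vec6 by (simp add: power2_eq_square algebra_simps)
  then have UV: "dot U V = (int N)\<^sup>2 * b" unfolding n1 N by (simp add: power2_eq_square)
  have "dot V V = ((b * r)\<^sup>2 + (Q1\<^sup>2 + Q2\<^sup>2)) * (\<alpha>1\<^sup>2 + \<alpha>2\<^sup>2 + \<beta>1\<^sup>2 + \<beta>2\<^sup>2) + m\<^sup>2 * (P1\<^sup>2 + P2\<^sup>2)"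
    unfolding V_def dot_vec6 by (simp add: power2_eq_square algebra_simps)
  also have "\<dots> = m\<^sup>2 * (a * (b * r)\<^sup>2 + (P1\<^sup>2 + P2\<^sup>2 + a * (Q1\<^sup>2 + Q2\<^sup>2)))"
    unfolding n1 by (simp add: algebra_simps)
  also have "\<dots> = (int N)\<^sup>2 * c" unfolding n2 N d_def by (simp add: power2_eq_square algebra_simps)
  finally have VV: "dot V V = (int N)\<^sup>2 * c" .
  have "N > 0" using assms(1) r m by (simp add: N_def)
  then show ?thesis by (rule that[OF _ UU UV VV])
qed

theorem prim_represented_all:
  fixes a b c :: int
  assumes "a > 0" "a * c - b\<^sup>2 > 0"
  shows "prim_represented (of_int a) (of_int b) (of_int c)"
proof -
  obtain N :: nat and U V :: "6 \<Rightarrow> int" where N: "N > 0" and g: "dot U U = (int N)\<^sup>2 * a"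
    "dot U V = (int N)\<^sup>2 * b" "dot V V = (int N)\<^sup>2 * c"
    by (rule rational_embedding[OF assms])
  have "gram_det U V = (int N)\<^sup>2 * (int N)\<^sup>2 * (a * c - b\<^sup>2)"
    unfolding g by (simp add: power2_eq_square algebra_simps)
  then have "gram_det U V > 0" using assms(2) N by simp
  from prim_represented_int_vectors[OF this]
  have "prim_represented ((real N)\<^sup>2 * of_int a) (real N * (real N * of_int b)) ((real N)\<^sup>2 * of_int c)"
    unfolding g by (simp add: power2_eq_square mult.assoc)
  then have "prim_represented (of_int a) (real N * of_int b) ((real N)\<^sup>2 * of_int c)"
    using N by (rule prim_represented_div_square) auto
  then have "prim_represented ((real N)\<^sup>2 * of_int c) (real N * of_int b) (of_int a)"
    by (rule prim_represented_swap)
  then have "prim_represented (of_int c) (of_int b) (of_int a)"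
    using N by (rule prim_represented_div_square) auto
  then show ?thesis by (rule prim_represented_swap)
qed

section \<open>Dual vectors of a primitive pair\<close>

lemma bezout_vector:
  fixes U :: "'n::finite \<Rightarrow> int"
  assumes "\<And>p. prime p \<Longrightarrow> \<exists>i. \<not> int p dvd U i"
  obtains W where "dot U W = 1"
proof -
  obtain i0 where "\<not> int 2 dvd U i0" using assms[OF two_is_prime_nat] by blast
  then have i0: "U i0 \<noteq> 0" by (intro notI) simp
  define e where "e i = (\<lambda>j. if j = i then 1 else 0 :: int)" for i :: 'n
  have dote: "dot U (e i) = U i" for i
    using dot_commute[of U "e i"] by (simp add: e_def dot_def if_distrib[of "\<lambda>x. _ * x"] cong: if_cong)
  define P where "P n \<longleftrightarrow> n > 0 \<and> (\<exists>W. dot U W = int n)" for n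
  have "dot U (\<lambda>j. U i0 * e i0 j) = int (nat ((U i0)\<^sup>2))"
    unfolding dot_simps dote by (simp add: power2_eq_square)
  moreover have "nat ((U i0)\<^sup>2) > 0" using i0 by simp
  ultimately have ex: "P (nat ((U i0)\<^sup>2))" unfolding P_def by blast
  \<comment> \<open>The least positive product with \<open>U\<close>; division with remainder shows
    that it divides every entry.\<close>
  define g where "g = (LEAST n. P n)"
  have g: "P g" unfolding g_def using ex by (rule LeastI)
  then obtain W where W: "dot U W = int g" and g0: "g > 0" by (auto simp: P_def)
  have "int g dvd U i" for i
  proof (rule ccontr)
    assume "\<not> int g dvd U i"
    then have nz: "U i mod int g \<noteq> 0" by (simp add: dvd_eq_mod_eq_0)
    have "dot U (\<lambda>j. e i j - (U i div int g) * W j) = U i - (U i div int g) * int g"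
      unfolding dot_simps dote W ..
    also have "\<dots> = int (nat (U i mod int g))" using g0 by (simp add: minus_div_mult_eq_mod)
    finally have "\<exists>W. dot U W = int (nat (U i mod int g))" by blast
    moreover have "U i mod int g > 0" using nz g0 pos_mod_sign[of "int g" "U i"] by linarith
    ultimately have "P (nat (U i mod int g))" unfolding P_def by simp
    then have "g \<le> nat (U i mod int g)" unfolding g_def by (rule Least_le)
    moreover have "nat (U i mod int g) < g" using g0 by (simp add: nat_less_iff)
    ultimately show False by simp
  qed
  note gU = this
  have "g = 1"
  proof (rule ccontr)
    assume "g \<noteq> 1"
    then obtain p where p: "prime p" "p dvd g" using prime_factor_nat by blast
    then have "int p dvd int g" by simp
    then have "int p dvd U i" for i using gU dvd_trans by blast
    then show False using assms[OF p(1)] by blast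
  qed
  then show ?thesis using that W by simp
qed

text \<open>\<open>W1\<close> and \<open>W2\<close> extend the two coordinate functions of the
  sublattice to the whole lattice; their common kernel will be the direct complement.\<close>

lemma primitive_pair_dual:
  assumes UV: "primitive_pair int_lattice (vec_of U) (vec_of V)"
  obtains W1 W2 where "dot U W1 = 1" "dot V W1 = 0" "dot U W2 = 0" "dot V W2 = 1"
proof -
  note nd = primitive_pair_not_dvd[OF UV]
  have "\<exists>i. \<not> int p dvd U i" if p: "prime p" for p
  proof (rule ccontr)
    assume "\<nexists>i. \<not> int p dvd U i"
    then have "int p dvd 1" using nd(1)[OF p, of 1 0] by simp
    then show False using p by auto
  qed
  then obtain W where W: "dot U W = 1" using bezout_vector by blast
  define t where "t = dot V W"
  \<comment> \<open>\<open>V'\<close> is orthogonal to \<open>W\<close>, so correcting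
    \<open>W'\<close> by a multiple of \<open>W\<close> to make it orthogonal to \<open>U\<close>
    keeps its product with \<open>V'\<close>.\<close>
  define V' where "V' i = V i - t * U i" for i
  have "\<exists>i. \<not> int p dvd V' i" if p: "prime p" for p
  proof (rule ccontr)
    assume "\<nexists>i. \<not> int p dvd V' i"
    then have "int p dvd 1" using nd(2)[OF p, of "- t" 1] by (simp add: V'_def)
    then show False using p by auto
  qed
  then obtain W' where W': "dot V' W' = 1" using bezout_vector by blast
  have V': "dot V' X = dot V X - t * dot U X" for X unfolding V'_def[abs_def] dot_simps ..
  define s where "s = dot U W'"
  define W2 where "W2 i = W' i - s * W i" for i
  have UW2: "dot U W2 = 0" unfolding W2_def[abs_def] dot_simps by (simp add: s_def W)
  have VW2: "dot V W2 = 1" 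
    unfolding W2_def[abs_def] dot_simps using W' unfolding V' by (simp add: s_def[symmetric] t_def[symmetric] mult.commute)
  define W1 where "W1 i = W i - t * W2 i" for i
  have "dot U W1 = 1" unfolding W1_def[abs_def] dot_simps by (simp add: W UW2)
  moreover have "dot V W1 = 0" unfolding W1_def[abs_def] dot_simps by (simp add: VW2 t_def)
  ultimately show ?thesis using that UW2 VW2 by blast
qed

section \<open>The standard lattice on \<open>int^6\<close>\<close>

context Z_lattice
begin

lemma B_linear:
  "B (x + y) z = B x z + B y z" "B z (x + y) = B z x + B z y"
  "B (x - y) z = B x z - B y z" "B z (x - y) = B z x - B z y"
  "B (smul k x) z = k * B x z" "B z (smul k x) = k * B z x"
  "B (- x) z = - B x z" "B z (- x) = - B z x" "B 0 z = 0" "B z 0 = 0"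
proof -
  interpret l: module_hom smul "(*)" "\<lambda>x. B x z" by (rule linear_left)
  interpret r: module_hom smul "(*)" "\<lambda>x. B z x" by (rule linear_right)
  show "B (x + y) z = B x z + B y z" "B z (x + y) = B z x + B z y"
    "B (x - y) z = B x z - B y z" "B z (x - y) = B z x - B z y"
    "B (smul k x) z = k * B x z" "B z (smul k x) = k * B z x"
    "B (- x) z = - B x z" "B z (- x) = - B z x" "B 0 z = 0" "B z 0 = 0"
    by (simp_all add: l.add r.add l.diff r.diff l.scale r.scale l.neg r.neg l.zero r.zero)
qed

end

interpretation vec: module "(*s) :: int \<Rightarrow> int^'n \<Rightarrow> int^'n"
  by unfold_locales (auto simp: vec_eq_iff algebra_simps)

definition dot6 :: "int^6 \<Rightarrow> int^6 \<Rightarrow> int" where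
  "dot6 x y = (\<Sum>i\<in>UNIV. x $ i * y $ i)"

lemma dot6_simps:
  "dot6 (x + y) z = dot6 x z + dot6 y z" "dot6 z (x + y) = dot6 z x + dot6 z y"
  "dot6 (x - y) z = dot6 x z - dot6 y z" "dot6 (k *s x) z = k * dot6 x z" "dot6 z (k *s x) = k * dot6 z x"
  by (simp_all add: dot6_def algebra_simps sum.distrib sum_subtractf sum_distrib_left)

lemma dot6_dot: "dot6 (vec_lambda X) (vec_lambda Y) = dot X Y"
  by (simp add: dot6_def dot_def)

lemma vec_basis: "vec.finite_basis (range (\<lambda>i. axis i 1) :: (int^'n) set)"
  unfolding vec.finite_basis_def
proof (intro conjI)
  let ?S = "range (\<lambda>i::'n. axis i (1::int))"
  have inj: "inj (\<lambda>i::'n. axis i (1::int))" by (rule injI) (simp add: axis_eq_axis)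
  have sum: "(\<Sum>v\<in>?S. u v *s v) $ i = u (axis i 1)" for u i
  proof -
    have "(\<Sum>v\<in>?S. u v *s v) = (\<Sum>j\<in>UNIV. u (axis j 1) *s axis j 1)"
      by (simp add: sum.reindex[OF inj])
    then show ?thesis by (simp add: axis_def if_distrib cong: if_cong)
  qed
  show "finite ?S" by simp
  show "vec.independent ?S"
  proof
    assume "vec.dependent ?S"
    then obtain u v where uv: "v \<in> ?S" "u v \<noteq> 0" "(\<Sum>v\<in>?S. u v *s v) = 0"
      by (auto simp: vec.dependent_finite)
    then obtain i where "v = axis i 1" by blast
    then show False using sum[of u i] uv by simp
  qed
  have "x \<in> vec.span ?S" for x
  proof -
    have "x = (\<Sum>i\<in>UNIV. x $ i *s axis i 1)"
      by (simp add: vec_eq_iff axis_def if_distrib cong: if_cong)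
    also have "\<dots> \<in> vec.span ?S" by (intro vec.span_sum vec.span_scale vec.span_base) auto
    finally show ?thesis .
  qed
  then show "vec.span ?S = UNIV" by blast
qed

lemma vec_rank: "Z_rank ((*s) :: int \<Rightarrow> int^'n \<Rightarrow> int^'n) = CARD('n)"
proof -
  have "card (range (\<lambda>i::'n. axis i (1::int))) = CARD('n)"
    by (subst card_image) (auto intro!: injI simp: axis_eq_axis)
  then show ?thesis using Z_rank_eq_card[OF vec.module_axioms vec_basis[where 'n = 'n]] by simp
qed

lemma Z6_lattice: "Z_lattice (*s) dot6"
proof (intro Z_lattice.intro Z_lattice_axioms.intro)
  show "module ((*s) :: int \<Rightarrow> int^6 \<Rightarrow> int^6)" by (rule vec.module_axioms)
  show "\<exists>S. vec.finite_basis (S :: (int^6) set)" by (rule exI, rule vec_basis)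
  show "dot6 x y = dot6 y x" for x y by (simp add: dot6_def mult.commute)
  show "module_hom (*s) (*) (\<lambda>x. dot6 x y)" for y
    by unfold_locales (simp_all add: dot6_simps algebra_simps)
  show "module_hom (*s) (*) (\<lambda>y. dot6 x y)" for x
    by unfold_locales (simp_all add: dot6_simps algebra_simps)
  fix x :: "int^6" assume "x \<noteq> 0"
  then obtain i where "x $ i \<noteq> 0" by (auto simp: vec_eq_iff)
  then have "0 < x $ i * x $ i" by (metis not_real_square_gt_zero zero_less_mult_iff linorder_neqE)
  also have "\<dots> \<le> dot6 x x" unfolding dot6_def by (rule member_le_sum) auto
  finally show "dot6 x x > 0" .
qed

lemma binary_lattice_gram:
  assumes "Z_lattice s C" "Z_rank s = 2"
  obtains p q where "\<And>x. \<exists>i j. x = s i p + s j q" "\<And>i j. s i p + s j q = 0 \<Longrightarrow> i = 0 \<and> j = 0"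
    "C p p > 0" "C p p * C q q - (C p q)\<^sup>2 > 0"
proof -
  interpret M: Z_lattice s C by fact
  obtain S where S: "M.finite_basis S" using M.finitely_generated_free by blast
  then have "card S = 2" using Z_rank_eq_card[OF M.module_axioms S] assms(2) by simp
  then obtain p q where pq: "S = {p, q}" "p \<noteq> q" by (auto simp: card_2_iff)
  have span: "\<exists>i j. x = s i p + s j q" for x
  proof -
    obtain c where "x = (\<Sum>w\<in>S. s (c w) w)"
      using S M.span_finite[of S] unfolding M.finite_basis_def by blast
    then show ?thesis using pq by auto
  qed
  have ind: "i = 0 \<and> j = 0" if 0: "s i p + s j q = 0" for i j
  proof -
    define c where "c w = (if w = p then i else j)" for w
    have "(\<Sum>w\<in>S. s (c w) w) = 0" using pq 0 by (simp add: c_def)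
    then have "c w = 0" if "w \<in> S" for w
      using M.independentD[of S S c w] S that by (auto simp: M.finite_basis_def)
    from this[of p] this[of q] show ?thesis using pq by (auto simp: c_def)
  qed
  have "p \<noteq> 0" using ind[of 1 0] by auto
  then have a: "C p p > 0" by (rule M.positive_definite)
  \<comment> \<open>Orthogonal to \<open>p\<close>; its norm is the determinant times
    \<open>C p p\<close>.\<close>
  define z where "z = s (- C p q) p + s (C p p) q"
  have "z \<noteq> 0" unfolding z_def using ind a by fastforce
  then have "C z z > 0" by (rule M.positive_definite)
  moreover have "C z z = C p p * (C p p * C q q - (C p q)\<^sup>2)"
    unfolding z_def M.B_linear M.symmetric[of q p] by (simp add: power2_eq_square algebra_simps)
  ultimately have "C p p * C q q - (C p q)\<^sup>2 > 0" using a zero_less_mult_pos by metis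
  then show ?thesis using that span ind a by blast
qed

theorem Z6_primitively_2_universal: "primitively_2_universal (*s) dot6"
  unfolding primitively_2_universal_def
proof (intro conjI allI impI Z6_lattice)
  fix s :: "int \<Rightarrow> int^2 \<Rightarrow> int^2" and C
  assume M: "Z_lattice s C \<and> Z_rank s = 2"
  interpret M: Z_lattice s C using M by blast
  obtain p q where span: "\<And>x. \<exists>i j. x = s i p + s j q"
    and ind: "\<And>i j. s i p + s j q = 0 \<Longrightarrow> i = 0 \<and> j = 0"
    and pos: "C p p > 0" "C p p * C q q - (C p q)\<^sup>2 > 0"
    using binary_lattice_gram[of s C] M by blast
  obtain u v where uv: "primitive_pair int_lattice u v"
    "u \<bullet> u = of_int (C p p)" "u \<bullet> v = of_int (C p q)" "v \<bullet> v = of_int (C q q)"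
    by (rule prim_represented_int_lattice[OF prim_represented_all[OF pos]])
  obtain U where U: "u = vec_of U" using primitive_pairD(1)[OF uv(1)] int_lattice_vec_of by blast
  obtain V where V: "v = vec_of V" using primitive_pairD(2)[OF uv(1)] int_lattice_vec_of by blast
  have g: "dot U U = C p p" "dot U V = C p q" "dot V V = C q q"
    using uv(2-4) unfolding U V vec_of_inner by simp_all
  obtain W1 W2 where W: "dot U W1 = 1" "dot V W1 = 0" "dot U W2 = 0" "dot V W2 = 1"
    using primitive_pair_dual[of U V] uv(1) U V by blast
  obtain ci cj where c: "x = s (ci x) p + s (cj x) q" for x using span by metis
  have uniq: "ci x = i \<and> cj x = j" if "x = s i p + s j q" for x i j
  proof -
    have "s (ci x - i) p + s (cj x - j) q = (s (ci x) p + s (cj x) q) - (s i p + s j q)"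
      by (simp add: M.scale_left_diff_distrib)
    also have "\<dots> = 0" using c[of x] that by simp
    finally show ?thesis using ind by fastforce
  qed
  have add: "ci (x + y) = ci x + ci y \<and> cj (x + y) = cj x + cj y" for x y
  proof (rule uniq)
    have "x + y = (s (ci x) p + s (cj x) q) + (s (ci y) p + s (cj y) q)" using c by metis
    then show "x + y = s (ci x + ci y) p + s (cj x + cj y) q" by (simp add: M.scale_left_distrib)
  qed
  have scale: "ci (s k x) = k * ci x \<and> cj (s k x) = k * cj x" for k x
  proof (rule uniq)
    have "s k x = s k (s (ci x) p + s (cj x) q)" using c by metis
    then show "s k x = s (k * ci x) p + s (k * cj x) q" by (simp add: M.scale_right_distrib)
  qed
  let ?u = "vec_lambda U :: int^6" and ?v = "vec_lambda V :: int^6"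
  let ?w1 = "vec_lambda W1 :: int^6" and ?w2 = "vec_lambda W2 :: int^6"
  define f where "f x = ci x *s ?u + cj x *s ?v" for x
  have hom: "module_hom s (*s) f"
    by unfold_locales (simp_all add: f_def add scale vec_eq_iff algebra_simps)
  have "dot6 (f x) (f y) = C x y" for x y
  proof -
    have "C x y = C (s (ci x) p + s (cj x) q) (s (ci y) p + s (cj y) q)" using c by metis
    also have "\<dots> = dot6 (f x) (f y)"
      unfolding M.B_linear f_def dot6_simps dot6_dot g M.symmetric[of q p] dot_commute[of V U] by simp
    finally show ?thesis ..
  qed
  then have rep: "Z_representation s C (*s) dot6 f" using hom by (simp add: Z_representation_def)
  have range: "range f = {i *s ?u + j *s ?v | i j. True}"
  proof -
    have "f (s i p + s j q) = i *s ?u + j *s ?v" for i j using uniq[OF refl, of i j] by (simp add: f_def)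
    then show ?thesis unfolding f_def by (auto simp: image_iff) metis
  qed
  define K where "K = {x. dot6 x ?w1 = 0 \<and> dot6 x ?w2 = 0}"
  have "vec.subspace (range f)"
  proof -
    interpret f: module_hom s "(*s)" f by (rule hom)
    show ?thesis by (rule f.subspace_image[OF M.subspace_UNIV])
  qed
  moreover have "vec.subspace K"
    by (auto simp: vec.subspace_def K_def dot6_simps) (simp_all add: dot6_def)
  moreover have "range f \<inter> K = {0}"
  proof
    show "range f \<inter> K \<subseteq> {0}" unfolding range K_def by (auto simp: dot6_simps dot6_dot W)
    show "{0} \<subseteq> range f \<inter> K" using \<open>vec.subspace (range f)\<close> \<open>vec.subspace K\<close> by (simp add: vec.subspace_0)
  qed
  moreover have "{x + y | x y. x \<in> range f \<and> y \<in> K} = UNIV"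
  proof -
    have "x \<in> {x + y | x y. x \<in> range f \<and> y \<in> K}" for x
    proof -
      let ?n = "dot6 x ?w1 *s ?u + dot6 x ?w2 *s ?v"
      have "?n \<in> range f" unfolding range by blast
      moreover have "x - ?n \<in> K" unfolding K_def by (simp add: dot6_simps dot6_dot W)
      moreover have "x = ?n + (x - ?n)" by simp
      ultimately show ?thesis by blast
    qed
    then show ?thesis by blast
  qed
  ultimately have "vec.direct_summand (range f)" unfolding vec.direct_summand_def by blast
  then show "\<exists>f. primitive_representation s C (*s) dot6 f"
    using rep unfolding primitive_representation_def by blast
qed

section \<open>Anisotropic frames in lattices of rank at most 5\<close>

text \<open>Gaussian elimination without division: the pivot \<open>a k s\<close> clears the
  coordinate \<open>s\<close>, and the index \<open>k\<close> is removed.\<close>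

lemma int_dependence:
  fixes a :: "'i \<Rightarrow> 's \<Rightarrow> int"
  assumes "finite S" "finite I" "card S < card I"
  shows "\<exists>c. (\<exists>i\<in>I. c i \<noteq> 0) \<and> (\<forall>s\<in>S. (\<Sum>i\<in>I. c i * a i s) = 0)"
  using assms
proof (induction S arbitrary: I a rule: finite_induct)
  case empty
  then have "I \<noteq> {}" by auto
  then show ?case by (intro exI[of _ "\<lambda>_. 1"]) auto
next
  case (insert s S)
  show ?case
  proof (cases "\<forall>i\<in>I. a i s = 0")
    case True
    have "card S < card I" using insert.prems insert.hyps by simp
    from insert.IH[OF insert.prems(1) this, of a] True show ?thesis by auto
  next
    case False
    then obtain k where k: "k \<in> I" "a k s \<noteq> 0" by blast
    define a' where "a' i t = a k s * a i t - a i s * a k t" for i t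
    have "card S < card (I - {k})" using insert.prems insert.hyps k by simp
    with insert.IH[of "I - {k}" a'] insert.prems obtain c where
      c: "\<exists>i\<in>I - {k}. c i \<noteq> 0" "\<forall>t\<in>S. (\<Sum>i\<in>I - {k}. c i * a' i t) = 0" by auto
    define c' where "c' i = (if i = k then - (\<Sum>i\<in>I - {k}. c i * a i s) else a k s * c i)" for i
    have sum: "(\<Sum>i\<in>I. c' i * a i t) = (\<Sum>i\<in>I - {k}. c i * a' i t)" for t
    proof -
      have "(\<Sum>i\<in>I. c' i * a i t) = c' k * a k t + (\<Sum>i\<in>I - {k}. c' i * a i t)"
        using insert.prems k by (simp add: sum.remove)
      also have "(\<Sum>i\<in>I - {k}. c' i * a i t) = (\<Sum>i\<in>I - {k}. a k s * c i * a i t)"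
        by (rule sum.cong) (auto simp: c'_def)
      also have "c' k * a k t = - (\<Sum>i\<in>I - {k}. c i * a i s * a k t)"
        by (simp add: c'_def sum_distrib_right)
      also have "- (\<Sum>i\<in>I - {k}. c i * a i s * a k t) + (\<Sum>i\<in>I - {k}. a k s * c i * a i t)
          = (\<Sum>i\<in>I - {k}. c i * a' i t)"
        by (simp add: a'_def sum_negf[symmetric] sum.distrib[symmetric] algebra_simps)
      finally show ?thesis .
    qed
    have "a' i s = 0" for i by (simp add: a'_def)
    then have "\<forall>t\<in>insert s S. (\<Sum>i\<in>I. c' i * a i t) = 0" using c(2) by (simp add: sum)
    moreover have "\<exists>i\<in>I. c' i \<noteq> 0" using c(1) k by (auto simp: c'_def)
    ultimately show ?thesis by blast
  qed
qed

definition binary_form :: "int \<Rightarrow> int \<Rightarrow> int \<Rightarrow> int^2 \<Rightarrow> int^2 \<Rightarrow> int" where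
  "binary_form a b c x y = a * x $ 1 * y $ 1 + b * (x $ 1 * y $ 2 + x $ 2 * y $ 1) + c * x $ 2 * y $ 2"

lemma binary_form_lattice:
  assumes "a > 0" "a * c - b\<^sup>2 > 0"
  shows "Z_lattice (*s) (binary_form a b c)"
proof (intro Z_lattice.intro Z_lattice_axioms.intro)
  show "module ((*s) :: int \<Rightarrow> int^2 \<Rightarrow> int^2)" by (rule vec.module_axioms)
  show "\<exists>S. vec.finite_basis (S :: (int^2) set)" by (rule exI, rule vec_basis)
  show "binary_form a b c x y = binary_form a b c y x" for x y
    by (simp add: binary_form_def algebra_simps)
  show "module_hom (*s) (*) (\<lambda>x. binary_form a b c x y)" for y
    by unfold_locales (simp_all add: binary_form_def algebra_simps)
  show "module_hom (*s) (*) (\<lambda>y. binary_form a b c x y)" for x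
    by unfold_locales (simp_all add: binary_form_def algebra_simps)
  fix x :: "int^2" assume x: "x \<noteq> 0"
  have eq: "a * binary_form a b c x x = (a * x $ 1 + b * x $ 2)\<^sup>2 + (a * c - b\<^sup>2) * (x $ 2)\<^sup>2"
    by (simp add: binary_form_def power2_eq_square algebra_simps)
  have "0 < (a * x $ 1 + b * x $ 2)\<^sup>2 + (a * c - b\<^sup>2) * (x $ 2)\<^sup>2"
  proof (cases "x $ 2 = 0")
    case True
    then have "x $ 1 \<noteq> 0" using x by (simp add: vec_eq_iff forall_2)
    then show ?thesis using True assms(1) by simp
  next
    case False
    then have "(a * c - b\<^sup>2) * (x $ 2)\<^sup>2 > 0" using assms(2) by simp
    then show ?thesis by (simp add: add_nonneg_pos)
  qed
  then show "binary_form a b c x x > 0" unfolding eq[symmetric] using assms(1) by (simp add: zero_less_mult_iff)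
qed

context Z_lattice
begin

lemma B_nonneg: "B x x \<ge> 0"
  using positive_definite[of x] B_linear(9)[of x] by (cases "x = 0") auto

lemma B_eq_0: "B x x = 0 \<longleftrightarrow> x = 0"
  using positive_definite[of x] B_linear(9)[of x] by (cases "x = 0") auto

lemma torsion_free: "smul k x = 0 \<Longrightarrow> k \<noteq> 0 \<Longrightarrow> x = 0"
  using B_eq_0[of x] B_linear(5)[of k x x] B_linear(9)[of x] by auto

text \<open>The divisibility is what the direct summand is used for: the component \<open>k\<close>
  of \<open>z\<close> in the complement satisfies \<open>q k = 0\<close>, so \<open>z\<close> lies
  in the image and has integral coordinates there.\<close>

lemma primitive_vectors:
  assumes univ: "primitively_2_universal smul B" and abc: "a > 0" "a * c - b\<^sup>2 > 0"
  obtains x y where "B x x = a" "B x y = b" "B y y = c"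
    "\<And>q \<alpha> \<beta> z. smul q z = smul \<alpha> x + smul \<beta> y \<Longrightarrow> q \<noteq> 0 \<Longrightarrow> q dvd \<alpha> \<and> q dvd \<beta>"
proof -
  obtain f where "primitive_representation (*s) (binary_form a b c) smul B f"
    using univ binary_form_lattice[OF abc] vec_rank[where 'n = 2] unfolding primitively_2_universal_def by fastforce
  then have hom: "module_hom (*s) smul f" and f: "\<And>x y. B (f x) (f y) = binary_form a b c x y"
    and summand: "direct_summand (range f)"
    by (auto simp: primitive_representation_def Z_representation_def)
  interpret f: module_hom "(*s)" smul f by (rule hom)
  interpret M: Z_lattice "(*s)" "binary_form a b c" by (rule binary_form_lattice[OF abc])
  define v where "v \<alpha> \<beta> = (\<alpha> *s axis 1 1 + \<beta> *s axis 2 1 :: int^2)" for \<alpha> \<beta>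
  let ?x = "f (v 1 0)" and ?y = "f (v 0 1)"
  have v: "v \<alpha> \<beta> $ 1 = \<alpha>" "v \<alpha> \<beta> $ 2 = \<beta>" for \<alpha> \<beta> by (simp_all add: v_def axis_def)
  have fv: "smul \<alpha> ?x + smul \<beta> ?y = f (v \<alpha> \<beta>)" for \<alpha> \<beta>
    by (simp add: f.scale[symmetric] f.add[symmetric] v_def)
  have inj: "x = 0" if "f x = 0" for x
    using f[of x x] that M.positive_definite[of x] B_linear(9)[of 0] by (cases "x = 0") auto
  obtain K where K: "subspace K" "range f \<inter> K = {0}" "{x + y | x y. x \<in> range f \<and> y \<in> K} = UNIV"
    and N: "subspace (range f)"
    using summand unfolding direct_summand_def by blast
  show ?thesis
  proof (rule that[of ?x ?y])
    show "B ?x ?x = a" "B ?x ?y = b" "B ?y ?y = c" unfolding f by (simp_all add: binary_form_def v)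
    fix q \<alpha> \<beta> z assume z: "smul q z = smul \<alpha> ?x + smul \<beta> ?y" and q: "q \<noteq> 0"
    obtain n k where nk: "z = n + k" "n \<in> range f" "k \<in> K" using K(3) by blast
    have "smul q k = f (v \<alpha> \<beta>) - smul q n" using z unfolding fv nk(1) by (simp add: algebra_simps)
    also have "\<dots> \<in> range f" using nk(2) by (intro subspace_diff[OF N] subspace_scale[OF N]) auto
    finally have "smul q k \<in> range f \<inter> K" using nk(3) subspace_scale[OF K(1)] by blast
    then have "smul q k = 0" using K(2) by blast
    then have "k = 0" using torsion_free q by blast
    then obtain w where w: "z = f w" using nk by auto
    have "f (q *s w - v \<alpha> \<beta>) = 0" using z unfolding w fv by (simp add: f.diff f.scale)
    then have "q *s w - v \<alpha> \<beta> = 0" by (rule inj)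
    then have "q *s w = v \<alpha> \<beta>" by simp
    then have "q * w $ 1 = \<alpha>" "q * w $ 2 = \<beta>" using v by (metis vector_smult_component)+
    then show "q dvd \<alpha> \<and> q dvd \<beta>" by auto
  qed
qed

lemma dependent_vectors:
  fixes f :: "nat \<Rightarrow> 'a"
  assumes "Z_rank smul < n"
  obtains c where "\<exists>i<n. c i \<noteq> 0" "(\<Sum>i<n. smul (c i) (f i)) = 0"
proof -
  obtain S where S: "finite_basis S" using finitely_generated_free by blast
  then have fin: "finite S" and sp: "span S = UNIV" by (auto simp: finite_basis_def)
  have card: "card S < n" using Z_rank_eq_card[OF module_axioms S] assms by simp
  have "\<exists>u. x = (\<Sum>v\<in>S. smul (u v) v)" for x
    using sp span_finite[OF fin] by blast
  then obtain u where u: "\<And>x. x = (\<Sum>v\<in>S. smul (u x v) v)" by metis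
  obtain c where c: "\<exists>i\<in>{..<n}. c i \<noteq> 0" "\<forall>v\<in>S. (\<Sum>i\<in>{..<n}. c i * u (f i) v) = 0"
    using int_dependence[OF fin finite_lessThan, of n "\<lambda>i. u (f i)"] card by auto
  have "(\<Sum>i<n. smul (c i) (f i)) = (\<Sum>i<n. smul (c i) (\<Sum>v\<in>S. smul (u (f i) v) v))"
    using u by metis
  also have "\<dots> = (\<Sum>i<n. \<Sum>v\<in>S. smul (c i * u (f i) v) v)" by (simp add: scale_sum_right)
  also have "\<dots> = (\<Sum>v\<in>S. \<Sum>i<n. smul (c i * u (f i) v) v)" by (rule sum.swap)
  also have "\<dots> = (\<Sum>v\<in>S. smul (\<Sum>i<n. c i * u (f i) v) v)" by (simp add: scale_sum_left)
  also have "\<dots> = 0" using c(2) by simp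
  finally show ?thesis using that[of c] c(1) by auto
qed

end

definition diag4 :: "int \<Rightarrow> int \<Rightarrow> int \<Rightarrow> int \<Rightarrow> int \<Rightarrow> int \<Rightarrow> int \<Rightarrow> int \<Rightarrow> int" where
  "diag4 n1 n2 n3 n4 x1 x2 x3 x4 = n1 * x1\<^sup>2 + n2 * x2\<^sup>2 + n3 * x3\<^sup>2 + n4 * x4\<^sup>2"

text \<open>A finite certificate for anisotropy over the p-adic numbers. It can be iterated, each
  round dividing the coordinates by p and the value by p^2.\<close>

definition anisotropic_mod :: "int \<Rightarrow> nat \<Rightarrow> int \<Rightarrow> int \<Rightarrow> int \<Rightarrow> int \<Rightarrow> bool" where
  "anisotropic_mod p e n1 n2 n3 n4 \<longleftrightarrow> (\<forall>x1 x2 x3 x4. p ^ e dvd diag4 n1 n2 n3 n4 x1 x2 x3 x4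
     \<longrightarrow> p dvd x1 \<and> p dvd x2 \<and> p dvd x3 \<and> p dvd x4)"

lemma anisotropic_descent:
  assumes "anisotropic_mod p e n1 n2 n3 n4" "p \<noteq> 0"
    and "p ^ (e + 2 * j) dvd diag4 n1 n2 n3 n4 x1 x2 x3 x4"
  shows "p ^ Suc j dvd x1 \<and> p ^ Suc j dvd x2 \<and> p ^ Suc j dvd x3 \<and> p ^ Suc j dvd x4"
  using assms(3)
proof (induction j arbitrary: x1 x2 x3 x4)
  case 0
  then show ?case using assms(1) by (simp add: anisotropic_mod_def)
next
  case (Suc j)
  have "p ^ e dvd p ^ (e + 2 * Suc j)" by (rule le_imp_power_dvd) simp
  then have "p ^ e dvd diag4 n1 n2 n3 n4 x1 x2 x3 x4" using Suc.prems dvd_trans by blast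
  then have "p dvd x1" "p dvd x2" "p dvd x3" "p dvd x4"
    using assms(1) unfolding anisotropic_mod_def by blast+
  then obtain y1 y2 y3 y4 where y: "x1 = p * y1" "x2 = p * y2" "x3 = p * y3" "x4 = p * y4"
    by (auto elim!: dvdE)
  have "diag4 n1 n2 n3 n4 x1 x2 x3 x4 = p\<^sup>2 * diag4 n1 n2 n3 n4 y1 y2 y3 y4"
    by (simp add: diag4_def y power_mult_distrib algebra_simps)
  moreover have "p ^ (e + 2 * Suc j) = p\<^sup>2 * p ^ (e + 2 * j)" by (simp add: power_add power2_eq_square)
  ultimately have "p\<^sup>2 * p ^ (e + 2 * j) dvd p\<^sup>2 * diag4 n1 n2 n3 n4 y1 y2 y3 y4"
    using Suc.prems by (simp only:)
  then have "p ^ (e + 2 * j) dvd diag4 n1 n2 n3 n4 y1 y2 y3 y4"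
    using assms(2) by (simp only: dvd_mult_cancel_left) simp
  from Suc.IH[OF this] show ?case by (simp add: y)
qed

text \<open>
  If the lattice has rank 5, a primitive sublattice of rank 2 meets the hyperplane of
  \<open>k1, \<dots>, k4\<close> in a primitive vector. Its norm cannot be divisible by a high power of \<open>p\<close>, so
  the form \<open>p ^ m * (x\<^sup>2 + y\<^sup>2)\<close> is not primitively represented for large \<open>m\<close>.
\<close>

lemma (in Z_lattice) no_anisotropic_frame:
  assumes univ: "primitively_2_universal smul B" and rank: "Z_rank smul < 6"
    and orth: "B k1 k2 = 0" "B k1 k3 = 0" "B k1 k4 = 0" "B k2 k3 = 0" "B k2 k4 = 0" "B k3 k4 = 0"
    and norms: "B k1 k1 = n1" "B k2 k2 = n2" "B k3 k3 = n3" "B k4 k4 = n4"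
    and pos: "n1 > 0" "n2 > 0" "n3 > 0" "n4 > 0" and p: "p > 1" and aniso: "anisotropic_mod p e n1 n2 n3 n4"
  shows False
proof -
  have sym: "B k2 k1 = 0" "B k3 k1 = 0" "B k4 k1 = 0" "B k3 k2 = 0" "B k4 k2 = 0" "B k4 k3 = 0"
    using orth symmetric by metis+
  define P where "P = n1 * n2 * n3 * n4"
  have P: "P > 0" using pos by (simp add: P_def)
  define j where "j = nat P"
  have Pj: "P < p ^ Suc j"
  proof -
    have "int j < 2 ^ j" by (metis less_exp of_nat_less_numeral_power_cancel_iff of_nat_numeral)
    also have "(2::int) ^ j \<le> p ^ j" using p by (intro power_mono) auto
    also have "\<dots> \<le> p ^ Suc j" using p by (intro power_increasing) auto
    finally show ?thesis using P by (simp add: j_def)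
  qed
  \<comment> \<open>The exponent is chosen so that \<open>anisotropic_descent\<close> makes the
    frame coordinates divisible by p^(j+1), which exceeds \<open>P\<close>.\<close>
  define m where "m = p ^ (e + 2 * j)"
  have m: "m > 0" "m * m - 0\<^sup>2 > 0" using p by (simp_all add: m_def)
  obtain x y where xy: "B x x = m" "B x y = 0" "B y y = m"
    and prim: "\<And>q \<alpha> \<beta> z. smul q z = smul \<alpha> x + smul \<beta> y \<Longrightarrow> q \<noteq> 0 \<Longrightarrow> q dvd \<alpha> \<and> q dvd \<beta>"
    using primitive_vectors[OF univ m] by metis
  define f where "f i = [x, y, k1, k2, k3, k4] ! i" for i
  obtain c where c: "\<exists>i<6. c i \<noteq> 0" "(\<Sum>i<6. smul (c i) (f i)) = 0"
    using dependent_vectors[OF rank] by blast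
  define \<alpha> \<beta> where "\<alpha> = c 0" "\<beta> = c 1"
  note ab = this
  have rel: "smul \<alpha> x + smul \<beta> y + smul (c 2) k1 + smul (c 3) k2 + smul (c 4) k3 + smul (c 5) k4 = 0"
    using c(2) by (simp add: ab f_def eval_nat_numeral add.assoc)
  define z0 where "z0 = smul \<alpha> x + smul \<beta> y"
  have z0: "z0 = - (smul (c 2) k1 + smul (c 3) k2 + smul (c 4) k3 + smul (c 5) k4)"
  proof -
    have "z0 + (smul (c 2) k1 + smul (c 3) k2 + smul (c 4) k3 + smul (c 5) k4) = 0"
      unfolding z0_def using rel by (simp only: add.assoc)
    then show ?thesis by (simp only: eq_neg_iff_add_eq_0)
  qed
  have Bz0: "B z0 k1 = - c 2 * n1" "B z0 k2 = - c 3 * n2" "B z0 k3 = - c 4 * n3" "B z0 k4 = - c 5 * n4"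
    unfolding z0 by (simp_all add: B_linear orth sym norms)
  have "\<alpha> \<noteq> 0 \<or> \<beta> \<noteq> 0"
  proof (rule ccontr)
    assume "\<not> (\<alpha> \<noteq> 0 \<or> \<beta> \<noteq> 0)"
    then have 0: "\<alpha> = 0" "\<beta> = 0" by auto
    then have "z0 = 0" by (simp add: z0_def)
    then have "c 2 = 0" "c 3 = 0" "c 4 = 0" "c 5 = 0" using Bz0 pos by (simp_all add: B_linear)
    moreover have "c i = 0" if "i < 6" for i
    proof -
      have "i = 0 \<or> i = 1 \<or> i = 2 \<or> i = 3 \<or> i = 4 \<or> i = 5" using that by linarith
      then show ?thesis using 0 calculation by (auto simp: ab)
    qed
    ultimately show False using c(1) by blast
  qed
  define g where "g = gcd \<alpha> \<beta>"
  have g: "g \<noteq> 0" using \<open>\<alpha> \<noteq> 0 \<or> \<beta> \<noteq> 0\<close> by (simp add: g_def)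
  obtain \<alpha>' \<beta>' where ab': "\<alpha> = g * \<alpha>'" "\<beta> = g * \<beta>'" "coprime \<alpha>' \<beta>'"
    using gcd_coprime_exists[of \<alpha> \<beta>] g unfolding g_def by (metis mult.commute)
  define z where "z = smul \<alpha>' x + smul \<beta>' y"
  have gz: "z0 = smul g z" by (simp add: z0_def z_def ab' scale_right_distrib)
  \<comment> \<open>\<open>P\<close> times the rational coordinates of \<open>z\<close> in the
    frame, which are the quotients \<open>B z k1 / n1\<close> and so on.\<close>
  define d1 d2 d3 d4 where "d1 = n2 * n3 * n4 * B z k1" "d2 = n1 * n3 * n4 * B z k2"
    "d3 = n1 * n2 * n4 * B z k3" "d4 = n1 * n2 * n3 * B z k4"
  note d = this
  define r where "r = smul d1 k1 + smul d2 k2 + smul d3 k3 + smul d4 k4"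
  have gd: "g * B z k1 = - c 2 * n1" "g * B z k2 = - c 3 * n2" "g * B z k3 = - c 4 * n3"
    "g * B z k4 = - c 5 * n4"
    using Bz0 unfolding gz B_linear by simp_all
  have gd1: "g * d1 = - P * c 2"
  proof -
    have "g * d1 = n2 * n3 * n4 * (g * B z k1)" by (simp only: d mult.left_commute)
    then show ?thesis unfolding gd by (simp add: P_def mult_ac)
  qed
  have gd2: "g * d2 = - P * c 3"
  proof -
    have "g * d2 = n1 * n3 * n4 * (g * B z k2)" by (simp only: d mult.left_commute)
    then show ?thesis unfolding gd by (simp add: P_def mult_ac)
  qed
  have gd3: "g * d3 = - P * c 4"
  proof -
    have "g * d3 = n1 * n2 * n4 * (g * B z k3)" by (simp only: d mult.left_commute)
    then show ?thesis unfolding gd by (simp add: P_def mult_ac)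
  qed
  have gd4: "g * d4 = - P * c 5"
  proof -
    have "g * d4 = n1 * n2 * n3 * (g * B z k4)" by (simp only: d mult.left_commute)
    then show ?thesis unfolding gd by (simp add: P_def mult_ac)
  qed
  have "smul g r = smul P z0"
    unfolding r_def z0 by (simp add: scale_right_distrib scale_right_diff_distrib gd1 gd2 gd3 gd4)
  then have "smul g (smul P z - r) = 0" unfolding gz by (simp add: scale_right_diff_distrib mult.commute)
  then have "smul P z - r = 0" using torsion_free g by blast
  then have Pz: "smul P z = r" by simp
  have "P * P * B z z = B (smul P z) (smul P z)" by (simp add: B_linear)
  also have "\<dots> = diag4 n1 n2 n3 n4 d1 d2 d3 d4"
    unfolding Pz r_def by (simp add: B_linear orth sym norms diag4_def power2_eq_square)
  also have "B z z = m * (\<alpha>'\<^sup>2 + \<beta>'\<^sup>2)"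
    unfolding z_def using xy symmetric[of y x] by (simp add: B_linear power2_eq_square algebra_simps)
  finally have "p ^ (e + 2 * j) dvd diag4 n1 n2 n3 n4 d1 d2 d3 d4"
    unfolding m_def by (metis dvd_mult dvd_triv_left mult.assoc)
  from anisotropic_descent[OF aniso _ this] p
  obtain y1 y2 y3 y4 where y: "d1 = p ^ Suc j * y1" "d2 = p ^ Suc j * y2" "d3 = p ^ Suc j * y3"
    "d4 = p ^ Suc j * y4" by (auto elim!: dvdE)
  define w where "w = smul y1 k1 + smul y2 k2 + smul y3 k3 + smul y4 k4"
  have "smul (p ^ Suc j) w = smul (P * \<alpha>') x + smul (P * \<beta>') y"
    using Pz unfolding r_def y w_def z_def by (simp add: scale_right_distrib)
  moreover have "p ^ Suc j \<noteq> 0" using p by simp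
  ultimately have "p ^ Suc j dvd P * \<alpha>'" "p ^ Suc j dvd P * \<beta>'" using prim by blast+
  then have "p ^ Suc j dvd gcd (P * \<alpha>') (P * \<beta>')" by simp
  also have "gcd (P * \<alpha>') (P * \<beta>') = P" using ab'(3) P by (simp add: gcd_mult_distrib_int[symmetric])
  finally show False using zdvd_imp_le[OF _ P] Pj by fastforce
qed

section \<open>Anisotropic diagonal forms\<close>

lemma square_mod_8: "(x::int)\<^sup>2 mod 8 = (if odd x then 1 else if 4 dvd x then 0 else 4)"
proof -
  have "x mod 8 = 0 \<or> x mod 8 = 1 \<or> x mod 8 = 2 \<or> x mod 8 = 3 \<or> x mod 8 = 4 \<or> x mod 8 = 5
      \<or> x mod 8 = 6 \<or> x mod 8 = 7"
    by presburger
  moreover have "x\<^sup>2 mod 8 = (x mod 8)\<^sup>2 mod 8" by (simp add: power_mod)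
  moreover have "odd x \<longleftrightarrow> odd (x mod 8)" by presburger
  moreover have "4 dvd x \<longleftrightarrow> 4 dvd (x mod 8)" by presburger
  ultimately show ?thesis by (elim disjE) simp_all
qed

text \<open>The exponent 3 is due to 1 + 1 + 1 + 1 = 4: four odd squares vanish mod 4, but add up to
  4 mod 8.\<close>

lemma anisotropic_mod_1111: "anisotropic_mod 2 3 1 1 1 1"
  unfolding anisotropic_mod_def
proof (intro allI impI)
  fix x1 x2 x3 x4 :: int
  assume "2 ^ 3 dvd diag4 1 1 1 1 x1 x2 x3 x4"
  then have "(x1\<^sup>2 + x2\<^sup>2 + x3\<^sup>2 + x4\<^sup>2) mod 8 = 0" by (simp add: diag4_def)
  moreover have "(x1\<^sup>2 + x2\<^sup>2 + x3\<^sup>2 + x4\<^sup>2) mod 8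
    = (x1\<^sup>2 mod 8 + x2\<^sup>2 mod 8 + x3\<^sup>2 mod 8 + x4\<^sup>2 mod 8) mod 8"
    unfolding cong_def[symmetric] by (intro cong_add) (simp_all add: cong_def)
  ultimately have sum: "(x1\<^sup>2 mod 8 + x2\<^sup>2 mod 8 + x3\<^sup>2 mod 8 + x4\<^sup>2 mod 8) mod 8 = 0" by (simp only:)
  have even: "even x \<longleftrightarrow> x\<^sup>2 mod 8 \<noteq> 1" for x :: int by (simp add: square_mod_8)
  have v: "x\<^sup>2 mod 8 = 0 \<or> x\<^sup>2 mod 8 = 1 \<or> x\<^sup>2 mod 8 = 4" for x :: int by (simp add: square_mod_8)
  show "2 dvd x1 \<and> 2 dvd x2 \<and> 2 dvd x3 \<and> 2 dvd x4"
    unfolding even using v[of x1] v[of x2] v[of x3] v[of x4] sum by (elim disjE) simp_all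
qed

lemma square_mod_4: "(x::int)\<^sup>2 mod 4 = (if odd x then 1 else 0)"
proof -
  have "x\<^sup>2 mod 4 = (x\<^sup>2 mod 8) mod 4" by (simp add: mod_mod_cancel)
  then show ?thesis unfolding square_mod_8 by simp
qed

lemma half_mod_4:
  fixes X Y k :: int
  assumes "X + 2 * Y = 8 * k"
  shows "X mod 8 = 2 \<Longrightarrow> Y mod 4 = 3" "X mod 8 = 4 \<Longrightarrow> Y mod 4 = 2"
proof -
  show "Y mod 4 = 3" if X: "X mod 8 = 2"
  proof -
    obtain q where "X = 8 * q + 2" using X by (metis mult_div_mod_eq)
    then have "2 * Y = 2 * (4 * (k - q - 1) + 3)" using assms by (simp add: algebra_simps)
    then have "Y = 4 * (k - q - 1) + 3" by (simp only: mult_cancel_left) simp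
    then show ?thesis by (simp only: mod_mult_self4) simp
  qed
  show "Y mod 4 = 2" if X: "X mod 8 = 4"
  proof -
    obtain q where "X = 8 * q + 4" using X by (metis mult_div_mod_eq)
    then have "2 * Y = 2 * (4 * (k - q - 1) + 2)" using assms by (simp add: algebra_simps)
    then have "Y = 4 * (k - q - 1) + 2" by (simp only: mult_cancel_left) simp
    then show ?thesis by (simp only: mod_mult_self4) simp
  qed
qed

text \<open>With q(x, y) = x^2 + n y^2 the form is q + 2 q. If \<open>x1\<close> and
  \<open>x2\<close> were odd, q(x1, x2) would be 1 + n mod 8, and q(x3, x4) would be a residue mod 4
  that q never takes. Once they are even, division by 2 exchanges the roles of the blocks and leaves
  a congruence mod 8.\<close>

lemma anisotropic_mod_binary_2:
  assumes n: "n = 1 \<or> n = (3::int)"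
  shows "anisotropic_mod 2 4 1 n 2 (2 * n)"
  unfolding anisotropic_mod_def
proof (intro allI impI)
  fix x1 x2 x3 x4 :: int
  assume "2 ^ 4 dvd diag4 1 n 2 (2 * n) x1 x2 x3 x4"
  then obtain k where k: "x1\<^sup>2 + n * x2\<^sup>2 + 2 * (x3\<^sup>2 + n * x4\<^sup>2) = 16 * k"
    by (auto simp: diag4_def algebra_simps elim: dvdE)
  have not2: "(y\<^sup>2 + n * z\<^sup>2) mod 4 \<noteq> (if n = 1 then 3 else 2)" for y z :: int
  proof -
    have "(y\<^sup>2 + n * z\<^sup>2) mod 4 = (y\<^sup>2 mod 4 + n * (z\<^sup>2 mod 4)) mod 4"
      unfolding cong_def[symmetric] by (intro cong_add cong_mult cong_refl) (simp_all add: cong_def)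
    then show ?thesis unfolding square_mod_4 using n by auto
  qed
  have odd8: "(y\<^sup>2 + n * z\<^sup>2) mod 8 = (1 + n) mod 8" if "odd y" "odd z" for y z :: int
  proof -
    have "(y\<^sup>2 + n * z\<^sup>2) mod 8 = (y\<^sup>2 mod 8 + n * (z\<^sup>2 mod 8)) mod 8"
      unfolding cong_def[symmetric] by (intro cong_add cong_mult cong_refl) (simp_all add: cong_def)
    then show ?thesis unfolding square_mod_8 using that by simp
  qed
  have even12: "even x1 \<longleftrightarrow> even x2"
  proof -
    have "even (x1\<^sup>2 + n * x2\<^sup>2 + 2 * (x3\<^sup>2 + n * x4\<^sup>2))" unfolding k by simp
    then show ?thesis using n by auto
  qed
  have x12: "even x1" "even x2"
  proof -
    have "False" if "odd x1"
    proof -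
      have "(x1\<^sup>2 + n * x2\<^sup>2) mod 8 = (1 + n) mod 8" using that even12 odd8 by blast
      moreover have "(x1\<^sup>2 + n * x2\<^sup>2) + 2 * (x3\<^sup>2 + n * x4\<^sup>2) = 8 * (2 * k)" using k by simp
      ultimately have "(x3\<^sup>2 + n * x4\<^sup>2) mod 4 = (if n = 1 then 3 else 2)"
        using n half_mod_4[of "x1\<^sup>2 + n * x2\<^sup>2" "x3\<^sup>2 + n * x4\<^sup>2" "2 * k"] by auto
      then show False using not2 by blast
    qed
    then show "even x1" "even x2" using even12 by blast+
  qed
  then obtain y1 y2 where y: "x1 = 2 * y1" "x2 = 2 * y2" by (auto elim!: evenE)
  have k': "2 * (y1\<^sup>2 + n * y2\<^sup>2) + (x3\<^sup>2 + n * x4\<^sup>2) = 8 * k"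
    using k unfolding y by (simp add: power_mult_distrib)
  have even34: "even x3 \<longleftrightarrow> even x4"
  proof -
    have "even (2 * (y1\<^sup>2 + n * y2\<^sup>2) + (x3\<^sup>2 + n * x4\<^sup>2))" unfolding k' by simp
    then show ?thesis using n by auto
  qed
  have "False" if "odd x3"
  proof -
    have "(x3\<^sup>2 + n * x4\<^sup>2) mod 8 = (1 + n) mod 8" using that even34 odd8 by blast
    moreover have "(x3\<^sup>2 + n * x4\<^sup>2) + 2 * (y1\<^sup>2 + n * y2\<^sup>2) = 8 * k" using k' by simp
    ultimately have "(y1\<^sup>2 + n * y2\<^sup>2) mod 4 = (if n = 1 then 3 else 2)"
      using n half_mod_4[of "x3\<^sup>2 + n * x4\<^sup>2" "y1\<^sup>2 + n * y2\<^sup>2" k] by auto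
    then show False using not2 by blast
  qed
  then have "even x3" by blast
  then show "2 dvd x1 \<and> 2 dvd x2 \<and> 2 dvd x3 \<and> 2 dvd x4" using x12 even34 by blast
qed

definition binary_anisotropic_mod :: "int \<Rightarrow> int \<Rightarrow> int \<Rightarrow> bool" where
  "binary_anisotropic_mod p m n \<longleftrightarrow>
     (\<forall>x y. p dvd m * x\<^sup>2 + n * y\<^sup>2 \<longrightarrow> p dvd x \<and> p dvd y)"

text \<open>Mod p only the first block is left. When p divides its variables, its value is divisible
  by p^2, and division by p exposes the second block.\<close>

lemma anisotropic_mod_odd:
  assumes p: "p \<noteq> 0" and mn: "binary_anisotropic_mod p m n" and mn': "binary_anisotropic_mod p m' n'"
  shows "anisotropic_mod p 2 m n (p * m') (p * n')"
  unfolding anisotropic_mod_def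
proof (intro allI impI)
  fix x1 x2 x3 x4 :: int
  assume *: "p ^ 2 dvd diag4 m n (p * m') (p * n') x1 x2 x3 x4"
  have eq: "diag4 m n (p * m') (p * n') x1 x2 x3 x4 = (m * x1\<^sup>2 + n * x2\<^sup>2) + p * (m' * x3\<^sup>2 + n' * x4\<^sup>2)"
    by (simp add: diag4_def algebra_simps)
  have "p dvd (m * x1\<^sup>2 + n * x2\<^sup>2) + p * (m' * x3\<^sup>2 + n' * x4\<^sup>2)"
    using * unfolding eq power2_eq_square by (metis dvd_mult_left)
  then have "p dvd m * x1\<^sup>2 + n * x2\<^sup>2" by (simp add: dvd_add_left_iff)
  then have x12: "p dvd x1" "p dvd x2" using mn unfolding binary_anisotropic_mod_def by blast+
  then obtain y1 y2 where y: "x1 = p * y1" "x2 = p * y2" by (auto elim!: dvdE)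
  have "p * p dvd p * (p * (m * y1\<^sup>2 + n * y2\<^sup>2) + (m' * x3\<^sup>2 + n' * x4\<^sup>2))"
    using *[unfolded eq] unfolding y by (simp add: power2_eq_square algebra_simps)
  then have "p dvd p * (m * y1\<^sup>2 + n * y2\<^sup>2) + (m' * x3\<^sup>2 + n' * x4\<^sup>2)" using p by simp
  then have "p dvd m' * x3\<^sup>2 + n' * x4\<^sup>2" by (simp add: dvd_add_right_iff)
  then have "p dvd x3" "p dvd x4" using mn' unfolding binary_anisotropic_mod_def by blast+
  then show "p dvd x1 \<and> p dvd x2 \<and> p dvd x3 \<and> p dvd x4" using x12 by blast
qed

lemma binary_anisotropic_modI:
  assumes "\<And>x y. x \<in> {0..<p} \<Longrightarrow> y \<in> {0..<p} \<Longrightarrow> (m * x\<^sup>2 + n * y\<^sup>2) mod p = 0 \<Longrightarrow> x = 0 \<and> y = 0"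
    and "p > 0"
  shows "binary_anisotropic_mod p m n"
  unfolding binary_anisotropic_mod_def
proof (intro allI impI)
  fix x y :: int
  assume *: "p dvd m * x\<^sup>2 + n * y\<^sup>2"
  have "[m * (x mod p)\<^sup>2 + n * (y mod p)\<^sup>2 = m * x\<^sup>2 + n * y\<^sup>2] (mod p)"
    by (intro cong_add cong_mult cong_refl cong_pow) (simp_all add: cong_def)
  then have "(m * (x mod p)\<^sup>2 + n * (y mod p)\<^sup>2) mod p = (m * x\<^sup>2 + n * y\<^sup>2) mod p"
    by (simp add: cong_def)
  then have "(m * (x mod p)\<^sup>2 + n * (y mod p)\<^sup>2) mod p = 0" using * by simp
  then have "x mod p = 0 \<and> y mod p = 0" using assms by (intro assms(1)) auto
  then show "p dvd x \<and> p dvd y" by (simp add: dvd_eq_mod_eq_0)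
qed

lemma interval_sets:
  "{0..<3::int} = {0, 1, 2}" "{0..<5::int} = {0, 1, 2, 3, 4}" "{0..<7::int} = {0, 1, 2, 3, 4, 5, 6}"
  by auto

text \<open>-1 is not a square mod 3, and -2 is a square neither mod 5 nor mod 7.\<close>

lemma binary_anisotropic_mod_cases:
  "binary_anisotropic_mod 3 1 1" "binary_anisotropic_mod 3 2 2" "binary_anisotropic_mod 5 1 2"
  "binary_anisotropic_mod 7 1 2"
  by (rule binary_anisotropic_modI; auto simp: interval_sets)+

lemma anisotropic_mod_cases:
  "anisotropic_mod 2 4 1 1 2 2" "anisotropic_mod 2 4 1 3 2 6" "anisotropic_mod 3 2 2 2 6 6"
  "anisotropic_mod 3 2 2 2 3 3" "anisotropic_mod 5 2 1 2 5 10" "anisotropic_mod 7 2 1 2 7 14"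
proof -
  note b = binary_anisotropic_mod_cases
  show "anisotropic_mod 2 4 1 1 2 2" using anisotropic_mod_binary_2[of 1] by simp
  show "anisotropic_mod 2 4 1 3 2 6" using anisotropic_mod_binary_2[of 3] by simp
  show "anisotropic_mod 3 2 2 2 6 6" using anisotropic_mod_odd[OF _ b(2) b(2)] by simp
  show "anisotropic_mod 3 2 2 2 3 3" using anisotropic_mod_odd[OF _ b(2) b(1)] by simp
  show "anisotropic_mod 5 2 1 2 5 10" using anisotropic_mod_odd[OF _ b(3) b(3)] by simp
  show "anisotropic_mod 7 2 1 2 7 14" using anisotropic_mod_odd[OF _ b(4) b(4)] by simp
qed

lemma small_square: "(x::int)\<^sup>2 \<le> 3 \<Longrightarrow> x \<in> {- 1, 0, 1}"
proof -
  assume *: "x\<^sup>2 \<le> 3"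
  have "\<bar>x\<bar> < 2"
  proof (rule ccontr)
    assume "\<not> \<bar>x\<bar> < 2"
    then have "2\<^sup>2 \<le> \<bar>x\<bar>\<^sup>2" by (intro power_mono) auto
    then show False using * by simp
  qed
  then show ?thesis by auto
qed

lemma small_square_sum:
  fixes a b c :: int
  assumes "a\<^sup>2 + b\<^sup>2 + c\<^sup>2 \<le> 3"
  shows "{a, b, c} \<subseteq> {- 1, 0, 1}"
  using assms zero_le_power2[of a] zero_le_power2[of b] zero_le_power2[of c]
  unfolding insert_subset by (intro conjI small_square empty_subsetI) linarith+

section \<open>Lattices of rank at most 5\<close>

text \<open>
  A lattice of rank 5 and determinant \<open>d\<close> contains an anisotropic frame in the orthogonal complement
  of a vector whose norm is \<open>d\<close> up to squares: there the determinant is a square, so that the form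
  is a multiple of the norm form of a definite quaternion algebra. All frames below arise in this way.
\<close>

lemma (in Z_lattice) Z_rank_ge_6:
  assumes univ: "primitively_2_universal smul B"
  shows "6 \<le> Z_rank smul"
proof (rule ccontr)
  assume "\<not> 6 \<le> Z_rank smul"
  then have rank: "Z_rank smul < 6" by simp
  note frame = no_anisotropic_frame[OF univ rank]
  note vectors = primitive_vectors[OF univ]
  note lin = B_linear
  obtain e1 e2 where e: "B e1 e1 = 1" "B e1 e2 = 0" "B e2 e2 = 1" "B e2 e1 = 0"
  proof -
    obtain x y where "B x x = 1" "B x y = 0" "B y y = 1" by (rule vectors[of 1 1 0]) auto
    then show ?thesis using that symmetric[of y x] by simp
  qed
  \<comment> \<open>The frame at the prime 2 that excludes orthogonal pairs of norm-2 vectors in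
    both cases below.\<close>
  have F1122: False
    if "B r e1 = 0" "B r e2 = 0" "B r' e1 = 0" "B r' e2 = 0" "B r r = 2" "B r' r' = 2" "B r r' = 0"
    for r r'
    by (rule frame[of e1 e2 r r' 1 1 2 2 2 4])
      (use that e symmetric[of e1 r] symmetric[of e2 r] symmetric[of e1 r'] symmetric[of e2 r']
        anisotropic_mod_cases(1) in simp_all)
  show False
  proof (cases "\<exists>e3. B e3 e3 = 1 \<and> B e3 e1 = 0 \<and> B e3 e2 = 0")
    case True
    then obtain e3 where e3: "B e3 e3 = 1" "B e3 e1 = 0" "B e3 e2 = 0" "B e1 e3 = 0" "B e2 e3 = 0"
      using symmetric by metis
    define perp where "perp x \<longleftrightarrow> B x e1 = 0 \<and> B x e2 = 0 \<and> B x e3 = 0" for x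
    \<comment> \<open>The vectors projected away have norm 1, so the orthogonal projection stays in
      the lattice.\<close>
    define pr where "pr x = x - smul (B x e1) e1 - smul (B x e2) e2 - smul (B x e3) e3" for x
    have perp_pr: "perp (pr x)" for x by (simp add: perp_def pr_def lin e e3)
    have B_pr: "B (pr x) (pr y) = B x y - B x e1 * B y e1 - B x e2 * B y e2 - B x e3 * B y e3" for x y
      using symmetric[of e1 y] symmetric[of e2 y] symmetric[of e3 y] by (simp add: pr_def lin e e3)
    have perp_sym: "B e1 x = 0" "B e2 x = 0" "B e3 x = 0" if "perp x" for x
      using that symmetric[of _ x] by (simp_all add: perp_def)
    have no1: "B x x \<noteq> 1" if "perp x" for x
    proof
      assume "B x x = 1"
      then show False
        by (intro frame[of e1 e2 e3 x 1 1 1 1 2 3])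
          (use that e e3 perp_sym[OF that] anisotropic_mod_1111 in simp_all)
    qed
    have zero: "B (pr x) y = 0" if "B (pr x) (pr x) = 0" for x y
      using that by (simp add: B_eq_0 lin)
    \<comment> \<open>By Bessel's inequality, the projections of vectors of norm at most 3 are a
      matter of finitely many cases.\<close>
    have coords: "{B x e1, B x e2, B x e3} \<subseteq> {- 1, 0, 1}" if "B x x \<le> 3" for x
    proof (rule small_square_sum)
      show "(B x e1)\<^sup>2 + (B x e2)\<^sup>2 + (B x e3)\<^sup>2 \<le> 3"
        using B_nonneg[of "pr x"] that unfolding B_pr by (simp add: power2_eq_square)
    qed
    \<comment> \<open>Z^3 plus a hexagonal plane has determinant 3; the frame is orthogonal to
      \<open>e1 + e2 + e3\<close>, of norm 3.\<close>
    have A2: False if f: "perp f1" "perp f2" "B f1 f1 = 2" "B f2 f2 = 2" "B f1 f2 = 1" for f1 f2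
    proof -
      have "B f2 f1 = 1" using f symmetric by metis
      then show False
        by (intro frame[of f1 "e1 - e2" "smul 2 f2 - f1" "e1 + e2 - smul 2 e3" 2 2 6 6 3 2])
          (use f e e3 perp_sym[OF f(1)] perp_sym[OF f(2)] anisotropic_mod_cases(3)
            in \<open>simp_all add: perp_def lin\<close>)
    qed
    have "\<exists>f. perp f \<and> B f f = 2"
    proof -
      obtain x y where xy: "B x x = 2" "B x y = 1" "B y y = 3" by (rule vectors[of 2 3 1]) auto
      have cx: "{B x e1, B x e2, B x e3} \<subseteq> {- 1, 0, 1}" using coords[of x] xy by simp
      have cy: "{B y e1, B y e2, B y e3} \<subseteq> {- 1, 0, 1}" using coords[of y] xy by simp
      \<comment> \<open>All values of the products with \<open>e1\<close>, \<open>e2\<close>,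
        \<open>e3\<close> are tried. \<open>no1\<close> discards projections of norm 1, and a
        projection of norm 0 vanishes, so its product with the other one must be 0. The same method
        is used for all small binary forms below.\<close>
      have "B (pr x) (pr x) = 2 \<or> B (pr y) (pr y) = 2"
        using cx cy no1[OF perp_pr, of x] no1[OF perp_pr, of y] B_nonneg[of "pr x"] zero[of x "pr y"]
          zero[of y "pr x"] symmetric[of "pr x" "pr y"]
        unfolding B_pr xy insert_subset insert_iff empty_iff by (elim conjE disjE FalseE) simp_all
      then show ?thesis using perp_pr by blast
    qed
    then obtain f where f: "perp f" "B f f = 2" by blast
    have "\<exists>g. perp g \<and> B g g = 3"
    proof -
      obtain x y where xy: "B x x = 3" "B x y = 0" "B y y = 3" by (rule vectors[of 3 3 0]) auto
      have cx: "{B x e1, B x e2, B x e3} \<subseteq> {- 1, 0, 1}" using coords[of x] xy by simp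
      have cy: "{B y e1, B y e2, B y e3} \<subseteq> {- 1, 0, 1}" using coords[of y] xy by simp
      have "B (pr x) (pr x) = 3 \<or> B (pr y) (pr y) = 3 \<or> (B (pr x) (pr x) = 2 \<and> B (pr y) (pr y) = 2 \<and>
          (B (pr x) (pr y) = 0 \<or> B (pr x) (pr y) = 1 \<or> B (pr x) (pr y) = - 1))"
        using cx cy no1[OF perp_pr, of x] no1[OF perp_pr, of y] B_nonneg[of "pr x"] zero[of x "pr y"]
          zero[of y "pr x"] symmetric[of "pr x" "pr y"]
        unfolding B_pr xy insert_subset insert_iff empty_iff by (elim conjE disjE FalseE) simp_all
      moreover have False if *: "B (pr x) (pr x) = 2" "B (pr y) (pr y) = 2" "B (pr x) (pr y) = 0"
        using F1122[of "pr x" "pr y"] * perp_pr[of x] perp_pr[of y] by (simp add: perp_def)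
      moreover have False if *: "B (pr x) (pr x) = 2" "B (pr y) (pr y) = 2" "B (pr x) (pr y) = 1"
        by (rule A2[OF perp_pr perp_pr *])
      moreover have False if *: "B (pr x) (pr x) = 2" "B (pr y) (pr y) = 2" "B (pr x) (pr y) = - 1"
        using A2[of "pr x" "- pr y"] * perp_pr[of x] perp_pr[of y] by (simp add: perp_def lin)
      ultimately show ?thesis using perp_pr by blast
    qed
    then obtain g where g: "perp g" "B g g = 3" by blast
    have gf: "B g f = B f g" by (rule symmetric)
    \<comment> \<open>A product of 2 or -2 would give \<open>g - f\<close> or \<open>g + f\<close>
      the norm 1, and larger ones a negative norm.\<close>
    have fg: "B f g = - 1 \<or> B f g = 0 \<or> B f g = 1"
    proof -
      have "perp (g + f)" "perp (g - f)" using f g by (simp_all add: perp_def lin)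
      then have "B (g + f) (g + f) \<noteq> 1" "B (g - f) (g - f) \<noteq> 1" using no1 by blast+
      moreover have "B (g + f) (g + f) = 5 + 2 * B f g" "B (g - f) (g - f) = 5 - 2 * B f g"
        using f g gf by (simp_all add: lin)
      moreover have "B (g + f) (g + f) \<ge> 0" "B (g - f) (g - f) \<ge> 0" by (rule B_nonneg)+
      ultimately show ?thesis by presburger
    qed
    note facts = f g gf e e3 perp_sym[OF f(1)] perp_sym[OF g(1)]
    \<comment> \<open>Determinant 5; the frame is orthogonal to \<open>e1 - 2 e2\<close>, of norm
      5.\<close>
    have K5: False if g': "perp g'" "B g' g' = 3" "B f g' = 1" for g'
    proof -
      have "B g' f = 1" using g' symmetric by metis
      then show False
        by (intro frame[of e3 f "smul 2 e1 + e2" "smul 2 g' - f" 1 2 5 10 5 2])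
          (use g' facts perp_sym[OF g'(1)] anisotropic_mod_cases(5) in \<open>simp_all add: perp_def lin\<close>)
    qed
    from fg show False
    proof (elim disjE)
      \<comment> \<open>Determinant 6; the frame is orthogonal to \<open>e1 + e2 - 2 e3\<close>, of
        norm 6.\<close>
      assume "B f g = 0"
      then show False
        by (intro frame[of f "e1 - e2" g "e1 + e2 + e3" 2 2 3 3 3 2])
          (use facts anisotropic_mod_cases(4) in \<open>simp_all add: perp_def lin\<close>)
    next
      assume "B f g = 1"
      then show False using K5[of g] g by simp
    next
      assume "B f g = - 1"
      then show False using K5[of "- g"] g by (simp add: perp_def lin)
    qed
  next
    case False
    define perp where "perp x \<longleftrightarrow> B x e1 = 0 \<and> B x e2 = 0" for x
    define pr where "pr x = x - smul (B x e1) e1 - smul (B x e2) e2" for x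
    have perp_pr: "perp (pr x)" for x by (simp add: perp_def pr_def lin e)
    have B_pr: "B (pr x) (pr y) = B x y - B x e1 * B y e1 - B x e2 * B y e2" for x y
      using symmetric[of e1 y] symmetric[of e2 y] by (simp add: pr_def lin e)
    have perp_sym: "B e1 x = 0" "B e2 x = 0" if "perp x" for x
      using that symmetric[of _ x] by (simp_all add: perp_def)
    have no1: "B x x \<noteq> 1" if "perp x" for x using False that by (auto simp: perp_def)
    have zero: "B (pr x) y = 0" if "B (pr x) (pr x) = 0" for x y
      using that by (simp add: B_eq_0 lin)
    have pr_eq: "pr x = x" if "B x e1 = 0" "B x e2 = 0" for x using that by (simp add: pr_def)
    have coords: "{B x e1, B x e2} \<subseteq> {- 1, 0, 1}"
      if "B x x \<le> 3" for x
      using small_square_sum[of "B x e1" "B x e2" 0] B_nonneg[of "pr x"] that unfolding B_pr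
      by (simp add: power2_eq_square)
    have "\<exists>f1 f2. perp f1 \<and> perp f2 \<and> B f1 f1 = 2 \<and> B f2 f2 = 2 \<and> B f1 f2 = 1"
    proof -
      obtain x y where xy: "B x x = 2" "B x y = 1" "B y y = 2" by (rule vectors[of 2 2 1]) auto
      have c: "{B x e1, B x e2} \<subseteq> {- 1, 0, 1}"
        "{B y e1, B y e2} \<subseteq> {- 1, 0, 1}"
        using coords[of x] coords[of y] xy by simp_all
      have "perp x \<and> perp y"
        using c no1[OF perp_pr, of x] no1[OF perp_pr, of y] zero[of x "pr y"]
          zero[of y "pr x"] symmetric[of "pr x" "pr y"]
        unfolding B_pr xy perp_def insert_subset insert_iff empty_iff
        by (elim conjE disjE FalseE) simp_all
      then show ?thesis using xy by blast
    qed
    then obtain f1 f2 where f: "perp f1" "perp f2" "B f1 f1 = 2" "B f2 f2 = 2" "B f1 f2 = 1" "B f2 f1 = 1"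
      using symmetric by metis
    have "\<exists>g. perp g \<and> B g g = 3"
    proof -
      obtain x y where xy: "B x x = 2" "B x y = 0" "B y y = 3" by (rule vectors[of 2 3 0]) auto
      have c: "{B x e1, B x e2} \<subseteq> {- 1, 0, 1}"
        "{B y e1, B y e2} \<subseteq> {- 1, 0, 1}"
        using coords[of x] coords[of y] xy by simp_all
      have "B (pr y) (pr y) = 3 \<or> (B (pr x) (pr x) = 2 \<and> B (pr y) (pr y) = 2 \<and> B (pr x) (pr y) = 0)"
        using c no1[OF perp_pr, of x] no1[OF perp_pr, of y] zero[of x "pr y"]
          zero[of y "pr x"] symmetric[of "pr x" "pr y"]
        unfolding B_pr xy insert_subset insert_iff empty_iff by (elim conjE disjE FalseE) simp_all
      moreover have False if *: "B (pr x) (pr x) = 2" "B (pr y) (pr y) = 2" "B (pr x) (pr y) = 0"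
        using F1122[of "pr x" "pr y"] * perp_pr[of x] perp_pr[of y] by (simp add: perp_def)
      ultimately show ?thesis using perp_pr by blast
    qed
    then obtain g where g: "perp g" "B g g = 3" by blast
    have bound: "B r g = - 1 \<or> B r g = 0 \<or> B r g = 1" if r: "perp r" "B r r = 2" for r
    proof -
      have "perp (g + r)" "perp (g - r)" using r g by (simp_all add: perp_def lin)
      then have "B (g + r) (g + r) \<noteq> 1" "B (g - r) (g - r) \<noteq> 1" using no1 by blast+
      moreover have "B (g + r) (g + r) = 5 + 2 * B r g" "B (g - r) (g - r) = 5 - 2 * B r g"
        using r g symmetric[of g r] by (simp_all add: lin)
      moreover have "B (g + r) (g + r) \<ge> 0" "B (g - r) (g - r) \<ge> 0" by (rule B_nonneg)+
      ultimately show ?thesis by presburger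
    qed
    have b1: "B f1 g = - 1 \<or> B f1 g = 0 \<or> B f1 g = 1" and b2: "B f2 g = - 1 \<or> B f2 g = 0 \<or> B f2 g = 1"
      using bound f by blast+
    \<comment> \<open>\<open>f1 - f2\<close> also has norm 2, so the products of \<open>g\<close>
      with \<open>f1\<close> and \<open>f2\<close> cannot be opposite and nonzero. The six remaining
      nonzero pairs are equivalent under symmetries of the hexagonal lattice and the sign of
      \<open>g\<close>.\<close>
    have "B (f1 - f2) g = - 1 \<or> B (f1 - f2) g = 0 \<or> B (f1 - f2) g = 1"
      by (rule bound) (use f in \<open>simp_all add: perp_def lin\<close>)
    then have b12: "B f1 g - B f2 g = - 1 \<or> B f1 g - B f2 g = 0 \<or> B f1 g - B f2 g = 1"
      by (simp add: lin)
    \<comment> \<open>Determinant 7; the frame is orthogonal to \<open>2 e1 + k\<close>, of norm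
      7.\<close>
    have K7: False
      if h: "perp h1" "perp h2" "perp k" "B h1 h1 = 2" "B h2 h2 = 2" "B h1 h2 = 1" "B k k = 3"
        "B h1 k = 1" "B h2 k = 1" for h1 h2 k
    proof -
      have s: "B h2 h1 = 1" "B k h1 = 1" "B k h2 = 1" using h symmetric by metis+
      show False
        by (rule frame[of e2 "h1 - h2" "e1 - (h1 + h2)" "smul 2 k - smul 2 e1 - (h1 + h2)" 1 2 7 14 7 2])
          (use h s e perp_sym[OF h(1)] perp_sym[OF h(2)] perp_sym[OF h(3)] anisotropic_mod_cases(6)
            in \<open>simp_all add: perp_def lin\<close>)
    qed
    \<comment> \<open>Determinant 9, a square; the frame is orthogonal to \<open>e2\<close>, of norm
      1.\<close>
    have K6: False if z: "B f1 g = 0" "B f2 g = 0"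
    proof -
      have s: "B g f1 = 0" "B g f2 = 0" using z symmetric by metis+
      show False
        by (rule frame[of e1 g f1 "smul 2 f2 - f1" 1 3 2 6 2 4])
          (use f g z s e perp_sym[OF f(1)] perp_sym[OF f(2)] perp_sym[OF g(1)] anisotropic_mod_cases(2)
            in \<open>simp_all add: perp_def lin\<close>)
    qed
    have perps: "perp (f1 - f2)" "perp (f2 - f1)" "perp (- g)" using f g by (simp_all add: perp_def lin)
    note K7s = K7[OF f(1,2) g(1)] K7[OF f(1,2) perps(3)] K7[OF f(1) perps(1) g(1)]
      K7[OF f(1) perps(1,3)] K7[OF f(2) perps(2) g(1)] K7[OF f(2) perps(2,3)]
    show False
      using b1 b2 b12 K6 K7s f(3-6) g(2) by (elim disjE) (simp_all add: lin)
  qed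
qed

theorem theorem2p4:
  shows "(\<exists>(smul :: int \<Rightarrow> int^6 \<Rightarrow> int^6) B.
            primitively_2_universal smul B \<and> Z_rank smul = 6) \<and>
         (\<forall>(smul :: int \<Rightarrow> 'a::ab_group_add \<Rightarrow> 'a) B.
            primitively_2_universal smul B \<longrightarrow> 6 \<le> Z_rank smul)"
proof (intro conjI allI impI)
  show "\<exists>(smul :: int \<Rightarrow> int^6 \<Rightarrow> int^6) B. primitively_2_universal smul B \<and> Z_rank smul = 6"
    using Z6_primitively_2_universal vec_rank[where 'n = 6] by auto
  fix smul :: "int \<Rightarrow> 'a \<Rightarrow> 'a" and B
  assume univ: "primitively_2_universal smul B"
  then interpret Z_lattice smul B by (simp add: primitively_2_universal_def)
  show "6 \<le> Z_rank smul" using univ by (rule Z_rank_ge_6)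
qed

end
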